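(* Let $p>0$ be a prime number, let $R\to S$ be a finite flat homomorphism of noetherian local rings of characteristic $p$, and let $P\in\operatorname{Spec}(R)$. If $S/\sqrt{PS}$ is weakly $F$-nilpotent, then $R/P$ is weakly $F$-nilpotent.
   Context: A noetherian local ring $(A,\mathfrak m)$ of prime characteristic $p$ with Frobenius map $F$ is called weakly $F$-nilpotent if for every $i<\dim A$, every element of the local cohomology module $H^i_{\mathfrak m}(A)$ is annihilated by some power $F^n$ of the natural Frobenius action on $H^i_{\mathfrak m}(A)$. $PS$ is the ideal of $S$ generated by the image of $P$ and $\sqrt{PS}$ is its radical. *)

theory Defs
  imports
    "HOL-Algebra.Algebra"
    "HOL-Algebra.Free_Abelian_Groups"
    "HOL-Algebra.Product_Groups"
    "HOL-Library.Extended_Nat"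
begin

section \<open>Noetherian local rings, characteristic, radicals and dimension\<close>

definition local_ring :: "('a, 'm) ring_scheme \<Rightarrow> bool" where
  "local_ring A \<longleftrightarrow> cring A \<and> (\<exists>!M. maximalideal M A)"

definition max_ideal :: "('a, 'm) ring_scheme \<Rightarrow> 'a set" where
  "max_ideal A = (THE M. maximalideal M A)"

definition noetherian_local_ring :: "('a, 'm) ring_scheme \<Rightarrow> bool" where
  "noetherian_local_ring A \<longleftrightarrow> noetherian_ring A \<and> local_ring A"

definition has_char :: "('a, 'm) ring_scheme \<Rightarrow> nat \<Rightarrow> bool" where
  "has_char A p \<longleftrightarrow> (\<forall>n::nat. [n] \<cdot>\<^bsub>A\<^esub> \<one>\<^bsub>A\<^esub> = \<zero>\<^bsub>A\<^esub> \<longleftrightarrow> p dvd n)"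

definition radical :: "('a, 'm) ring_scheme \<Rightarrow> 'a set \<Rightarrow> 'a set" where
  "radical A I = {a \<in> carrier A. \<exists>n::nat. a [^]\<^bsub>A\<^esub> n \<in> I}"

text \<open>Supremum of the lengths \<open>n\<close> of strict chains \<open>Q 0 \<subset> \<dots> \<subset> Q n\<close> of prime ideals.\<close>

definition krull_dim :: "('a, 'm) ring_scheme \<Rightarrow> enat" where
  "krull_dim A =
     Sup {enat n | n. \<exists>Q :: nat \<Rightarrow> 'a set.
            (\<forall>i\<le>n. primeideal (Q i) A) \<and> (\<forall>i<n. Q i \<subset> Q (Suc i))}"


section \<open>Finite and flat modules\<close>

text \<open>\<open>S\<close> as an \<open>R\<close>-module along \<open>\<phi> : R \<rightarrow> S\<close>.\<close>

definition scalar_restriction ::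
    "('b, 'm) ring_scheme \<Rightarrow> ('a \<Rightarrow> 'b) \<Rightarrow> ('a, 'b) module" where
  "scalar_restriction S \<phi> =
     \<lparr>carrier = carrier S, monoid.mult = monoid.mult S, one = \<one>\<^bsub>S\<^esub>, ring.zero = \<zero>\<^bsub>S\<^esub>,
      add = add S, smult = (\<lambda>r s. \<phi> r \<otimes>\<^bsub>S\<^esub> s)\<rparr>"

definition fin_gen_module ::
    "('a, 'm) ring_scheme \<Rightarrow> ('a, 'b, 'n) module_scheme \<Rightarrow> bool" where
  "fin_gen_module R M \<longleftrightarrow> module R M \<and>
     (\<exists>B \<subseteq> carrier M. finite B \<and>
        (\<forall>x \<in> carrier M. \<exists>c \<in> B \<rightarrow> carrier R. x = (\<Oplus>\<^bsub>M\<^esub>b\<in>B. c b \<odot>\<^bsub>M\<^esub> b)))"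

definition module_hom ::
    "('a, 'm) ring_scheme \<Rightarrow> ('a, 'b, 'n) module_scheme \<Rightarrow> ('a, 'c, 'k) module_scheme
      \<Rightarrow> ('b \<Rightarrow> 'c) set" where
  "module_hom R M N =
     {f \<in> carrier M \<rightarrow> carrier N.
        (\<forall>x \<in> carrier M. \<forall>y \<in> carrier M. f (x \<oplus>\<^bsub>M\<^esub> y) = f x \<oplus>\<^bsub>N\<^esub> f y) \<and>
        (\<forall>r \<in> carrier R. \<forall>x \<in> carrier M. f (r \<odot>\<^bsub>M\<^esub> x) = r \<odot>\<^bsub>N\<^esub> f x)}"

definition tensor_relations ::
    "('a, 'm) ring_scheme \<Rightarrow> ('a, 'b, 'n) module_scheme \<Rightarrow> ('a, 'c, 'k) module_scheme
      \<Rightarrow> (('b \<times> 'c) \<Rightarrow>\<^sub>0 int) set" where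
  "tensor_relations R M P =
     generate (free_Abelian_group (carrier M \<times> carrier P))
       ({frag_of (x \<oplus>\<^bsub>M\<^esub> x', y) - frag_of (x, y) - frag_of (x', y) | x x' y.
           x \<in> carrier M \<and> x' \<in> carrier M \<and> y \<in> carrier P} \<union>
        {frag_of (x, y \<oplus>\<^bsub>P\<^esub> y') - frag_of (x, y) - frag_of (x, y') | x y y'.
           x \<in> carrier M \<and> y \<in> carrier P \<and> y' \<in> carrier P} \<union>
        {frag_of (r \<odot>\<^bsub>M\<^esub> x, y) - frag_of (x, r \<odot>\<^bsub>P\<^esub> y) | r x y.
           r \<in> carrier R \<and> x \<in> carrier M \<and> y \<in> carrier P})"

definition tensor_product ::
    "('a, 'm) ring_scheme \<Rightarrow> ('a, 'b, 'n) module_scheme \<Rightarrow> ('a, 'c, 'k) module_scheme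
      \<Rightarrow> (('b \<times> 'c) \<Rightarrow>\<^sub>0 int) set monoid" where
  "tensor_product R M P =
     free_Abelian_group (carrier M \<times> carrier P) Mod tensor_relations R M P"

text \<open>The map \<open>f \<otimes> P : M \<otimes> P \<rightarrow> N \<otimes> P\<close>, computed on all representatives of a coset at once.\<close>

definition tensor_map ::
    "('a, 'm) ring_scheme \<Rightarrow> ('a, 'b, 'n) module_scheme \<Rightarrow> ('a, 'c, 'k) module_scheme
      \<Rightarrow> ('b \<Rightarrow> 'd) \<Rightarrow> ('a, 'd, 'l) module_scheme
      \<Rightarrow> (('b \<times> 'c) \<Rightarrow>\<^sub>0 int) set \<Rightarrow> (('d \<times> 'c) \<Rightarrow>\<^sub>0 int) set" where
  "tensor_map R M P f N U =
     (\<Union>t\<in>U. tensor_relations R N P #>\<^bsub>free_Abelian_group (carrier N \<times> carrier P)\<^esub>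
               frag_extend (\<lambda>(x, y). frag_of (f x, y)) t)"

text \<open>
  Flatness: \<open>- \<otimes> P\<close> preserves injections.  HOL cannot quantify over modules on all types inside
  a definition.  The type \<open>(nat \<Rightarrow> 'a) set\<close> carries an isomorphic copy of every quotient of
  every \<open>R\<^sup>n\<close>, hence of every finitely generated \<open>R\<close>-module, and of every ideal of \<open>R\<close>.  Since
  tensor products commute with filtered colimits (or by the ideal criterion), preservation of
  injections between such modules is the same as preservation of all injections.
\<close>

definition flat_module ::
    "('a, 'm) ring_scheme \<Rightarrow> ('a, 'b, 'n) module_scheme \<Rightarrow> bool" where
  "flat_module R P \<longleftrightarrow> module R P \<and>
     (\<forall>(M :: ('a, (nat \<Rightarrow> 'a) set) module) (N :: ('a, (nat \<Rightarrow> 'a) set) module) f.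
        module R M \<and> module R N \<and> f \<in> module_hom R M N \<and> inj_on f (carrier M) \<longrightarrow>
        inj_on (tensor_map R M P f N) (carrier (tensor_product R M P)))"


section \<open>Localisation at an element\<close>

text \<open>
  The fraction \<open>a / f\<^sup>n\<close> is the class of all pairs \<open>(b, m)\<close> such that
  \<open>f\<^sup>k (f\<^sup>m a - f\<^sup>n b) = 0\<close> for some \<open>k\<close>.
\<close>

definition fraction :: "('a, 'm) ring_scheme \<Rightarrow> 'a \<Rightarrow> 'a \<Rightarrow> nat \<Rightarrow> ('a \<times> nat) set" where
  "fraction A f a n =
     {(b, m). b \<in> carrier A \<and>
        (\<exists>k::nat. f [^]\<^bsub>A\<^esub> k \<otimes>\<^bsub>A\<^esub> (f [^]\<^bsub>A\<^esub> m \<otimes>\<^bsub>A\<^esub> a) = f [^]\<^bsub>A\<^esub> k \<otimes>\<^bsub>A\<^esub> (f [^]\<^bsub>A\<^esub> n \<otimes>\<^bsub>A\<^esub> b))}"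

definition localization :: "('a, 'm) ring_scheme \<Rightarrow> 'a \<Rightarrow> ('a \<times> nat) set ring" where
  "localization A f =
     \<lparr>carrier = {fraction A f a n | a n. a \<in> carrier A},
      monoid.mult = (\<lambda>U V. \<Union>(a, n)\<in>U. \<Union>(b, m)\<in>V. fraction A f (a \<otimes>\<^bsub>A\<^esub> b) (n + m)),
      one = fraction A f \<one>\<^bsub>A\<^esub> 0,
      ring.zero = fraction A f \<zero>\<^bsub>A\<^esub> 0,
      add = (\<lambda>U V. \<Union>(a, n)\<in>U. \<Union>(b, m)\<in>V.
               fraction A f (f [^]\<^bsub>A\<^esub> m \<otimes>\<^bsub>A\<^esub> a \<oplus>\<^bsub>A\<^esub> f [^]\<^bsub>A\<^esub> n \<otimes>\<^bsub>A\<^esub> b) (n + m))\<rparr>"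

text \<open>
  The canonical map \<open>A\<^sub>f \<rightarrow> A\<^sub>g\<close>, for \<open>f\<close> dividing \<open>g\<close>: the image of \<open>a / f\<^sup>n\<close> is
  the class of all \<open>b / g\<^sup>m\<close> such that \<open>g\<^sup>m a\<close> and \<open>f\<^sup>n b\<close> agree in \<open>A\<^sub>g\<close>.
\<close>

definition localization_map ::
    "('a, 'm) ring_scheme \<Rightarrow> 'a \<Rightarrow> 'a \<Rightarrow> ('a \<times> nat) set \<Rightarrow> ('a \<times> nat) set" where
  "localization_map A f g U =
     {(b, m). b \<in> carrier A \<and>
        (\<exists>(a, n)\<in>U. \<exists>k::nat.
           g [^]\<^bsub>A\<^esub> k \<otimes>\<^bsub>A\<^esub> (g [^]\<^bsub>A\<^esub> m \<otimes>\<^bsub>A\<^esub> a) = g [^]\<^bsub>A\<^esub> k \<otimes>\<^bsub>A\<^esub> (f [^]\<^bsub>A\<^esub> n \<otimes>\<^bsub>A\<^esub> b))}"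


section \<open>The Cech complex, local cohomology and its Frobenius action\<close>

definition cech_index :: "'a list \<Rightarrow> nat \<Rightarrow> nat set set" where
  "cech_index xs i = {I. I \<subseteq> {..<length xs} \<and> card I = i}"

definition cech_elem :: "('a, 'm) ring_scheme \<Rightarrow> 'a list \<Rightarrow> nat set \<Rightarrow> 'a" where
  "cech_elem A xs I = (\<Otimes>\<^bsub>A\<^esub>j\<in>I. xs ! j)"

abbreviation cech_ring ::
    "('a, 'm) ring_scheme \<Rightarrow> 'a list \<Rightarrow> nat set \<Rightarrow> ('a \<times> nat) set ring" where
  "cech_ring A xs I \<equiv> localization A (cech_elem A xs I)"

text \<open>
  The \<open>i\<close>-th term is the product of the \<open>A\<^sub>x\<close>, \<open>x = \<Prod>j\<in>I. x\<^sub>j\<close>, over the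
  \<open>i\<close>-element sets \<open>I\<close> of indices.  The library's quotients of groups are multiplicative, so
  from here on the additive group structure is written multiplicatively.
\<close>

definition cech_group ::
    "('a, 'm) ring_scheme \<Rightarrow> 'a list \<Rightarrow> nat \<Rightarrow> (nat set \<Rightarrow> ('a \<times> nat) set) monoid" where
  "cech_group A xs i =
     product_group (cech_index xs i) (\<lambda>I. add_monoid (cech_ring A xs I))"

definition cech_diff ::
    "('a, 'm) ring_scheme \<Rightarrow> 'a list \<Rightarrow> nat
      \<Rightarrow> (nat set \<Rightarrow> ('a \<times> nat) set) \<Rightarrow> (nat set \<Rightarrow> ('a \<times> nat) set)" where
  "cech_diff A xs i c =
     (\<lambda>J\<in>cech_index xs (Suc i).
        \<Oplus>\<^bsub>cech_ring A xs J\<^esub>j\<in>J.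
          [((-1) ^ card {l \<in> J. l < j} :: int)] \<cdot>\<^bsub>cech_ring A xs J\<^esub>
            localization_map A (cech_elem A xs (J - {j})) (cech_elem A xs J) (c (J - {j})))"

definition cech_cocycles ::
    "('a, 'm) ring_scheme \<Rightarrow> 'a list \<Rightarrow> nat \<Rightarrow> (nat set \<Rightarrow> ('a \<times> nat) set) set" where
  "cech_cocycles A xs i =
     kernel (cech_group A xs i) (cech_group A xs (Suc i)) (cech_diff A xs i)"

definition cech_coboundaries ::
    "('a, 'm) ring_scheme \<Rightarrow> 'a list \<Rightarrow> nat \<Rightarrow> (nat set \<Rightarrow> ('a \<times> nat) set) set" where
  "cech_coboundaries A xs i =
     (case i of 0 \<Rightarrow> {\<one>\<^bsub>cech_group A xs 0\<^esub>}
      | Suc k \<Rightarrow> cech_diff A xs k ` carrier (cech_group A xs k))"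

text \<open>
  \<open>H\<^sup>i\<close> of the Cech complex on \<open>xs\<close>, i.e. the \<open>i\<close>-th local cohomology of \<open>A\<close> with support in
  the ideal generated by \<open>xs\<close>.  Only its additive group is needed below.
\<close>

definition local_cohomology ::
    "('a, 'm) ring_scheme \<Rightarrow> 'a list \<Rightarrow> nat \<Rightarrow> (nat set \<Rightarrow> ('a \<times> nat) set) set monoid" where
  "local_cohomology A xs i =
     (cech_group A xs i)\<lparr>carrier := cech_cocycles A xs i\<rparr> Mod cech_coboundaries A xs i"

text \<open>
  The Frobenius action on \<open>H\<^sup>i\<close> is induced by the Frobenius endomorphisms of the
  localisations; on a coset it is computed on all representatives at once.
\<close>

definition cech_frobenius ::
    "nat \<Rightarrow> ('a, 'm) ring_scheme \<Rightarrow> 'a list \<Rightarrow> nat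
      \<Rightarrow> (nat set \<Rightarrow> ('a \<times> nat) set) \<Rightarrow> (nat set \<Rightarrow> ('a \<times> nat) set)" where
  "cech_frobenius p A xs i c = (\<lambda>I\<in>cech_index xs i. c I [^]\<^bsub>cech_ring A xs I\<^esub> p)"

definition frobenius_action ::
    "nat \<Rightarrow> ('a, 'm) ring_scheme \<Rightarrow> 'a list \<Rightarrow> nat
      \<Rightarrow> (nat set \<Rightarrow> ('a \<times> nat) set) set \<Rightarrow> (nat set \<Rightarrow> ('a \<times> nat) set) set" where
  "frobenius_action p A xs i U =
     (\<Union>c\<in>U. cech_coboundaries A xs i #>\<^bsub>cech_group A xs i\<^esub> cech_frobenius p A xs i c)"

text \<open>
  The local cohomology with support in the maximal ideal, with its Frobenius action, is the
  cohomology of the Cech complex on any finite sequence generating the maximal ideal up to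
  radical; up to isomorphism compatible with Frobenius it does not depend on that sequence.
  Such sequences exist because \<open>A\<close> is noetherian.
\<close>

definition weakly_F_nilpotent :: "nat \<Rightarrow> ('a, 'm) ring_scheme \<Rightarrow> bool" where
  "weakly_F_nilpotent p A \<longleftrightarrow>
     Factorial_Ring.prime p \<and> noetherian_local_ring A \<and> has_char A p \<and>
     (\<forall>xs. set xs \<subseteq> carrier A \<and> radical A (genideal A (set xs)) = max_ideal A \<longrightarrow>
        (\<forall>i. enat i < krull_dim A \<longrightarrow>
           (\<forall>\<xi> \<in> carrier (local_cohomology A xs i).
              \<exists>n. (frobenius_action p A xs i ^^ n) \<xi> = \<one>\<^bsub>local_cohomology A xs i\<^esub>)))"

end

theory Submission
  imports Defs
begin

text \<open>
  Write \<open>A = R/P\<close> and \<open>C = S/\<surd>(PS)\<close>.  A finite flat \<open>S\<close> over the local ring \<open>R\<close> is free with \<open>1\<close> in a basis,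
  so there is an \<open>R\<close>-linear retraction \<open>\<rho> : S \<rightarrow> R\<close> of \<open>\<phi>\<close>, and \<open>\<rho>(PS) \<subseteq> P\<close>.  As \<open>S\<close> is noetherian, the power
  \<open>q = p\<^sup>e\<close> of \<open>\<surd>(PS)\<close>, taken elementwise, lies in \<open>PS\<close> for some \<open>e\<close>.  Hence \<open>s \<mapsto> \<rho>(s\<^sup>q)\<close> induces an additive map
  \<open>\<theta> : C \<rightarrow> A\<close> with \<open>\<theta>(a c) = a\<^sup>q \<theta>(c)\<close> and \<open>\<theta>(1) = 1\<close>.  On Cech complexes, \<open>A \<rightarrow> C\<close> followed by \<open>\<theta>\<close> is
  \<open>F\<^sup>e\<close>, so a class of \<open>A\<close> whose image over \<open>C\<close> is nilpotent is itself nilpotent.  Finally \<open>A \<rightarrow> C\<close> is finite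
  and injective, so \<open>dim A \<le> dim C\<close> by going up, and generators of the maximal ideal of \<open>A\<close> up to
  radical remain such in \<open>C\<close>.
\<close>

section \<open>Frobenius in prime characteristic\<close>

text \<open>The retraction \<open>\<rho>\<close> alone need not descend to C: it sends PS into P,
  but it need not send \<surd>(PS) there. Raising to the power q first repairs this, because q-th
  powers are additive in characteristic p; the price is that \<open>\<theta>\<close> is only
  semilinear. That is enough, since the denominators met in the Cech complex over C come from A: on
  fractions \<open>\<theta>\<close> acts by c/x^M \<mapsto> \<theta>(c)/x^(Mq). A class whose image
  over C is killed by F^n is thus killed by F^(n+e). The identity \<theta>(a 1) = a^q in the domain
  A also gives injectivity of A \<rightarrow> C. Weak F-nilpotency is stated for every sequence
  generating the maximal ideal up to radical, so a sequence of A is simply mapped to C and both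
  complexes are compared term by term. Nakayama's lemma, and with it going up, and integrality are
  all drawn from one elimination lemma in place of determinants. Flatness enters only through
  inclusions of ideals I \<subseteq> R.\<close>

lemma (in abelian_group_hom) add_hom_finsum:
  assumes "finite J" "\<And>j. j \<in> J \<Longrightarrow> g j \<in> carrier G"
  shows "h (\<Oplus>\<^bsub>G\<^esub>j\<in>J. g j) = (\<Oplus>\<^bsub>H\<^esub>j\<in>J. h (g j))"
  using assms by (induction J rule: finite_induct) (simp_all add: Pi_def)

lemma (in abelian_group_hom) hom_int_multiple:
  "a \<in> carrier G \<Longrightarrow> h ([(z::int)] \<cdot>\<^bsub>G\<^esub> a) = [z] \<cdot>\<^bsub>H\<^esub> h a"
  using group_hom.hom_int_pow[OF a_group_hom, of a z] by (simp add: add_pow_def)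

context cring
begin

lemma add_pow_as_mult: "x \<in> carrier R \<Longrightarrow> [(n::nat)] \<cdot> x = [n] \<cdot> \<one> \<otimes> x"
  by (simp add: add_pow_ldistr)

lemma binomial:
  assumes c: "x \<in> carrier R" "y \<in> carrier R"
  shows "(x \<oplus> y) [^] (n::nat) = (\<Oplus>k\<in>{..n}. [(n choose k)] \<cdot> (x [^] k \<otimes> y [^] (n - k)))"
proof (induction n)
  case 0
  then show ?case using c by simp
next
  case (Suc n)
  let ?t = "\<lambda>n k. [(n choose k)] \<cdot> (x [^] k \<otimes> y [^] (n - k))"
  let ?u = "\<lambda>k. [(n choose k)] \<cdot> (x [^] k \<otimes> y [^] (Suc n - k))"
  have "(x \<oplus> y) [^] Suc n = (\<Oplus>k\<in>{..n}. ?t n k) \<otimes> x \<oplus> (\<Oplus>k\<in>{..n}. ?t n k) \<otimes> y"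
    using c Suc.IH by (simp add: r_distr)
  also have "(\<Oplus>k\<in>{..n}. ?t n k) \<otimes> x = (\<Oplus>k\<in>{..n}. [(n choose k)] \<cdot> (x [^] Suc k \<otimes> y [^] (n - k)))"
    using c by (subst finsum_ldistr) (auto intro!: finsum_cong' simp: add_pow_ldistr add_pow_rdistr m_ac)
  also have "(\<Oplus>k\<in>{..n}. ?t n k) \<otimes> y = (\<Oplus>k\<in>{..n}. ?u k)"
    using c by (subst finsum_ldistr) (auto intro!: finsum_cong' simp: add_pow_ldistr add_pow_rdistr m_ac Suc_diff_le)
  \<comment> \<open>The added term k = Suc n has binomial coefficient 0. With it present, splitting
    off k = 0 leaves a sum indexed like the one multiplied by x, and Pascal's rule applies
    termwise.\<close>
  also have "\<dots> = (\<Oplus>k\<in>{..Suc n}. ?u k)"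
    using c by (subst finsum_Suc) (simp_all add: Pi_def binomial_eq_0)
  also have "\<dots> = (\<Oplus>k\<in>{..n}. ?u (Suc k)) \<oplus> ?u 0"
    using c by (subst finsum_Suc2) (simp_all add: Pi_def)
  also have "(\<Oplus>k\<in>{..n}. [(n choose k)] \<cdot> (x [^] Suc k \<otimes> y [^] (n - k))) \<oplus>
      ((\<Oplus>k\<in>{..n}. ?u (Suc k)) \<oplus> ?u 0) = (\<Oplus>k\<in>{..n}. ?t (Suc n) (Suc k)) \<oplus> ?t (Suc n) 0"
    using c by (simp add: finsum_addf[symmetric] a_assoc[symmetric] add.nat_pow_mult Pi_def)
  also have "\<dots> = (\<Oplus>k\<in>{..Suc n}. ?t (Suc n) k)"
    using c by (subst finsum_Suc2) (simp_all add: Pi_def)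
  finally show ?case .
qed

lemma nat_multiple_eq_zero:
  assumes "[(p::nat)] \<cdot> \<one> = \<zero>" "p dvd m" "x \<in> carrier R"
  shows "[m] \<cdot> x = \<zero>"
proof -
  obtain k where "m = p * k" using assms(2) by (rule dvdE)
  then have "[m] \<cdot> \<one> = [k] \<cdot> ([p] \<cdot> \<one>)" by (simp add: add.nat_pow_pow)
  then show ?thesis using assms add_pow_as_mult[of x m] by simp
qed

lemma frobenius_add:
  assumes p: "Factorial_Ring.prime (p::nat)" "[p] \<cdot> \<one> = \<zero>"
    and c: "x \<in> carrier R" "y \<in> carrier R"
  shows "(x \<oplus> y) [^] p = x [^] p \<oplus> y [^] p"
proof -
  have "p \<ge> 2" using p(1) by (rule prime_ge_2_nat)
  \<comment> \<open>Both end terms can now be split off the binomial sum; the shifted indices that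
    remain run from 1 to r + 1 = p - 1, exactly those with binomial coefficient divisible by
    p.\<close>
  then obtain r where r: "p = Suc (Suc r)" by (metis add_2_eq_Suc le_Suc_ex)
  define g where "g k = [(p choose k)] \<cdot> (x [^] k \<otimes> y [^] (p - k))" for k
  have g: "g k \<in> carrier R" for k using c by (simp add: g_def)
  have "(x \<oplus> y) [^] p = (\<Oplus>k\<in>{..p}. g k)" unfolding g_def by (rule binomial[OF c])
  also have "\<dots> = g p \<oplus> ((\<Oplus>k\<in>{..r}. g (Suc k)) \<oplus> g 0)"
    unfolding r using g by (subst finsum_Suc, simp, subst finsum_Suc2, simp_all)
  also have "(\<Oplus>k\<in>{..r}. g (Suc k)) = (\<Oplus>k\<in>{..r}. \<zero>)"
  proof (rule finsum_cong')
    fix k assume "k \<in> {..r}"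
    then have "p dvd (p choose Suc k)" using p(1) r by (intro dvd_choose_prime) auto
    then show "g (Suc k) = \<zero>" unfolding g_def using c by (intro nat_multiple_eq_zero[OF p(2)]) auto
  qed auto
  finally show ?thesis using c by (simp add: g_def)
qed

lemma frobenius_power_add:
  assumes p: "Factorial_Ring.prime (p::nat)" "[p] \<cdot> \<one> = \<zero>"
    and c: "x \<in> carrier R" "y \<in> carrier R"
  shows "(x \<oplus> y) [^] (p ^ e) = x [^] (p ^ e) \<oplus> y [^] (p ^ e)"
proof (induction e)
  case (Suc e)
  then show ?case using c frobenius_add[OF p]
    by (simp add: power_Suc2 nat_pow_pow[symmetric] del: power_Suc)
qed (use c in simp)

lemma frobenius_hom:
  assumes p: "Factorial_Ring.prime (p::nat)" "[p] \<cdot> \<one> = \<zero>"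
  shows "abelian_group_hom R R (\<lambda>x. x [^] (p ^ e))"
  by (intro abelian_group_homI is_abelian_group group_hom.intro group_hom_axioms.intro a_group homI)
    (simp_all add: frobenius_power_add[OF p])

end

section \<open>Localisation at an element\<close>

locale localization_at = cring A for A (structure) +
  fixes f
  assumes elt_closed [simp]: "f \<in> carrier A"
begin

abbreviation frac :: "'a \<Rightarrow> nat \<Rightarrow> ('a \<times> nat) set" where "frac \<equiv> fraction A f"
abbreviation L :: "('a \<times> nat) set ring" where "L \<equiv> localization A f"

lemmas pow_simps = nat_pow_mult[symmetric] m_ac

lemma mem_frac: "(b, m) \<in> frac a n \<longleftrightarrow>
    b \<in> carrier A \<and> (\<exists>k::nat. f [^] k \<otimes> (f [^] m \<otimes> a) = f [^] k \<otimes> (f [^] n \<otimes> b))"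
  by (simp add: fraction_def)

lemma frac_self: "a \<in> carrier A \<Longrightarrow> (a, n) \<in> frac a n"
  by (auto simp: mem_frac)

text \<open>Transitivity of equality of a/f^n, b/f^m and c/f^l. The power f^m of the middle
  denominator cannot be cancelled, so it is absorbed into the exponent k + j + m.\<close>

lemma frac_trans:
  assumes c: "a \<in> carrier A" "b \<in> carrier A" "c \<in> carrier A"
    and 1: "f [^] (k::nat) \<otimes> (f [^] (m::nat) \<otimes> a) = f [^] k \<otimes> (f [^] (n::nat) \<otimes> b)"
    and 2: "f [^] (j::nat) \<otimes> (f [^] (l::nat) \<otimes> b) = f [^] j \<otimes> (f [^] m \<otimes> c)"
  shows "f [^] (k + j + m) \<otimes> (f [^] l \<otimes> a) = f [^] (k + j + m) \<otimes> (f [^] n \<otimes> c)"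
proof -
  have "f [^] (k + j + m) \<otimes> (f [^] l \<otimes> a) = f [^] (j + l) \<otimes> (f [^] k \<otimes> (f [^] m \<otimes> a))"
    using c by (simp add: pow_simps)
  also have "\<dots> = f [^] (k + n) \<otimes> (f [^] j \<otimes> (f [^] l \<otimes> b))"
    unfolding 1 using c by (simp add: pow_simps)
  also have "\<dots> = f [^] (k + j + m) \<otimes> (f [^] n \<otimes> c)"
    unfolding 2 using c by (simp add: pow_simps)
  finally show ?thesis .
qed

lemma frac_eq_iff:
  assumes c: "a \<in> carrier A" "b \<in> carrier A"
  shows "frac a n = frac b m \<longleftrightarrow> (\<exists>k::nat. f [^] k \<otimes> (f [^] m \<otimes> a) = f [^] k \<otimes> (f [^] n \<otimes> b))"
    (is "_ \<longleftrightarrow> ?E a b n m")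
proof
  assume "frac a n = frac b m"
  with frac_self[OF c(2)] have "(b, m) \<in> frac a n" by blast
  then show "?E a b n m" by (simp add: mem_frac)
next
  have sub: "frac b m \<subseteq> frac a n" if "?E a b n m" and c: "a \<in> carrier A" "b \<in> carrier A" for a b n m
    using that frac_trans[OF c] by (fastforce simp: mem_frac)
  assume E: "?E a b n m"
  then have "?E b a m n" by metis
  with E show "frac a n = frac b m" using sub c by (meson subset_antisym)
qed

lemma frac_eqI:
  assumes "a \<in> carrier A" "b \<in> carrier A" "f [^] m \<otimes> a = f [^] n \<otimes> b"
  shows "frac a n = frac b m"
  using assms by (auto simp: frac_eq_iff)

lemma carrier_L: "carrier L = {frac a n | a n. a \<in> carrier A}"
  and one_L: "\<one>\<^bsub>L\<^esub> = frac \<one> 0" and zero_L: "\<zero>\<^bsub>L\<^esub> = frac \<zero> 0"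
  by (simp_all add: localization_def)

lemma frac_closed [simp]: "a \<in> carrier A \<Longrightarrow> frac a n \<in> carrier L"
  by (auto simp: carrier_L)

lemma frac_shift: "a \<in> carrier A \<Longrightarrow> frac (f [^] (k::nat) \<otimes> a) (n + k) = frac a n"
  by (intro frac_eqI) (simp_all add: pow_simps)

lemma frac_zero: "frac \<zero> n = \<zero>\<^bsub>L\<^esub>"
  by (simp add: zero_L frac_eq_iff)

text \<open>The operations of \<open>localization\<close> are unions over all pairs of
  representatives; such a union collapses to one fraction once independence of the representatives
  is shown.\<close>

lemma UN2_const:
  assumes "(a, n) \<in> U" "(b, m) \<in> V"
    and "\<And>a' n' b' m'. (a', n') \<in> U \<Longrightarrow> (b', m') \<in> V \<Longrightarrow> h a' n' b' m' = K"
  shows "(\<Union>(a, n)\<in>U. \<Union>(b, m)\<in>V. h a n b m) = K"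
  using assms by fastforce

lemma mult_frac:
  assumes c: "a \<in> carrier A" "b \<in> carrier A"
  shows "frac a n \<otimes>\<^bsub>L\<^esub> frac b m = frac (a \<otimes> b) (n + m)"
  unfolding localization_def monoid.simps
proof (rule UN2_const[OF frac_self[OF c(1)] frac_self[OF c(2)]])
  fix a' n' b' m' assume m: "(a', n') \<in> frac a n" "(b', m') \<in> frac b m"
  then obtain k l :: nat where kl: "f [^] k \<otimes> (f [^] n' \<otimes> a) = f [^] k \<otimes> (f [^] n \<otimes> a')"
      "f [^] l \<otimes> (f [^] m' \<otimes> b) = f [^] l \<otimes> (f [^] m \<otimes> b')" and c': "a' \<in> carrier A" "b' \<in> carrier A"
    by (auto simp: mem_frac)
  have "f [^] (k + l) \<otimes> (f [^] (n + m) \<otimes> (a' \<otimes> b'))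
      = (f [^] k \<otimes> (f [^] n \<otimes> a')) \<otimes> (f [^] l \<otimes> (f [^] m \<otimes> b'))"
    using c c' by (simp add: pow_simps)
  also have "\<dots> = f [^] (k + l) \<otimes> (f [^] (n' + m') \<otimes> (a \<otimes> b))"
    unfolding kl[symmetric] using c c' by (simp add: pow_simps)
  finally show "frac (a' \<otimes> b') (n' + m') = frac (a \<otimes> b) (n + m)"
    using c c' by (auto simp: frac_eq_iff)
qed

lemma add_frac:
  assumes c: "a \<in> carrier A" "b \<in> carrier A"
  shows "frac a n \<oplus>\<^bsub>L\<^esub> frac b m = frac (f [^] m \<otimes> a \<oplus> f [^] n \<otimes> b) (n + m)"
  unfolding localization_def ring.simps
proof (rule UN2_const[OF frac_self[OF c(1)] frac_self[OF c(2)]])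
  fix a' n' b' m' assume m: "(a', n') \<in> frac a n" "(b', m') \<in> frac b m"
  then obtain k l :: nat where kl: "f [^] k \<otimes> (f [^] n' \<otimes> a) = f [^] k \<otimes> (f [^] n \<otimes> a')"
      "f [^] l \<otimes> (f [^] m' \<otimes> b) = f [^] l \<otimes> (f [^] m \<otimes> b')" and c': "a' \<in> carrier A" "b' \<in> carrier A"
    by (auto simp: mem_frac)
  have "f [^] (k + l) \<otimes> (f [^] (n + m) \<otimes> (f [^] m' \<otimes> a' \<oplus> f [^] n' \<otimes> b'))
      = f [^] (l + m + m') \<otimes> (f [^] k \<otimes> (f [^] n \<otimes> a')) \<oplus> f [^] (k + n + n') \<otimes> (f [^] l \<otimes> (f [^] m \<otimes> b'))"
    using c c' by (simp add: pow_simps r_distr)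
  also have "\<dots> = f [^] (k + l) \<otimes> (f [^] (n' + m') \<otimes> (f [^] m \<otimes> a \<oplus> f [^] n \<otimes> b))"
    unfolding kl[symmetric] using c c' by (simp add: pow_simps r_distr)
  finally show "frac (f [^] m' \<otimes> a' \<oplus> f [^] n' \<otimes> b') (n' + m') = frac (f [^] m \<otimes> a \<oplus> f [^] n \<otimes> b) (n + m)"
    using c c' by (auto simp: frac_eq_iff)
qed

lemma add_frac_same:
  assumes c: "a \<in> carrier A" "b \<in> carrier A"
  shows "frac a n \<oplus>\<^bsub>L\<^esub> frac b n = frac (a \<oplus> b) n"
  unfolding add_frac[OF c] using c
  by (simp add: r_distr[symmetric] frac_shift)

lemma frac_cases:
  assumes "U \<in> carrier L" obtains a n where "a \<in> carrier A" "U = frac a n"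
  using assms by (auto simp: carrier_L)

text \<open>With three elements over one denominator, the ring axioms of the localisation reduce to
  those of the numerators.\<close>

lemma frac_cases3:
  assumes "U \<in> carrier L" "V \<in> carrier L" "W \<in> carrier L"
  obtains a b c n where "a \<in> carrier A" "b \<in> carrier A" "c \<in> carrier A"
    "U = frac a n" "V = frac b n" "W = frac c n"
proof -
  from assms obtain a b c n m l where c: "a \<in> carrier A" "b \<in> carrier A" "c \<in> carrier A"
    and e: "U = frac a n" "V = frac b m" "W = frac c l" by (auto simp: carrier_L)
  have u: "U = frac (f [^] (m + l) \<otimes> a) (n + (m + l))" and "V = frac (f [^] (n + l) \<otimes> b) (m + (n + l))"
     "W = frac (f [^] (n + m) \<otimes> c) (l + (n + m))"
    unfolding e using c by (simp_all only: frac_shift)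
  moreover have "m + (n + l) = n + (m + l)" "l + (n + m) = n + (m + l)" by simp_all
  ultimately have "V = frac (f [^] (n + l) \<otimes> b) (n + (m + l))" "W = frac (f [^] (n + m) \<otimes> c) (n + (m + l))"
    by simp_all
  with u show thesis using c by (intro that[OF _ _ _ u]) simp_all
qed

lemma cring_L: "cring L"
proof (rule cringI)
  show "abelian_group L"
  proof (rule abelian_groupI)
    fix U V W assume "U \<in> carrier L" "V \<in> carrier L" "W \<in> carrier L"
    then obtain a b c n where c: "a \<in> carrier A" "b \<in> carrier A" "c \<in> carrier A"
        "U = frac a n" "V = frac b n" "W = frac c n" by (rule frac_cases3)
    then show "U \<oplus>\<^bsub>L\<^esub> V \<in> carrier L" "U \<oplus>\<^bsub>L\<^esub> V \<oplus>\<^bsub>L\<^esub> W = U \<oplus>\<^bsub>L\<^esub> (V \<oplus>\<^bsub>L\<^esub> W)" "U \<oplus>\<^bsub>L\<^esub> V = V \<oplus>\<^bsub>L\<^esub> U"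
      by (simp_all add: add_frac_same a_ac)
  next
    fix U assume "U \<in> carrier L"
    then obtain a n where c: "a \<in> carrier A" "U = frac a n" by (rule frac_cases)
    then show "\<zero>\<^bsub>L\<^esub> \<oplus>\<^bsub>L\<^esub> U = U" by (simp add: frac_zero[of n, symmetric] add_frac_same)
    from c have "frac (\<ominus> a) n \<oplus>\<^bsub>L\<^esub> U = \<zero>\<^bsub>L\<^esub>" by (simp add: add_frac_same frac_zero l_neg)
    with c show "\<exists>V\<in>carrier L. V \<oplus>\<^bsub>L\<^esub> U = \<zero>\<^bsub>L\<^esub>" by (metis frac_closed a_inv_closed)
  qed (simp add: zero_L)
  show "comm_monoid L"
  proof (rule comm_monoidI)
    fix U V W assume "U \<in> carrier L" "V \<in> carrier L" "W \<in> carrier L"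
    then obtain a b c n where c: "a \<in> carrier A" "b \<in> carrier A" "c \<in> carrier A"
        "U = frac a n" "V = frac b n" "W = frac c n" by (rule frac_cases3)
    then show "U \<otimes>\<^bsub>L\<^esub> V \<in> carrier L" "U \<otimes>\<^bsub>L\<^esub> V \<otimes>\<^bsub>L\<^esub> W = U \<otimes>\<^bsub>L\<^esub> (V \<otimes>\<^bsub>L\<^esub> W)" "U \<otimes>\<^bsub>L\<^esub> V = V \<otimes>\<^bsub>L\<^esub> U"
      "\<one>\<^bsub>L\<^esub> \<otimes>\<^bsub>L\<^esub> U = U"
      by (simp_all add: mult_frac m_ac one_L add.assoc)
  qed (simp add: one_L)
  fix U V W assume "U \<in> carrier L" "V \<in> carrier L" "W \<in> carrier L"
  then obtain a b c n where c: "a \<in> carrier A" "b \<in> carrier A" "c \<in> carrier A"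
      "U = frac a n" "V = frac b n" "W = frac c n" by (rule frac_cases3)
  then show "(U \<oplus>\<^bsub>L\<^esub> V) \<otimes>\<^bsub>L\<^esub> W = U \<otimes>\<^bsub>L\<^esub> W \<oplus>\<^bsub>L\<^esub> V \<otimes>\<^bsub>L\<^esub> W"
    by (simp add: add_frac_same mult_frac l_distr)
qed

sublocale L: cring L by (rule cring_L)

lemma finsum_frac:
  assumes "finite J" "\<And>j. j \<in> J \<Longrightarrow> g j \<in> carrier A"
  shows "(\<Oplus>\<^bsub>L\<^esub>j\<in>J. frac (g j) n) = frac (\<Oplus>j\<in>J. g j) n"
  using assms
proof (induction J rule: finite_induct)
  case (insert x J)
  then show ?case by (simp add: Pi_def add_frac_same)
qed (simp add: frac_zero)

lemma group_hom_frac: "group_hom (add_monoid A) (add_monoid L) (\<lambda>a. frac a n)"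
  using L.a_group
  by (intro group_hom.intro group_hom_axioms.intro homI) (simp_all add: add_frac_same a_group)

lemma int_multiple_frac:
  assumes "a \<in> carrier A" shows "[(z::int)] \<cdot>\<^bsub>L\<^esub> frac a n = frac ([z] \<cdot> a) n"
  using group_hom.hom_int_pow[OF group_hom_frac, of a z n] assms unfolding add_pow_def by simp

lemma pow_frac: "a \<in> carrier A \<Longrightarrow> frac a n [^]\<^bsub>L\<^esub> (k::nat) = frac (a [^] k) (n * k)"
  by (induction k) (simp_all add: one_L mult_frac add.commute)

text \<open>With g = hf one has a/f^n = h^n a/(hf)^n, so the canonical map keeps the denominator
  exponent n.\<close>

lemma localization_map_frac:
  assumes c: "a \<in> carrier A" "h \<in> carrier A" and g: "g = h \<otimes> f"
  shows "localization_map A f g (frac a n) = fraction A g (h [^] n \<otimes> a) n"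
proof -
  have gc: "g \<in> carrier A" using c g by simp
  have gp: "h [^] i \<otimes> f [^] i = g [^] i" for i :: nat using c g by (simp add: nat_pow_distrib)
  have gp': "h [^] i \<otimes> (f [^] i \<otimes> z) = g [^] i \<otimes> z" if "z \<in> carrier A" for i :: nat and z
    using that c by (simp add: m_assoc[symmetric] gp)
  have 1: "(b, m) \<in> fraction A g (h [^] n \<otimes> a) n" if "(b, m) \<in> localization_map A f g (frac a n)" for b m
  proof -
    from that obtain a' n' where an: "(a', n') \<in> frac a n" and b: "b \<in> carrier A"
      and "\<exists>k::nat. g [^] k \<otimes> (g [^] m \<otimes> a') = g [^] k \<otimes> (f [^] n' \<otimes> b)"
      by (auto simp: localization_map_def)
    then obtain k l :: nat where cc: "a' \<in> carrier A" "b \<in> carrier A"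
      and l: "f [^] l \<otimes> (f [^] n' \<otimes> a) = f [^] l \<otimes> (f [^] n \<otimes> a')"
      and k: "g [^] k \<otimes> (g [^] m \<otimes> a') = g [^] k \<otimes> (f [^] n' \<otimes> b)"
      by (auto simp: mem_frac)
    \<comment> \<open>The relation \<open>l\<close> involves powers of f. Writing g^n' and g^l as
      products of powers of h and f exposes them; the factor g^k serves the relation
      \<open>k\<close>.\<close>
    have "g [^] (n' + l + k) \<otimes> (g [^] m \<otimes> (h [^] n \<otimes> a))
        = (h [^] n' \<otimes> h [^] l \<otimes> h [^] n \<otimes> g [^] k \<otimes> g [^] m) \<otimes> (f [^] l \<otimes> (f [^] n' \<otimes> a))"
      using c cc gc by (simp add: nat_pow_mult[symmetric] gp[symmetric, of n'] gp[symmetric, of l] m_ac)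
    also have "\<dots> = (h [^] n' \<otimes> h [^] l \<otimes> h [^] n \<otimes> f [^] l \<otimes> f [^] n) \<otimes> (g [^] k \<otimes> (g [^] m \<otimes> a'))"
      unfolding l using c cc gc by (simp add: m_ac)
    also have "\<dots> = g [^] (n' + l + k) \<otimes> (g [^] n \<otimes> b)"
      unfolding k using c cc gc by (simp add: nat_pow_mult[symmetric] gp[symmetric, of n'] gp[symmetric, of l] gp[symmetric, of n] m_ac)
    finally show ?thesis using cc by (auto simp: fraction_def)
  qed
  have 2: "(b, m) \<in> localization_map A f g (frac a n)" if "(b, m) \<in> fraction A g (h [^] n \<otimes> a) n" for b m
  proof -
    from that obtain k :: nat where cc: "b \<in> carrier A"
      and k: "g [^] k \<otimes> (g [^] m \<otimes> (h [^] n \<otimes> a)) = g [^] k \<otimes> (g [^] n \<otimes> b)"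
      by (auto simp: fraction_def)
    have "g [^] (k + n) \<otimes> (g [^] m \<otimes> a) = f [^] n \<otimes> (g [^] k \<otimes> (g [^] m \<otimes> (h [^] n \<otimes> a)))"
      using c cc gc by (simp add: nat_pow_mult[symmetric] gp[symmetric, of n] m_ac)
    also have "\<dots> = g [^] (k + n) \<otimes> (f [^] n \<otimes> b)"
      unfolding k using c cc gc by (simp add: nat_pow_mult[symmetric] m_ac)
    finally show ?thesis using cc frac_self[OF c(1), of n] by (auto simp: localization_map_def)
  qed
  show ?thesis using 1 2 by auto
qed

end

section \<open>Cech cochains with a common denominator\<close>

text \<open>The differential on numerators, for cochains with a common denominator exponent.\<close>

definition diff_numerator ::
    "('a, 'm) ring_scheme \<Rightarrow> 'a list \<Rightarrow> nat \<Rightarrow> (nat set \<Rightarrow> 'a) \<Rightarrow> nat set \<Rightarrow> 'a" where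
  "diff_numerator A xs N a J =
     (\<Oplus>\<^bsub>A\<^esub>j\<in>J. [((-1) ^ card {l \<in> J. l < j} :: int)] \<cdot>\<^bsub>A\<^esub> ((xs ! j) [^]\<^bsub>A\<^esub> N \<otimes>\<^bsub>A\<^esub> a (J - {j})))"

text \<open>There are only finitely many index sets, so every Cech cochain can be written with one
  exponent N for all components (\<open>coch_cases\<close>). This turns statements on cochains into
  statements on families of numerators in the ring.\<close>

definition cochain ::
    "('a, 'm) ring_scheme \<Rightarrow> 'a list \<Rightarrow> nat \<Rightarrow> (nat set \<Rightarrow> 'a) \<Rightarrow> nat \<Rightarrow> nat set \<Rightarrow> ('a \<times> nat) set" where
  "cochain A xs i a N = (\<lambda>I\<in>cech_index xs i. fraction A (cech_elem A xs I) (a I) N)"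

locale cech_complex = cring A for A (structure) +
  fixes xs :: "'a list" and p :: nat
  assumes xs_closed: "set xs \<subseteq> carrier A"
    and prime_p: "Factorial_Ring.prime p" and p_zero: "[p] \<cdot> \<one> = \<zero>"
begin

abbreviation \<pi> where "\<pi> \<equiv> cech_elem A xs"
abbreviation ix where "ix \<equiv> cech_index xs"
abbreviation C where "C \<equiv> cech_group A xs"
abbreviation \<delta> where "\<delta> \<equiv> diff_numerator A xs"
abbreviation coch where "coch \<equiv> cochain A xs"

lemma ixD: "I \<in> ix i \<Longrightarrow> I \<subseteq> {..<length xs}" "I \<in> ix i \<Longrightarrow> finite I" "I \<in> ix i \<Longrightarrow> card I = i"
  by (auto simp: cech_index_def intro: finite_subset)

lemma finite_ix: "finite (ix i)"
  by (rule finite_subset[of _ "Pow {..<length xs}"]) (auto simp: cech_index_def)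

lemma nth_closed: "\<lbrakk>j \<in> I; I \<in> ix i\<rbrakk> \<Longrightarrow> xs ! j \<in> carrier A"
  using xs_closed ixD(1)[of I i] nth_mem[of j xs] by (meson lessThan_iff subsetD)

lemma ix_remove: "\<lbrakk>J \<in> ix (Suc i); j \<in> J\<rbrakk> \<Longrightarrow> J - {j} \<in> ix i"
  by (auto simp: cech_index_def card_Diff_singleton dest: finite_subset[OF _ finite_lessThan])

lemma elem_closed [simp]: "I \<in> ix i \<Longrightarrow> \<pi> I \<in> carrier A"
  unfolding cech_elem_def by (intro finprod_closed) (auto simp: nth_closed)

lemma elem_remove:
  assumes J: "J \<in> ix (Suc i)" "j \<in> J" shows "\<pi> J = xs ! j \<otimes> \<pi> (J - {j})"
proof -
  have "\<pi> (insert j (J - {j})) = xs ! j \<otimes> \<pi> (J - {j})"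
    unfolding cech_elem_def using J ixD(2)[OF J(1)] nth_closed
    by (intro finprod_insert) auto
  with J show ?thesis by (simp add: insert_absorb)
qed

lemma localization_elem: "I \<in> ix i \<Longrightarrow> localization_at A (\<pi> I)"
  by (intro localization_at.intro localization_at_axioms.intro is_cring elem_closed)

lemma comm_group_C: "comm_group (C i)"
proof (rule group.group_comm_groupI)
  show "Group.group (C i)" unfolding cech_group_def
    by (intro product_group abelian_group.a_group ring.is_abelian_group cring.axioms(1)
        localization_at.cring_L localization_elem)
  fix x y assume c: "x \<in> carrier (C i)" "y \<in> carrier (C i)"
  have "x I \<oplus>\<^bsub>cech_ring A xs I\<^esub> y I = y I \<oplus>\<^bsub>cech_ring A xs I\<^esub> x I" if I: "I \<in> ix i" for I
  proof -
    interpret localization_at A "\<pi> I" using I by (rule localization_elem)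
    from c I have "x I \<in> carrier L" "y I \<in> carrier L" by (auto simp: cech_group_def)
    then show ?thesis by (rule L.a_comm)
  qed
  then show "x \<otimes>\<^bsub>C i\<^esub> y = y \<otimes>\<^bsub>C i\<^esub> x" by (simp add: cech_group_def cong: restrict_cong)
qed

lemma coch_closed: "(\<And>I. I \<in> ix i \<Longrightarrow> a I \<in> carrier A) \<Longrightarrow> coch i a N \<in> carrier (C i)"
  by (auto simp: cochain_def cech_group_def localization_at.frac_closed[OF localization_elem])

lemma coch_eq_iff:
  assumes "\<And>I. I \<in> ix i \<Longrightarrow> a I \<in> carrier A" "\<And>I. I \<in> ix i \<Longrightarrow> b I \<in> carrier A"
  shows "coch i a N = coch i b M \<longleftrightarrow>
    (\<forall>I\<in>ix i. \<exists>k::nat. \<pi> I [^] k \<otimes> (\<pi> I [^] M \<otimes> a I) = \<pi> I [^] k \<otimes> (\<pi> I [^] N \<otimes> b I))"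
proof -
  have "coch i a N = coch i b M \<longleftrightarrow> (\<forall>I\<in>ix i. fraction A (\<pi> I) (a I) N = fraction A (\<pi> I) (b I) M)"
    unfolding cochain_def by (auto simp: restrict_def fun_eq_iff)
  also have "\<dots> \<longleftrightarrow>
    (\<forall>I\<in>ix i. \<exists>k::nat. \<pi> I [^] k \<otimes> (\<pi> I [^] M \<otimes> a I) = \<pi> I [^] k \<otimes> (\<pi> I [^] N \<otimes> b I))"
    by (intro ball_cong refl localization_at.frac_eq_iff localization_elem assms)
  finally show ?thesis .
qed

text \<open>Numerators are required to lie in the carrier for every I, whereas
  \<open>\<pi> I\<close> is known to be there only for index sets; hence the default \<zero> outside
  \<open>ix i\<close>.\<close>

lemma coch_shift:
  assumes "\<And>I. a I \<in> carrier A"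
  shows "coch i (\<lambda>I. if I \<in> ix i then \<pi> I [^] (k::nat) \<otimes> a I else \<zero>) (N + k) = coch i a N"
  unfolding cochain_def using localization_at.frac_shift[OF localization_elem] assms
  by (intro restrict_ext) simp

lemma coch_cases:
  assumes "c \<in> carrier (C i)"
  obtains a N where "\<And>I. a I \<in> carrier A" "c = coch i a N"
proof -
  have "\<forall>I\<in>ix i. \<exists>a n. a \<in> carrier A \<and> c I = fraction A (\<pi> I) a n"
  proof
    fix I assume I: "I \<in> ix i"
    with assms have "c I \<in> carrier (cech_ring A xs I)" by (auto simp: cech_group_def)
    then show "\<exists>a n. a \<in> carrier A \<and> c I = fraction A (\<pi> I) a n"
      by (auto simp: localization_at.carrier_L[OF localization_elem[OF I]])
  qed
  then obtain a n where an: "\<And>I. I \<in> ix i \<Longrightarrow> a I \<in> carrier A \<and> c I = fraction A (\<pi> I) (a I) (n I)"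
    by metis
  \<comment> \<open>The sum serves as a common upper bound of the finitely many exponents
    \<open>n I\<close>.\<close>
  define N where "N = sum n (ix i)"
  define b where "b I = (if I \<in> ix i then \<pi> I [^] (N - n I) \<otimes> a I else \<zero>)" for I
  have b: "b I \<in> carrier A" for I using an by (simp add: b_def)
  moreover have "c = coch i b N"
  proof
    fix I
    show "c I = coch i b N I"
    proof (cases "I \<in> ix i")
      case True
      then have "n I \<le> N" unfolding N_def by (intro member_le_sum finite_ix) auto
      then show ?thesis
        using True an localization_at.frac_shift[OF localization_elem[OF True], of "a I" "N - n I" "n I"]
        by (simp add: cochain_def b_def)
    next
      case False
      with assms show ?thesis by (auto simp: cech_group_def cochain_def)
    qed
  qed
  ultimately show thesis by (rule that)
qed

lemma coch_cases2:
  assumes "c \<in> carrier (C i)" "d \<in> carrier (C i)"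
  obtains a b N where "\<And>I. a I \<in> carrier A" "\<And>I. b I \<in> carrier A" "c = coch i a N" "d = coch i b N"
proof -
  from assms(1) obtain a N where a: "\<And>I. a I \<in> carrier A" "c = coch i a N" by (rule coch_cases) blast
  from assms(2) obtain b M where b: "\<And>I. b I \<in> carrier A" "d = coch i b M" by (rule coch_cases) blast
  let ?s = "\<lambda>k a I. if I \<in> ix i then \<pi> I [^] (k::nat) \<otimes> a I else \<zero>"
  show thesis
  proof (rule that[of "?s M a" "?s N b" "N + M"])
    show "c = coch i (?s M a) (N + M)" "d = coch i (?s N b) (N + M)"
      using coch_shift[OF a(1), where i = i and k = M and N = N] coch_shift[OF b(1), where i = i and k = N and N = M] a(2) b(2) by (simp_all add: add.commute)
  qed (simp_all add: a b)
qed

lemma coch_one: "\<one>\<^bsub>C i\<^esub> = coch i (\<lambda>_. \<zero>) N"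
  unfolding cech_group_def cochain_def one_product_group monoid.simps
  by (intro restrict_ext) (simp add: localization_at.frac_zero[OF localization_elem])

lemma coch_mult:
  assumes "\<And>I. I \<in> ix i \<Longrightarrow> a I \<in> carrier A" "\<And>I. I \<in> ix i \<Longrightarrow> b I \<in> carrier A"
  shows "coch i a N \<otimes>\<^bsub>C i\<^esub> coch i b N = coch i (\<lambda>I. a I \<oplus> b I) N"
  unfolding cech_group_def cochain_def mult_product_group monoid.simps
  by (intro restrict_ext) (simp add: localization_at.add_frac_same[OF localization_elem] assms)

lemma frobenius_coch:
  assumes "\<And>I. a I \<in> carrier A"
  shows "cech_frobenius p A xs i (coch i a N) = coch i (\<lambda>I. a I [^] p) (N * p)"
  unfolding cech_frobenius_def cochain_def
  by (intro restrict_ext) (simp add: localization_at.pow_frac[OF localization_elem] assms)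

lemma diff_summand_closed:
  assumes "\<And>I. a I \<in> carrier A" "J \<in> ix i" "j \<in> J"
  shows "[(z::int)] \<cdot> ((xs ! j) [^] (N::nat) \<otimes> a (J - {j})) \<in> carrier A"
  using assms nth_closed by (intro add.int_pow_closed) auto

lemma diff_closed:
  assumes "\<And>I. a I \<in> carrier A" "J \<in> ix i"
  shows "\<delta> N a J \<in> carrier A"
  unfolding diff_numerator_def using diff_summand_closed[of a, OF assms] by (intro finsum_closed) auto

text \<open>Since x_J is x_j times the product over J - {j}, restricting to the smaller localisation
  multiplies the numerator by x_j^N and keeps the exponent N. The differential therefore preserves
  common denominators.\<close>

lemma cech_diff_coch:
  assumes a: "\<And>I. a I \<in> carrier A"
  shows "cech_diff A xs i (coch i a N) = coch (Suc i) (\<delta> N a) N"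
  unfolding cech_diff_def cochain_def
proof (rule restrict_ext, goal_cases)
  case (1 J)
  interpret localization_at A "\<pi> J" using 1 by (rule localization_elem)
  have "(\<Oplus>\<^bsub>L\<^esub>j\<in>J. [((-1) ^ card {l \<in> J. l < j} :: int)] \<cdot>\<^bsub>L\<^esub>
      localization_map A (\<pi> (J - {j})) (\<pi> J) ((\<lambda>I\<in>ix i. fraction A (\<pi> I) (a I) N) (J - {j})))
    = (\<Oplus>\<^bsub>L\<^esub>j\<in>J. frac ([((-1) ^ card {l \<in> J. l < j} :: int)] \<cdot> ((xs ! j) [^] N \<otimes> a (J - {j}))) N)"
  proof (rule L.finsum_cong')
    fix j assume j: "j \<in> J"
    note jx = ix_remove[OF 1 j] nth_closed[OF j 1]
    show "[((-1) ^ card {l \<in> J. l < j} :: int)] \<cdot>\<^bsub>L\<^esub>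
        localization_map A (\<pi> (J - {j})) (\<pi> J) ((\<lambda>I\<in>ix i. fraction A (\<pi> I) (a I) N) (J - {j}))
      = frac ([((-1) ^ card {l \<in> J. l < j} :: int)] \<cdot> ((xs ! j) [^] N \<otimes> a (J - {j}))) N"
      using localization_at.localization_map_frac[OF localization_elem[OF jx(1)] a jx(2) elem_remove[OF 1 j], where n = N]
        jx a by (simp add: int_multiple_frac)
  qed (use diff_summand_closed[of a, OF a 1] in auto)
  also have "\<dots> = frac (\<delta> N a J) N"
    unfolding diff_numerator_def using ixD(2)[OF 1] diff_summand_closed[of a, OF a 1] by (intro finsum_frac) auto
  finally show ?case .
qed

lemma diff_add:
  assumes "\<And>I. a I \<in> carrier A" "\<And>I. b I \<in> carrier A" "J \<in> ix i"
  shows "\<delta> N (\<lambda>I. a I \<oplus> b I) J = \<delta> N a J \<oplus> \<delta> N b J"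
proof -
  have "\<delta> N (\<lambda>I. a I \<oplus> b I) J =
    (\<Oplus>j\<in>J. [((-1) ^ card {l \<in> J. l < j} :: int)] \<cdot> ((xs ! j) [^] N \<otimes> a (J - {j})) \<oplus>
           [((-1) ^ card {l \<in> J. l < j} :: int)] \<cdot> ((xs ! j) [^] N \<otimes> b (J - {j})))"
    unfolding diff_numerator_def
    using diff_summand_closed assms nth_closed[OF _ assms(3)]
    by (intro finsum_cong') (auto simp: r_distr add.int_pow_mult_distrib a_comm)
  then show ?thesis unfolding diff_numerator_def
    using diff_summand_closed assms by (simp add: finsum_addf Pi_def)
qed

text \<open>Frobenius is additive, so it commutes with the integer signs, and it turns the factor
  x_j^N into x_j^(Np).\<close>

lemma diff_frobenius:
  assumes "\<And>I. a I \<in> carrier A" "J \<in> ix i"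
  shows "(\<delta> N a J) [^] p = \<delta> (N * p) (\<lambda>I. a I [^] p) J"
proof -
  interpret F: abelian_group_hom A A "\<lambda>x. x [^] p"
    using frobenius_hom[OF prime_p p_zero, of 1] by simp
  show ?thesis unfolding diff_numerator_def
    using diff_summand_closed[of a, OF assms] ixD(2)[OF assms(2)] nth_closed[OF _ assms(2)] assms(1)
    by (subst F.add_hom_finsum)
      (auto intro!: finsum_cong' simp: F.hom_int_multiple nat_pow_distrib nat_pow_pow)
qed

section \<open>Cocycles and coboundaries as equations in the ring\<close>

lemma coboundaries_eq:
  "cech_coboundaries A xs i = {coch i (\<delta> M b) M | M b. \<forall>I. b I \<in> carrier A}"
proof (cases i)
  case 0
  \<comment> \<open>In degree 0 the only index set is empty, so \<open>\<delta> M b {}\<close> is an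
    empty sum and the right-hand side is the trivial subgroup, as in the definition. Later arguments
    can then treat all degrees alike.\<close>
  have empty: "I = {}" if "I \<in> ix 0" for I using ixD[OF that] by simp
  have "\<delta> M b I = \<zero>" if "I \<in> ix 0" for M b I
    unfolding empty[OF that] by (simp add: diff_numerator_def)
  then have "coch 0 (\<delta> M b) M = \<one>\<^bsub>C 0\<^esub>" for M b
    unfolding coch_one[of 0 M] cochain_def by (intro restrict_ext) simp
  moreover have "\<exists>b. \<forall>I::nat set. b I \<in> carrier A" by (rule exI[of _ "\<lambda>_. \<zero>"]) simp
  ultimately have "{coch 0 (\<delta> M b) M | M b. \<forall>I. b I \<in> carrier A} = {\<one>\<^bsub>C 0\<^esub>}" by auto
  then show ?thesis using 0 by (simp add: cech_coboundaries_def)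
next
  case (Suc k)
  show ?thesis unfolding Suc cech_coboundaries_def nat.case
  proof safe
    fix c assume "c \<in> carrier (C k)"
    then obtain b M where "\<And>I. b I \<in> carrier A" "c = coch k b M" by (rule coch_cases) blast
    then show "\<exists>M b. cech_diff A xs k c = coch (Suc k) (\<delta> M b) M \<and> (\<forall>I. b I \<in> carrier A)"
      using cech_diff_coch by blast
  next
    fix M b assume "\<forall>I::nat set. b I \<in> carrier A"
    then have b: "b I \<in> carrier A" for I by simp
    show "coch (Suc k) (\<delta> M b) M \<in> cech_diff A xs k ` carrier (C k)"
      using cech_diff_coch[OF b, where i = k and N = M] coch_closed[OF b, where i = k and N = M]
      by (intro image_eqI[of _ _ "coch k b M"]) simp_all
  qed
qed

lemma cocycle_iff:
  assumes a: "\<And>I. a I \<in> carrier A"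
  shows "coch i a N \<in> cech_cocycles A xs i \<longleftrightarrow>
    (\<forall>J\<in>ix (Suc i). \<exists>k::nat. \<pi> J [^] k \<otimes> \<delta> N a J = \<zero>)"
proof -
  have "coch i a N \<in> carrier (C i)" by (rule coch_closed) (rule a)
  then have "coch i a N \<in> cech_cocycles A xs i \<longleftrightarrow> coch (Suc i) (\<delta> N a) N = coch (Suc i) (\<lambda>_. \<zero>) 0"
    by (simp add: cech_cocycles_def kernel_def cech_diff_coch[of a, OF a] coch_one[of "Suc i" 0])
  also have "\<dots> \<longleftrightarrow> (\<forall>J\<in>ix (Suc i). \<exists>k::nat. \<pi> J [^] k \<otimes> \<delta> N a J = \<zero>)"
    using diff_closed[of a, OF a] by (subst coch_eq_iff) auto
  finally show ?thesis .
qed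

text \<open>Together with \<open>cocycle_iff\<close> this removes localisations from the picture. A
  map that is merely additive and semilinear can be applied to such equations, although it is not
  given as a map of localisations.\<close>

lemma coboundary_iff:
  assumes a: "\<And>I. a I \<in> carrier A"
  shows "coch i a N \<in> cech_coboundaries A xs i \<longleftrightarrow>
    (\<exists>M b. (\<forall>I. b I \<in> carrier A) \<and>
      (\<forall>I\<in>ix i. \<exists>k::nat. \<pi> I [^] k \<otimes> (\<pi> I [^] M \<otimes> a I) = \<pi> I [^] k \<otimes> (\<pi> I [^] N \<otimes> \<delta> M b I)))"
proof -
  have "coch i a N = coch i (\<delta> M b) M \<longleftrightarrow>
      (\<forall>I\<in>ix i. \<exists>k::nat. \<pi> I [^] k \<otimes> (\<pi> I [^] M \<otimes> a I) = \<pi> I [^] k \<otimes> (\<pi> I [^] N \<otimes> \<delta> M b I))"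
    if b: "\<And>I. b I \<in> carrier A" for M b
    using a diff_closed[of b, OF b] by (rule coch_eq_iff)
  then show ?thesis unfolding coboundaries_eq by blast
qed

section \<open>The Frobenius action on cohomology classes\<close>

lemma cech_diff_hom: "cech_diff A xs i \<in> hom (C i) (C (Suc i))"
proof (rule homI)
  fix c d assume "c \<in> carrier (C i)" "d \<in> carrier (C i)"
  then obtain a b N where a: "\<And>I. a I \<in> carrier A" and b: "\<And>I. b I \<in> carrier A"
    and cd: "c = coch i a N" "d = coch i b N" by (rule coch_cases2) blast
  have ab: "a I \<oplus> b I \<in> carrier A" for I using a b by simp
  have "coch (Suc i) (\<delta> N a) N \<otimes>\<^bsub>C (Suc i)\<^esub> coch (Suc i) (\<delta> N b) N =
      coch (Suc i) (\<lambda>I. \<delta> N a I \<oplus> \<delta> N b I) N"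
    using diff_closed[of a, OF a] diff_closed[of b, OF b] by (rule coch_mult)
  then show "cech_diff A xs i (c \<otimes>\<^bsub>C i\<^esub> d) = cech_diff A xs i c \<otimes>\<^bsub>C (Suc i)\<^esub> cech_diff A xs i d"
    unfolding cd coch_mult[of i a b, OF a b] cech_diff_coch[of a, OF a] cech_diff_coch[of b, OF b]
      cech_diff_coch[of "\<lambda>I. a I \<oplus> b I", OF ab]
    by (simp add: cochain_def diff_add[of a b, OF a b] cong: restrict_cong)
next
  fix c assume "c \<in> carrier (C i)"
  then obtain a N where a: "\<And>I. a I \<in> carrier A" and c: "c = coch i a N" by (rule coch_cases) blast
  show "cech_diff A xs i c \<in> carrier (C (Suc i))"
    unfolding c cech_diff_coch[of a, OF a] using diff_closed[of a, OF a] by (rule coch_closed)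
qed

lemma coboundaries_subgroup: "subgroup (cech_coboundaries A xs i) (C i)"
proof (cases i)
  case 0
  then show ?thesis
    using group.triv_subgroup[OF comm_group.axioms(2)[OF comm_group_C]] by (simp add: cech_coboundaries_def)
next
  case (Suc k)
  have "group_hom (C k) (C (Suc k)) (cech_diff A xs k)"
    by (intro group_hom.intro group_hom_axioms.intro cech_diff_hom comm_group.axioms(2)[OF comm_group_C])
  from group_hom.img_is_subgroup[OF this] show ?thesis by (simp add: Suc cech_coboundaries_def)
qed

lemma frobenius_mult:
  assumes "c \<in> carrier (C i)" "d \<in> carrier (C i)"
  shows "cech_frobenius p A xs i (c \<otimes>\<^bsub>C i\<^esub> d) =
    cech_frobenius p A xs i c \<otimes>\<^bsub>C i\<^esub> cech_frobenius p A xs i d"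
proof -
  from assms obtain a b N where a: "\<And>I. a I \<in> carrier A" and b: "\<And>I. b I \<in> carrier A"
    and cd: "c = coch i a N" "d = coch i b N" by (rule coch_cases2) blast
  have "(\<lambda>I. (a I \<oplus> b I) [^] p) = (\<lambda>I. a I [^] p \<oplus> b I [^] p)"
    using frobenius_add[OF prime_p p_zero a b] by simp
  then show ?thesis unfolding cd using a b by (simp add: coch_mult frobenius_coch)
qed

lemma frobenius_closed:
  assumes "c \<in> carrier (C i)" shows "cech_frobenius p A xs i c \<in> carrier (C i)"
proof -
  from assms obtain a N where a: "\<And>I. a I \<in> carrier A" and c: "c = coch i a N" by (rule coch_cases) blast
  show ?thesis unfolding c frobenius_coch[of a, OF a] using a by (intro coch_closed) simp
qed

lemma frobenius_coboundary:
  assumes "c \<in> cech_coboundaries A xs i" shows "cech_frobenius p A xs i c \<in> cech_coboundaries A xs i"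
proof -
  from assms obtain b M where b: "\<And>I. b I \<in> carrier A" and c: "c = coch i (\<delta> M b) M"
    unfolding coboundaries_eq by blast
  have "cech_frobenius p A xs i c = coch i (\<lambda>I. \<delta> M b I [^] p) (M * p)"
    unfolding c cech_frobenius_def cochain_def
    by (intro restrict_ext) (simp add: localization_at.pow_frac[OF localization_elem] diff_closed[of b, OF b])
  also have "\<dots> = coch i (\<delta> (M * p) (\<lambda>I. b I [^] p)) (M * p)"
    unfolding cochain_def by (intro restrict_ext) (simp add: diff_frobenius[of b, OF b])
  finally show ?thesis unfolding coboundaries_eq using b by blast
qed

text \<open>Frobenius is additive and preserves coboundaries, so every representative of a class
  yields the same coset and the union in \<open>frobenius_action\<close> collapses.\<close>

lemma frobenius_action_coset:
  assumes c: "c \<in> carrier (C i)"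
  shows "frobenius_action p A xs i (cech_coboundaries A xs i #>\<^bsub>C i\<^esub> c) =
    cech_coboundaries A xs i #>\<^bsub>C i\<^esub> cech_frobenius p A xs i c"
proof -
  let ?B = "cech_coboundaries A xs i" and ?F = "cech_frobenius p A xs i"
  interpret C: comm_group "C i" by (rule comm_group_C)
  interpret B: subgroup ?B "C i" by (rule coboundaries_subgroup)
  have "?B #>\<^bsub>C i\<^esub> ?F d = ?B #>\<^bsub>C i\<^esub> ?F c" if "d \<in> ?B #>\<^bsub>C i\<^esub> c" for d
  proof -
    from that obtain b where b: "b \<in> ?B" and d: "d = b \<otimes>\<^bsub>C i\<^esub> c" by (auto simp: r_coset_def)
    have "?B #>\<^bsub>C i\<^esub> ?F d = (?B #>\<^bsub>C i\<^esub> ?F b) #>\<^bsub>C i\<^esub> ?F c"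
      unfolding d frobenius_mult[OF B.mem_carrier[OF b] c]
      by (rule C.coset_mult_assoc[symmetric]) (use frobenius_closed c b B.subset in auto)
    also have "?B #>\<^bsub>C i\<^esub> ?F b = ?B"
      using frobenius_coboundary[OF b] by (intro C.coset_join2 coboundaries_subgroup) auto
    finally show ?thesis .
  qed
  moreover have "c \<in> ?B #>\<^bsub>C i\<^esub> c" using c by (intro C.rcos_self coboundaries_subgroup)
  ultimately show ?thesis unfolding frobenius_action_def by blast
qed

lemma frobenius_action_iterate:
  assumes a: "\<And>I. a I \<in> carrier A"
  shows "(frobenius_action p A xs i ^^ n) (cech_coboundaries A xs i #>\<^bsub>C i\<^esub> coch i a N) =
    cech_coboundaries A xs i #>\<^bsub>C i\<^esub> coch i (\<lambda>I. a I [^] (p ^ n)) (N * p ^ n)"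
proof (induction n)
  case 0
  have "(\<lambda>I. a I [^] (1::nat)) = a" using a by simp
  then show ?case by simp
next
  case (Suc n)
  have an: "a I [^] (p ^ n) \<in> carrier A" for I using a by simp
  have "coch i (\<lambda>I. a I [^] (p ^ n)) (N * p ^ n) \<in> carrier (C i)" using an by (intro coch_closed)
  then show ?case
    using Suc.IH a
    by (simp add: frobenius_action_coset frobenius_coch[of "\<lambda>I. a I [^] (p ^ n)", OF an]
        nat_pow_pow mult.assoc power_Suc2 del: power_Suc)
qed

text \<open>A coset of the coboundaries is the neutral class exactly when its representative is a
  coboundary. Nilpotency becomes a condition on powers of numerators.\<close>

lemma frobenius_nilpotent_iff:
  "(\<forall>\<xi> \<in> carrier (local_cohomology A xs i).
      \<exists>n. (frobenius_action p A xs i ^^ n) \<xi> = \<one>\<^bsub>local_cohomology A xs i\<^esub>) \<longleftrightarrow>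
   (\<forall>a N. (\<forall>I. a I \<in> carrier A) \<longrightarrow> coch i a N \<in> cech_cocycles A xs i \<longrightarrow>
      (\<exists>n. coch i (\<lambda>I. a I [^] (p ^ n)) (N * p ^ n) \<in> cech_coboundaries A xs i))"
    (is "?l \<longleftrightarrow> ?r")
proof -
  let ?B = "cech_coboundaries A xs i" and ?Z = "cech_cocycles A xs i"
  interpret C: comm_group "C i" by (rule comm_group_C)
  have carr: "carrier (local_cohomology A xs i) = (\<lambda>c. ?B #>\<^bsub>C i\<^esub> c) ` ?Z"
    by (auto simp: local_cohomology_def FactGroup_def RCOSETS_def r_coset_def)
  have one: "\<one>\<^bsub>local_cohomology A xs i\<^esub> = ?B"
    by (simp add: local_cohomology_def FactGroup_def)
  have Z: "?Z \<subseteq> carrier (C i)" by (auto simp: cech_cocycles_def kernel_def)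
  have "?l \<longleftrightarrow> (\<forall>c\<in>?Z. \<exists>n. (frobenius_action p A xs i ^^ n) (?B #>\<^bsub>C i\<^esub> c) = ?B)"
    unfolding carr one by simp
  also have "\<dots> \<longleftrightarrow> (\<forall>a N. (\<forall>I. a I \<in> carrier A) \<longrightarrow> coch i a N \<in> ?Z \<longrightarrow>
      (\<exists>n. (frobenius_action p A xs i ^^ n) (?B #>\<^bsub>C i\<^esub> coch i a N) = ?B))"
  proof (intro iffI allI impI ballI)
    fix c assume *: "\<forall>a N. (\<forall>I. a I \<in> carrier A) \<longrightarrow> coch i a N \<in> ?Z \<longrightarrow>
      (\<exists>n. (frobenius_action p A xs i ^^ n) (?B #>\<^bsub>C i\<^esub> coch i a N) = ?B)" and c: "c \<in> ?Z"
    then have "c \<in> carrier (C i)" using Z by blast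
    then obtain a N where "\<And>I. a I \<in> carrier A" "c = coch i a N" by (rule coch_cases) blast
    with * c show "\<exists>n. (frobenius_action p A xs i ^^ n) (?B #>\<^bsub>C i\<^esub> c) = ?B" by blast
  qed blast
  also have "\<dots> \<longleftrightarrow> ?r"
  proof -
    have "(frobenius_action p A xs i ^^ n) (?B #>\<^bsub>C i\<^esub> coch i a N) = ?B \<longleftrightarrow>
        coch i (\<lambda>I. a I [^] (p ^ n)) (N * p ^ n) \<in> ?B" if a: "\<And>I. a I \<in> carrier A" for a n N
    proof -
      have "coch i (\<lambda>I. a I [^] (p ^ n)) (N * p ^ n) \<in> carrier (C i)" using a by (intro coch_closed) simp
      then show ?thesis unfolding frobenius_action_iterate[of a, OF a]
        using C.coset_join1[OF _ _ coboundaries_subgroup] C.coset_join2[OF _ coboundaries_subgroup] by blast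
    qed
    then show ?thesis by (intro all_cong1 imp_cong refl ex_cong1) blast
  qed
  finally show ?thesis .
qed

end

section \<open>Descent of Frobenius nilpotency along a semilinear retraction\<close>

lemma cech_index_map [simp]: "cech_index (map f xs) i = cech_index xs i"
  by (simp add: cech_index_def)

text \<open>A cocycle a/x^N maps to the cocycle \<psi>(a)/\<psi>(x)^N. If its p^n-th power is the
  differential of b/\<psi>(x)^M, applying \<open>\<theta>\<close> shows that the p^(n+e)-th power of
  a/x^N is the differential of \<theta>(b)/x^(Mq). Only powers of elements \<psi>(x) have to be
  pulled out of \<open>\<theta>\<close>, which semilinearity permits.\<close>

lemma frobenius_nilpotent_descent:
  fixes A (structure) and C :: "('b, 'c) ring_scheme"
  assumes A: "cech_complex A xs p" and C: "cech_complex C (map \<psi> xs) p"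
    and psi: "ring_hom_ring A C \<psi>"
    and theta: "abelian_group_hom C A \<theta>" "\<theta> \<one>\<^bsub>C\<^esub> = \<one>"
    and semilinear: "\<And>a c. \<lbrakk>a \<in> carrier A; c \<in> carrier C\<rbrakk> \<Longrightarrow> \<theta> (\<psi> a \<otimes>\<^bsub>C\<^esub> c) = a [^] (p ^ e) \<otimes> \<theta> c"
    and nil: "\<forall>\<xi> \<in> carrier (local_cohomology C (map \<psi> xs) i).
      \<exists>n. (frobenius_action p C (map \<psi> xs) i ^^ n) \<xi> = \<one>\<^bsub>local_cohomology C (map \<psi> xs) i\<^esub>"
  shows "\<forall>\<xi> \<in> carrier (local_cohomology A xs i).
      \<exists>n. (frobenius_action p A xs i ^^ n) \<xi> = \<one>\<^bsub>local_cohomology A xs i\<^esub>"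
proof -
  interpret A: cech_complex A xs p by fact
  interpret C: cech_complex C "map \<psi> xs" p by fact
  interpret psi: ring_hom_ring A C \<psi> by fact
  interpret theta: abelian_group_hom C A \<theta> by fact
  let ?ix = "cech_index xs" and ?x = "cech_elem A xs" and ?q = "p ^ e"
  have nth: "map \<psi> xs ! j = \<psi> (xs ! j)" "xs ! j \<in> carrier A" if "j \<in> I" "I \<in> ?ix i" for j I i
    using A.ixD(1)[OF that(2)] that A.nth_closed[OF that] by auto
  have elem: "cech_elem C (map \<psi> xs) I = \<psi> (?x I)" if I: "I \<in> ?ix i" for I i
  proof -
    have "ring_hom_cring A C \<psi>"
      by (rule ring_hom_cringI[OF A.is_cring C.is_cring psi.homh])
    from ring_hom_cring.hom_finprod[OF this, of "\<lambda>j. xs ! j" I]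
    show ?thesis unfolding cech_elem_def using nth[OF _ I]
      by (auto intro!: C.finprod_cong' simp: Pi_def)
  qed
  have diff_psi: "diff_numerator C (map \<psi> xs) N (\<lambda>I. \<psi> (a I)) J = \<psi> (A.\<delta> N a J)"
    if a: "\<And>I. a I \<in> carrier A" and J: "J \<in> ?ix i" for a J N i
    unfolding diff_numerator_def
    using A.diff_summand_closed[of a, OF a J] A.ixD(2)[OF J] nth[OF _ J] a
    by (subst psi.add_hom_finsum) (auto intro!: C.finsum_cong' simp: psi.hom_int_multiple psi.hom_nat_pow)
  have diff_theta: "\<theta> (diff_numerator C (map \<psi> xs) M b J) = A.\<delta> (M * ?q) (\<lambda>I. \<theta> (b I)) J"
    if b: "\<And>I. b I \<in> carrier C" and J: "J \<in> ?ix i" for b J M i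
  proof -
    have "\<theta> ((map \<psi> xs ! j) [^]\<^bsub>C\<^esub> M \<otimes>\<^bsub>C\<^esub> b (J - {j})) = (xs ! j) [^] (M * ?q) \<otimes> \<theta> (b (J - {j}))"
      if j: "j \<in> J" for j
      using semilinear[of "(xs ! j) [^] M" "b (J - {j})"] nth[OF j J] b
      by (simp add: psi.hom_nat_pow A.nat_pow_pow)
    then show ?thesis
      unfolding diff_numerator_def
      using C.diff_summand_closed[of b J i, OF b] A.ixD(2)[OF J] nth[OF _ J] b J
      by (subst theta.add_hom_finsum) (auto intro!: A.finsum_cong' simp: theta.hom_int_multiple)
  qed
  have cocycle: "C.coch i (\<lambda>I. \<psi> (a I)) N \<in> cech_cocycles C (map \<psi> xs) i"
    if a: "\<And>I. a I \<in> carrier A" and z: "A.coch i a N \<in> cech_cocycles A xs i" for a N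
  proof -
    have "\<exists>k::nat. cech_elem C (map \<psi> xs) J [^]\<^bsub>C\<^esub> k \<otimes>\<^bsub>C\<^esub> C.\<delta> N (\<lambda>I. \<psi> (a I)) J = \<zero>\<^bsub>C\<^esub>"
      if J: "J \<in> ?ix (Suc i)" for J
    proof -
      from z J obtain k :: nat where "?x J [^] k \<otimes> A.\<delta> N a J = \<zero>"
        using A.cocycle_iff[of a, OF a] by blast
      then have "\<psi> (?x J [^] k \<otimes> A.\<delta> N a J) = \<psi> \<zero>" by simp
      then show ?thesis
        using A.diff_closed[of a, OF a J] A.elem_closed[OF J] diff_psi[of a, OF a J] elem[OF J]
        by (auto simp: psi.hom_nat_pow)
    qed
    then show ?thesis using C.cocycle_iff[of "\<lambda>I. \<psi> (a I)"] a by simp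
  qed
  have coboundary: "A.coch i (\<lambda>I. a I [^] (p ^ (n + e))) (N * p ^ (n + e)) \<in> cech_coboundaries A xs i"
    if a: "\<And>I. a I \<in> carrier A"
      and z: "C.coch i (\<lambda>I. \<psi> (a I) [^]\<^bsub>C\<^esub> (p ^ n)) (N * p ^ n) \<in> cech_coboundaries C (map \<psi> xs) i" for a N n
  proof -
    have pow_e: "p ^ (n + e) = p ^ n * p ^ e" by (rule power_add)
    let ?y = "cech_elem C (map \<psi> xs)"
    have "\<psi> (a I) [^]\<^bsub>C\<^esub> (p ^ n) \<in> carrier C" for I using a by simp
    from z[unfolded C.coboundary_iff[of "\<lambda>I. \<psi> (a I) [^]\<^bsub>C\<^esub> (p ^ n)", OF this]]
    obtain M b where b': "\<forall>I. b I \<in> carrier C" and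
      eq: "\<forall>I\<in>?ix i. \<exists>k::nat. ?y I [^]\<^bsub>C\<^esub> k \<otimes>\<^bsub>C\<^esub> (?y I [^]\<^bsub>C\<^esub> M \<otimes>\<^bsub>C\<^esub> \<psi> (a I) [^]\<^bsub>C\<^esub> (p ^ n))
        = ?y I [^]\<^bsub>C\<^esub> k \<otimes>\<^bsub>C\<^esub> (?y I [^]\<^bsub>C\<^esub> (N * p ^ n) \<otimes>\<^bsub>C\<^esub> C.\<delta> M b I)"
      unfolding cech_index_map by blast
    from b' have b: "\<And>I. b I \<in> carrier C" by blast
    have main: "\<exists>k::nat. ?x I [^] k \<otimes> (?x I [^] (M * ?q) \<otimes> a I [^] (p ^ (n + e)))
        = ?x I [^] k \<otimes> (?x I [^] (N * p ^ (n + e)) \<otimes> A.\<delta> (M * ?q) (\<lambda>I. \<theta> (b I)) I)" if I: "I \<in> ?ix i" for I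
    proof -
      from eq I obtain k :: nat where
        k: "?y I [^]\<^bsub>C\<^esub> k \<otimes>\<^bsub>C\<^esub> (?y I [^]\<^bsub>C\<^esub> M \<otimes>\<^bsub>C\<^esub> \<psi> (a I) [^]\<^bsub>C\<^esub> (p ^ n))
        = ?y I [^]\<^bsub>C\<^esub> k \<otimes>\<^bsub>C\<^esub> (?y I [^]\<^bsub>C\<^esub> (N * p ^ n) \<otimes>\<^bsub>C\<^esub> C.\<delta> M b I)" by blast
      have x: "?x I \<in> carrier A" using I by simp
      have d: "C.\<delta> M b I \<in> carrier C" using C.diff_closed[of b, OF b] I by simp
      \<comment> \<open>The factor 1 is inserted so that semilinearity applies on this side too;
        \<theta>(1) = 1 then returns the plain q-th power.\<close>
      have "\<psi> (?x I [^] k \<otimes> (?x I [^] M \<otimes> a I [^] (p ^ n))) \<otimes>\<^bsub>C\<^esub> \<one>\<^bsub>C\<^esub>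
          = \<psi> (?x I [^] k \<otimes> ?x I [^] (N * p ^ n)) \<otimes>\<^bsub>C\<^esub> C.\<delta> M b I"
        using k x d a by (simp add: elem[OF I] psi.hom_nat_pow C.m_assoc)
      then have "\<theta> (\<psi> (?x I [^] k \<otimes> (?x I [^] M \<otimes> a I [^] (p ^ n))) \<otimes>\<^bsub>C\<^esub> \<one>\<^bsub>C\<^esub>)
          = \<theta> (\<psi> (?x I [^] k \<otimes> ?x I [^] (N * p ^ n)) \<otimes>\<^bsub>C\<^esub> C.\<delta> M b I)" by (rule arg_cong)
      then have "(?x I [^] k \<otimes> (?x I [^] M \<otimes> a I [^] (p ^ n))) [^] ?q
          = (?x I [^] k \<otimes> ?x I [^] (N * p ^ n)) [^] ?q \<otimes> A.\<delta> (M * ?q) (\<lambda>I. \<theta> (b I)) I"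
        using semilinear[of "?x I [^] k \<otimes> (?x I [^] M \<otimes> a I [^] (p ^ n))" "\<one>\<^bsub>C\<^esub>"]
          semilinear[of "?x I [^] k \<otimes> ?x I [^] (N * p ^ n)" "C.\<delta> M b I"]
          x a d theta(2) diff_theta[of b, OF b I]
        by (simp del: psi.hom_mult A.nat_pow_mult)
      then have "?x I [^] (k * ?q) \<otimes> (?x I [^] (M * ?q) \<otimes> a I [^] (p ^ (n + e)))
        = ?x I [^] (k * ?q) \<otimes> (?x I [^] (N * p ^ (n + e)) \<otimes> A.\<delta> (M * ?q) (\<lambda>I. \<theta> (b I)) I)"
        using x a A.diff_closed[of "\<lambda>I. \<theta> (b I)" I i "M * ?q"] I b
        by (simp add: pow_e mult.assoc[symmetric] A.nat_pow_distrib A.nat_pow_pow A.m_assoc del: A.nat_pow_mult)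
      then show ?thesis by blast
    qed
    have "\<exists>M' b'. (\<forall>I. b' I \<in> carrier A) \<and> (\<forall>I\<in>?ix i. \<exists>k::nat.
        ?x I [^] k \<otimes> (?x I [^] M' \<otimes> a I [^] (p ^ (n + e)))
        = ?x I [^] k \<otimes> (?x I [^] (N * p ^ (n + e)) \<otimes> A.\<delta> M' b' I))"
      by (rule exI[of _ "M * ?q"], rule exI[of _ "\<lambda>I. \<theta> (b I)"])
        (intro conjI ballI allI theta.hom_closed b main)
    moreover have "a I [^] (p ^ (n + e)) \<in> carrier A" for I using a by simp
    ultimately show ?thesis by (simp only: A.coboundary_iff)
  qed
  show ?thesis
    unfolding A.frobenius_nilpotent_iff
  proof (intro allI impI)
    fix a N assume "\<forall>I. a I \<in> carrier A" and z: "A.coch i a N \<in> cech_cocycles A xs i"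
    then have a: "a I \<in> carrier A" for I by blast
    then have pa: "\<forall>I. \<psi> (a I) \<in> carrier C" by simp
    from nil[unfolded C.frobenius_nilpotent_iff, rule_format, OF pa[rule_format] cocycle[of a, OF a z]]
    obtain n where "C.coch i (\<lambda>I. \<psi> (a I) [^]\<^bsub>C\<^esub> (p ^ n)) (N * p ^ n) \<in> cech_coboundaries C (map \<psi> xs) i" ..
    from coboundary[of a, OF a this]
    show "\<exists>n. A.coch i (\<lambda>I. a I [^] (p ^ n)) (N * p ^ n) \<in> cech_coboundaries A xs i" by blast
  qed
qed

section \<open>Nakayama's lemma\<close>

text \<open>An ideal maximal among those that contain I and miss a multiplicative set is prime. The
  maximality clause is exported because W = {1} then produces a maximal ideal.\<close>

lemma (in cring) exists_prime_avoiding: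
  assumes I: "ideal I R" and one: "\<one> \<in> W" and mult: "\<And>x y. \<lbrakk>x \<in> W; y \<in> W\<rbrakk> \<Longrightarrow> x \<otimes> y \<in> W"
    and disj: "I \<inter> W = {}"
  obtains M where "primeideal M R" "I \<subseteq> M" "M \<inter> W = {}"
    "\<And>J. \<lbrakk>ideal J R; M \<subseteq> J; J \<inter> W = {}\<rbrakk> \<Longrightarrow> J = M"
proof -
  let ?A = "{J. ideal J R \<and> I \<subseteq> J \<and> J \<inter> W = {}}"
  have "\<exists>M\<in>?A. \<forall>Y\<in>?A. M \<subseteq> Y \<longrightarrow> Y = M"
  proof (rule subset_Zorn_nonempty)
    show "?A \<noteq> {}" using I disj by blast
    fix C assume C: "C \<noteq> {}" "subset.chain ?A C"
    then have "subset.chain {J. ideal J R} C" by (auto simp: pred_on.chain_def)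
    from chain_Union_is_ideal[OF this] C(1) have "ideal (\<Union>C) R" by simp
    with C show "\<Union>C \<in> ?A" by (auto simp: pred_on.chain_def)
  qed
  then obtain M where MA: "M \<in> ?A" and max': "\<forall>Y\<in>?A. M \<subseteq> Y \<longrightarrow> Y = M" by blast
  from MA have M: "ideal M R" "I \<subseteq> M" "M \<inter> W = {}" by auto
  have max: "J = M" if "ideal J R" "M \<subseteq> J" "J \<inter> W = {}" for J
    using that M max' by blast
  interpret M: ideal M R by fact
  \<comment> \<open>By maximality, M together with an element outside M generates an ideal that
    meets W.\<close>
  have hit: "\<exists>m r. m \<in> M \<and> r \<in> carrier R \<and> m \<oplus> r \<otimes> a \<in> W" if a: "a \<in> carrier R" "a \<notin> M" for a
  proof -
    let ?J = "set_add R M (PIdl a)"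
    have J: "ideal ?J R" by (intro add_ideals M cgenideal_ideal a)
    have sub: "M \<subseteq> ?J"
    proof
      fix x assume "x \<in> M"
      then have "x = x \<oplus> \<zero> \<otimes> a" using a by simp
      with \<open>x \<in> M\<close> show "x \<in> ?J" by (auto simp: set_add_def' cgenideal_def)
    qed
    have "a = \<zero> \<oplus> \<one> \<otimes> a" using a by simp
    moreover have "\<one> \<otimes> a \<in> PIdl a" unfolding cgenideal_def using one_closed by blast
    ultimately have "a \<in> ?J" using M.zero_closed unfolding set_add_def' by blast
    with a max[OF J sub] have "?J \<inter> W \<noteq> {}" by blast
    then show ?thesis by (auto simp: set_add_def' cgenideal_def)
  qed
  have "primeideal M R"
  proof (rule primeidealI[OF M(1) is_cring])
    show "carrier R \<noteq> M" using one M(3) by auto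
    fix a b assume ab: "a \<in> carrier R" "b \<in> carrier R" "a \<otimes> b \<in> M"
    show "a \<in> M \<or> b \<in> M"
    proof (rule ccontr)
      assume "\<not> (a \<in> M \<or> b \<in> M)"
      then obtain m r n s where m: "m \<in> M" "r \<in> carrier R" "m \<oplus> r \<otimes> a \<in> W"
        and n: "n \<in> M" "s \<in> carrier R" "n \<oplus> s \<otimes> b \<in> W"
        using hit ab by meson
      have c: "m \<in> carrier R" "n \<in> carrier R" using m n by auto
      \<comment> \<open>If neither factor of a product in M were in M, two elements of W would
        multiply into M: every term of the expansion contains m, n or ab.\<close>
      have "(m \<oplus> r \<otimes> a) \<otimes> (n \<oplus> s \<otimes> b) = m \<otimes> (n \<oplus> s \<otimes> b) \<oplus> ((r \<otimes> a) \<otimes> n \<oplus> (r \<otimes> s) \<otimes> (a \<otimes> b))"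
        using c m n ab by (simp add: l_distr r_distr m_ac a_ac)
      also have "\<dots> \<in> M" using c m n ab M.I_r_closed[of m "n \<oplus> s \<otimes> b"] M.I_l_closed[of n "r \<otimes> a"] M.I_l_closed[of "a \<otimes> b" "r \<otimes> s"]
        by simp
      finally show False using mult[OF m(3) n(3)] M(3) by blast
    qed
  qed
  then show thesis using M max by (intro that)
qed

lemma (in additive_subgroup) finsum_mem:
  assumes "abelian_group G" "finite B" "\<And>b. b \<in> B \<Longrightarrow> f b \<in> H"
  shows "(\<Oplus>\<^bsub>G\<^esub>b\<in>B. f b) \<in> H"
proof -
  interpret abelian_group G by fact
  show ?thesis using assms(2,3)
    by (induction B rule: finite_induct) (simp_all add: Pi_def)
qed

text \<open>
  A division-free form of Gaussian elimination, replacing the determinant trick.  Taking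
  \<open>W\<close> and \<open>D\<close> constant gives Nakayama's lemma at a prime; taking monic polynomials of degree \<open>n\<close>
  and polynomials of smaller degree in one element gives integrality of finite extensions.
\<close>

lemma (in cring) elimination:
  fixes W D :: "nat \<Rightarrow> 'a set"
  assumes W: "\<And>n. W n \<subseteq> carrier R" and D: "\<And>n. D n \<subseteq> carrier R"
    and D_add: "\<And>n a b. \<lbrakk>a \<in> D n; b \<in> D n\<rbrakk> \<Longrightarrow> a \<oplus> b \<in> D n"
    and D_mult: "\<And>n m a b. \<lbrakk>a \<in> D n; b \<in> D m\<rbrakk> \<Longrightarrow> a \<otimes> b \<in> D (n + m)"
    and WD: "\<And>n m w a. \<lbrakk>w \<in> W n; a \<in> D m\<rbrakk> \<Longrightarrow> w \<otimes> a \<in> D (n + m)"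
    and WW: "\<And>n m w v. \<lbrakk>w \<in> W n; v \<in> W m\<rbrakk> \<Longrightarrow> w \<otimes> v \<in> W (n + m)"
    and WmD: "\<And>n w a. \<lbrakk>w \<in> W n; a \<in> D n\<rbrakk> \<Longrightarrow> w \<ominus> a \<in> W n"
    and T: "additive_subgroup T R"
    and WT: "\<And>n w t. \<lbrakk>w \<in> W n; t \<in> T\<rbrakk> \<Longrightarrow> w \<otimes> t \<in> T"
    and DT: "\<And>n a t. \<lbrakk>a \<in> D n; t \<in> T\<rbrakk> \<Longrightarrow> a \<otimes> t \<in> T"
    and B: "finite B" "B \<subseteq> carrier R"
    and r: "r \<in> W n" "\<And>b. b \<in> B \<Longrightarrow> \<exists>t\<in>T. \<exists>a\<in>B \<rightarrow> D n. r \<otimes> b = t \<oplus> (\<Oplus>c\<in>B. a c \<otimes> c)"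
  shows "\<exists>N. \<exists>s\<in>W N. \<forall>b\<in>B. s \<otimes> b \<in> T"
  using B r
proof (induction B arbitrary: r n rule: finite_induct)
  case empty
  then show ?case by blast
next
  case (insert x F)
  interpret T: additive_subgroup T R by fact
  have x: "x \<in> carrier R" and F: "F \<subseteq> carrier R" using insert.prems(1) by auto
  have r: "r \<in> carrier R" using insert.prems(2) W by blast
  have split: "(\<Oplus>c\<in>insert x F. a c \<otimes> c) = a x \<otimes> x \<oplus> (\<Oplus>c\<in>F. a c \<otimes> c)"
    if "a \<in> insert x F \<rightarrow> D n" for a
    using that D x F insert.hyps by (subst finsum_insert) (auto simp: Pi_def subset_iff)
  have closed: "(\<Oplus>c\<in>F. a c \<otimes> c) \<in> carrier R" if "a \<in> F \<rightarrow> carrier R" for a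
    using that F by (intro finsum_closed) auto
  obtain t a where ta: "t \<in> T" "a \<in> insert x F \<rightarrow> D n"
    and rx: "r \<otimes> x = t \<oplus> (\<Oplus>c\<in>insert x F. a c \<otimes> c)"
    using insert.prems(3)[of x] by blast
  have aD: "a c \<in> D n" "a c \<in> carrier R" if "c \<in> insert x F" for c using ta(2) that D[of n] by auto
  let ?s = "\<Oplus>c\<in>F. a c \<otimes> c"
  have s: "?s \<in> carrier R" using aD by (intro closed) auto
  \<comment> \<open>Moving the diagonal coefficient to the left gives u x as an element of T plus a
    combination of F alone. No division by u takes place.\<close>
  define u where "u = r \<ominus> a x"
  have uW: "u \<in> W n" unfolding u_def using insert.prems(2) aD by (intro WmD) auto
  have u: "u \<in> carrier R" using uW W by blast
  have ux: "u \<otimes> x = t \<oplus> ?s"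
  proof -
    have "u \<otimes> x = r \<otimes> x \<oplus> (\<ominus> a x) \<otimes> x"
      unfolding u_def using r x aD[of x] by (simp add: minus_eq l_distr)
    also have "\<dots> = t \<oplus> ?s"
      unfolding rx split[OF ta(2)] using x s aD[of x] T.a_subset ta(1)
      by (simp add: l_minus a_ac subset_iff r_neg1 r_neg2)
    finally show ?thesis .
  qed
  \<comment> \<open>Multiplying the relation for b by u makes x appear only as u x, which is then
    substituted. The smaller family F satisfies relations of the same shape, with degree doubled to
    n + n.\<close>
  have "\<exists>t'\<in>T. \<exists>a'\<in>F \<rightarrow> D (n + n). (u \<otimes> r) \<otimes> b = t' \<oplus> (\<Oplus>c\<in>F. a' c \<otimes> c)" if b: "b \<in> F" for b
  proof -
    obtain t' a' where ta': "t' \<in> T" "a' \<in> insert x F \<rightarrow> D n"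
      and rb: "r \<otimes> b = t' \<oplus> (\<Oplus>c\<in>insert x F. a' c \<otimes> c)"
      using insert.prems(3)[of b] b by blast
    have aD': "a' c \<in> D n" "a' c \<in> carrier R" if "c \<in> insert x F" for c using ta'(2) that D[of n] by auto
    let ?s' = "\<Oplus>c\<in>F. a' c \<otimes> c"
    have s': "?s' \<in> carrier R" using aD' by (intro closed) auto
    have tc: "t \<in> carrier R" "t' \<in> carrier R" using ta(1) ta'(1) T.a_subset by auto
    have "(u \<otimes> r) \<otimes> b = u \<otimes> (t' \<oplus> (a' x \<otimes> x \<oplus> ?s'))"
      using u r b F rb split[OF ta'(2)] by (simp add: m_assoc subset_iff)
    also have "\<dots> = u \<otimes> t' \<oplus> (a' x \<otimes> (u \<otimes> x) \<oplus> u \<otimes> ?s')"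
      using u tc s' aD'[of x] x by (simp add: r_distr m_ac)
    also have "\<dots> = (u \<otimes> t' \<oplus> a' x \<otimes> t) \<oplus> (u \<otimes> ?s' \<oplus> a' x \<otimes> ?s)"
      unfolding ux using u tc s s' aD'[of x] by (simp add: r_distr a_ac)
    also have "u \<otimes> ?s' \<oplus> a' x \<otimes> ?s = (\<Oplus>c\<in>F. u \<otimes> (a' c \<otimes> c)) \<oplus> (\<Oplus>c\<in>F. a' x \<otimes> (a c \<otimes> c))"
      using u aD aD' F insert.hyps(1) by (subst (1 2) finsum_rdistr) (auto simp: subset_iff)
    also have "\<dots> = (\<Oplus>c\<in>F. u \<otimes> (a' c \<otimes> c) \<oplus> a' x \<otimes> (a c \<otimes> c))"
      using u aD aD' F by (subst finsum_addf) (auto simp: subset_iff)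
    also have "\<dots> = (\<Oplus>c\<in>F. (u \<otimes> a' c \<oplus> a' x \<otimes> a c) \<otimes> c)"
      using u aD aD' F by (intro finsum_cong') (auto simp: subset_iff l_distr m_assoc)
    finally have eq: "(u \<otimes> r) \<otimes> b = (u \<otimes> t' \<oplus> a' x \<otimes> t) \<oplus> (\<Oplus>c\<in>F. (u \<otimes> a' c \<oplus> a' x \<otimes> a c) \<otimes> c)" .
    have "u \<otimes> t' \<oplus> a' x \<otimes> t \<in> T" using WT[OF uW ta'(1)] DT[OF aD'(1) ta(1), of x] by auto
    moreover have "(\<lambda>c. u \<otimes> a' c \<oplus> a' x \<otimes> a c) \<in> F \<rightarrow> D (n + n)"
      using aD(1) aD'(1) by (auto intro!: D_add WD[OF uW] D_mult[OF _ aD(1)])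
    ultimately show ?thesis using eq
      by (intro bexI[of _ "u \<otimes> t' \<oplus> a' x \<otimes> t"] bexI[of _ "\<lambda>c. u \<otimes> a' c \<oplus> a' x \<otimes> a c"])
  qed
  from insert.IH[OF F WW[OF uW insert.prems(2)] this]
  obtain N v where v: "v \<in> W N" "\<And>b. b \<in> F \<Longrightarrow> v \<otimes> b \<in> T" by blast
  have vc: "v \<in> carrier R" using v W by blast
  \<comment> \<open>The element v from the induction handles F; the extra factor u is what brings x
    back in, through u x.\<close>
  have "(v \<otimes> u) \<otimes> b \<in> T" if b: "b \<in> F" for b
  proof -
    have "(v \<otimes> u) \<otimes> b = u \<otimes> (v \<otimes> b)" using vc u b F by (simp add: m_ac subset_iff)
    then show ?thesis using WT[OF uW v(2)[OF b]] by simp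
  qed
  moreover have "(v \<otimes> u) \<otimes> x \<in> T"
  proof -
    have "(v \<otimes> u) \<otimes> x = v \<otimes> t \<oplus> (\<Oplus>c\<in>F. v \<otimes> (a c \<otimes> c))"
      using vc u x ux s ta(1) T.a_subset aD F insert.hyps(1)
      by (simp add: m_assoc r_distr finsum_rdistr Pi_def subset_iff)
    also have "\<dots> = v \<otimes> t \<oplus> (\<Oplus>c\<in>F. a c \<otimes> (v \<otimes> c))"
      using vc aD F by (intro arg_cong2[where f = "(\<oplus>)"] refl finsum_cong') (auto simp: subset_iff m_ac)
    also have "\<dots> \<in> T"
      using WT[OF v(1) ta(1)] DT[OF aD(1) v(2)] insert.hyps(1)
      by (intro T.a_closed T.finsum_mem is_abelian_group) auto
    finally show ?thesis .
  qed
  ultimately show ?case using WW[OF v(1) uW] by blast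
qed

text \<open>For the module N spanned by T and B, the hypothesis says that r N lies in T + Q N with r
  outside Q, so N/T equals Q(N/T) after localising at Q. That N/T vanishes at Q is expressed without
  localising, by one s outside Q that moves all of B into T.\<close>

lemma (in ring_hom_cring) nakayama:
  assumes Q: "primeideal Q R" and T: "additive_subgroup T S"
    and smult: "\<And>r t. \<lbrakk>r \<in> carrier R; t \<in> T\<rbrakk> \<Longrightarrow> h r \<otimes>\<^bsub>S\<^esub> t \<in> T"
    and B: "finite B" "B \<subseteq> carrier S"
    and r: "r \<in> carrier R - Q"
      "\<And>b. b \<in> B \<Longrightarrow> \<exists>t\<in>T. \<exists>a\<in>B \<rightarrow> Q. h r \<otimes>\<^bsub>S\<^esub> b = t \<oplus>\<^bsub>S\<^esub> (\<Oplus>\<^bsub>S\<^esub>c\<in>B. h (a c) \<otimes>\<^bsub>S\<^esub> c)"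
  shows "\<exists>s\<in>carrier R - Q. \<forall>b\<in>B. h s \<otimes>\<^bsub>S\<^esub> b \<in> T"
proof -
  interpret Q: primeideal Q R by fact
  let ?W = "\<lambda>_::nat. h ` (carrier R - Q)" and ?D = "\<lambda>_::nat. h ` Q"
  have Qc: "q \<in> carrier R" if "q \<in> Q" for q using that by auto
  have "\<exists>N. \<exists>s\<in>?W N. \<forall>b\<in>B. s \<otimes>\<^bsub>S\<^esub> b \<in> T"
  proof (rule S.elimination[where D = ?D, OF _ _ _ _ _ _ _ T _ _ B])
    fix n show "?W n \<subseteq> carrier S" "?D n \<subseteq> carrier S" using Qc by auto
  next
    fix n a b assume "a \<in> ?D n" "b \<in> ?D n"
    then obtain a' b' where "a' \<in> Q" "b' \<in> Q" "a = h a'" "b = h b'" by auto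
    then have "a \<oplus>\<^bsub>S\<^esub> b = h (a' \<oplus> b')" "a' \<oplus> b' \<in> Q" using Qc by auto
    then show "a \<oplus>\<^bsub>S\<^esub> b \<in> ?D n" by blast
  next
    fix n m a b assume "a \<in> ?D n" "b \<in> ?D m"
    then obtain a' b' where "a' \<in> Q" "b' \<in> Q" "a = h a'" "b = h b'" by auto
    then have "a \<otimes>\<^bsub>S\<^esub> b = h (a' \<otimes> b')" "a' \<otimes> b' \<in> Q" using Qc Q.I_l_closed by auto
    then show "a \<otimes>\<^bsub>S\<^esub> b \<in> ?D (n + m)" by blast
  next
    fix n m a b assume "a \<in> ?W n" "b \<in> ?D m"
    then obtain a' b' where "a' \<in> carrier R" "b' \<in> Q" "a = h a'" "b = h b'" by auto
    then have "a \<otimes>\<^bsub>S\<^esub> b = h (a' \<otimes> b')" "a' \<otimes> b' \<in> Q" using Qc Q.I_l_closed by auto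
    then show "a \<otimes>\<^bsub>S\<^esub> b \<in> ?D (n + m)" by blast
  next
    fix n m a b assume "a \<in> ?W n" "b \<in> ?W m"
    then obtain a' b' where ab: "a' \<in> carrier R - Q" "b' \<in> carrier R - Q" "a = h a'" "b = h b'" by auto
    then have "a \<otimes>\<^bsub>S\<^esub> b = h (a' \<otimes> b')" "a' \<otimes> b' \<in> carrier R - Q" using Q.I_prime[of a' b'] by auto
    then show "a \<otimes>\<^bsub>S\<^esub> b \<in> ?W (n + m)" by blast
  next
    fix n w a assume "w \<in> ?W n" "a \<in> ?D n"
    then obtain w' a' where wa: "w' \<in> carrier R" "w' \<notin> Q" "a' \<in> Q" "w = h w'" "a = h a'" by auto
    \<comment> \<open>The complement of Q is stable under subtracting elements of Q; this is what
      keeps the pivots of the elimination outside Q.\<close>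
    have "w' \<ominus> a' \<notin> Q"
    proof
      assume "w' \<ominus> a' \<in> Q"
      with wa(3) have "w' \<ominus> a' \<oplus> a' \<in> Q" by blast
      with wa Qc[OF wa(3)] show False by (simp add: R.minus_eq R.a_assoc R.l_neg)
    qed
    moreover have "w \<ominus>\<^bsub>S\<^esub> a = h (w' \<ominus> a')" using wa Qc[OF wa(3)] by (simp add: R.minus_eq S.minus_eq)
    ultimately show "w \<ominus>\<^bsub>S\<^esub> a \<in> ?W n" using wa Qc[OF wa(3)] by blast
  next
    fix n w t assume "w \<in> ?W n" "t \<in> T"
    then show "w \<otimes>\<^bsub>S\<^esub> t \<in> T" using smult by auto
  next
    fix n a t assume "a \<in> ?D n" "t \<in> T"
    then show "a \<otimes>\<^bsub>S\<^esub> t \<in> T" using smult Qc by auto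
  next
    show "h r \<in> ?W 0" using r(1) by auto
  next
    fix b assume "b \<in> B"
    from r(2)[OF this] obtain t a where ta: "t \<in> T" "a \<in> B \<rightarrow> Q"
      and e: "h r \<otimes>\<^bsub>S\<^esub> b = t \<oplus>\<^bsub>S\<^esub> (\<Oplus>\<^bsub>S\<^esub>c\<in>B. h (a c) \<otimes>\<^bsub>S\<^esub> c)" by blast
    have "(\<lambda>c. h (a c)) \<in> B \<rightarrow> ?D 0" using ta by auto
    with ta(1) e show "\<exists>t\<in>T. \<exists>a\<in>B \<rightarrow> ?D 0. h r \<otimes>\<^bsub>S\<^esub> b = t \<oplus>\<^bsub>S\<^esub> (\<Oplus>\<^bsub>S\<^esub>c\<in>B. a c \<otimes>\<^bsub>S\<^esub> c)"
      by (intro bexI[of _ t] bexI[of _ "\<lambda>c. h (a c)"])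
  qed
  then show ?thesis by auto
qed

section \<open>Finite ring homomorphisms\<close>

text \<open>Generation of S is left to a later locale, so that the same combinations also describe,
  with \<open>h\<close> the identity, the ideal spanned by the coefficients of a relation.\<close>

locale finite_family = ring_hom_cring R S h for R (structure) and S (structure) and h +
  fixes B
  assumes finite_B: "finite B" and B_closed: "B \<subseteq> carrier S"
begin

definition comb where "comb c = (\<Oplus>\<^bsub>S\<^esub>b\<in>B. h (c b) \<otimes>\<^bsub>S\<^esub> b)"

lemma comb_cong: "(\<And>b. b \<in> B \<Longrightarrow> c b = d b) \<Longrightarrow> d \<in> B \<rightarrow> carrier R \<Longrightarrow> comb c = comb d"
  unfolding comb_def using B_closed by (intro S.finsum_cong') auto

lemma comb_closed [simp]: "c \<in> B \<rightarrow> carrier R \<Longrightarrow> comb c \<in> carrier S"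
  unfolding comb_def using B_closed by (intro S.finsum_closed) auto

lemma comb_add:
  assumes "c \<in> B \<rightarrow> carrier R" "d \<in> B \<rightarrow> carrier R"
  shows "comb c \<oplus>\<^bsub>S\<^esub> comb d = comb (\<lambda>b. c b \<oplus> d b)"
proof -
  have "comb c \<oplus>\<^bsub>S\<^esub> comb d = (\<Oplus>\<^bsub>S\<^esub>b\<in>B. h (c b) \<otimes>\<^bsub>S\<^esub> b \<oplus>\<^bsub>S\<^esub> h (d b) \<otimes>\<^bsub>S\<^esub> b)"
    unfolding comb_def using assms B_closed by (subst S.finsum_addf) auto
  also have "\<dots> = comb (\<lambda>b. c b \<oplus> d b)"
    unfolding comb_def using assms B_closed by (intro S.finsum_cong') (auto simp: S.l_distr Pi_def subset_iff)
  finally show ?thesis .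
qed

lemma comb_smult:
  assumes "r \<in> carrier R" "c \<in> B \<rightarrow> carrier R"
  shows "h r \<otimes>\<^bsub>S\<^esub> comb c = comb (\<lambda>b. r \<otimes> c b)"
proof -
  have "h r \<otimes>\<^bsub>S\<^esub> comb c = (\<Oplus>\<^bsub>S\<^esub>b\<in>B. h r \<otimes>\<^bsub>S\<^esub> (h (c b) \<otimes>\<^bsub>S\<^esub> b))"
    unfolding comb_def using assms B_closed finite_B by (subst S.finsum_rdistr) auto
  also have "\<dots> = comb (\<lambda>b. r \<otimes> c b)"
    unfolding comb_def using assms B_closed by (intro S.finsum_cong') (auto simp: S.m_assoc Pi_def subset_iff)
  finally show ?thesis .
qed

lemma comb_mult:
  assumes "x \<in> carrier S" "c \<in> B \<rightarrow> carrier R"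
  shows "x \<otimes>\<^bsub>S\<^esub> comb c = (\<Oplus>\<^bsub>S\<^esub>b\<in>B. h (c b) \<otimes>\<^bsub>S\<^esub> (x \<otimes>\<^bsub>S\<^esub> b))"
proof -
  have "x \<otimes>\<^bsub>S\<^esub> comb c = (\<Oplus>\<^bsub>S\<^esub>b\<in>B. x \<otimes>\<^bsub>S\<^esub> (h (c b) \<otimes>\<^bsub>S\<^esub> b))"
    unfolding comb_def using assms B_closed finite_B by (subst S.finsum_rdistr) auto
  also have "\<dots> = (\<Oplus>\<^bsub>S\<^esub>b\<in>B. h (c b) \<otimes>\<^bsub>S\<^esub> (x \<otimes>\<^bsub>S\<^esub> b))"
    using assms B_closed by (intro S.finsum_cong') (auto simp: S.m_lcomm Pi_def subset_iff)
  finally show ?thesis .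
qed

text \<open>For a generating family and an ideal Q this is the extended ideal QS; for Q the whole
  ring it is the R-span of B.\<close>

definition extension where "extension Q = comb ` (B \<rightarrow> Q)"

lemma extension_subgroup:
  assumes Q: "ideal Q R" shows "additive_subgroup (extension Q) S"
proof -
  interpret Q: ideal Q R by fact
  have QB: "c \<in> B \<rightarrow> carrier R" if "c \<in> B \<rightarrow> Q" for c
    using that Q.a_subset by (auto simp: Pi_def)
  show ?thesis
  proof (rule additive_subgroupI, rule group.subgroupI[OF S.a_group], simp_all)
    show "extension Q \<subseteq> carrier S" using QB by (auto simp: extension_def)
    have "(\<lambda>_. \<zero>) \<in> B \<rightarrow> Q" using Q.zero_closed by simp
    then show "extension Q \<noteq> {}" unfolding extension_def by blast
    fix x assume "x \<in> extension Q"
    then obtain c where c: "c \<in> B \<rightarrow> Q" and x: "x = comb c" by (auto simp: extension_def)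
    have "h (\<ominus> \<one>) \<otimes>\<^bsub>S\<^esub> comb c = comb (\<lambda>b. \<ominus> \<one> \<otimes> c b)" using QB[OF c] by (intro comb_smult) auto
    then have "\<ominus>\<^bsub>S\<^esub> x = comb (\<lambda>b. \<ominus> \<one> \<otimes> c b)" using QB[OF c] x by (simp add: S.l_minus)
    moreover have "(\<lambda>b. \<ominus> \<one> \<otimes> c b) \<in> B \<rightarrow> Q" using c by (auto intro!: Q.I_l_closed)
    ultimately show "inv\<^bsub>add_monoid S\<^esub> x \<in> extension Q" unfolding extension_def a_inv_def by blast
  next
    fix x y assume "x \<in> extension Q" "y \<in> extension Q"
    then obtain c d where c: "c \<in> B \<rightarrow> Q" "d \<in> B \<rightarrow> Q" and x: "x = comb c" "y = comb d"
      by (auto simp: extension_def)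
    then have "x \<oplus>\<^bsub>S\<^esub> y = comb (\<lambda>b. c b \<oplus> d b)" using comb_add QB by blast
    moreover have "(\<lambda>b. c b \<oplus> d b) \<in> B \<rightarrow> Q" using c by auto
    ultimately show "x \<oplus>\<^bsub>S\<^esub> y \<in> extension Q" unfolding extension_def by blast
  qed
qed

end

locale finite_ring_hom = finite_family +
  assumes generates: "x \<in> carrier S \<Longrightarrow> \<exists>c\<in>B \<rightarrow> carrier R. x = comb c"
begin

text \<open>A multiple of q b with q in Q is q times some element of S; expanding that element in
  the generators keeps all coefficients in Q.\<close>

lemma extension_ideal:
  assumes Q: "ideal Q R" shows "ideal (extension Q) S"
proof -
  interpret Q: ideal Q R by fact
  interpret E: additive_subgroup "extension Q" S by (rule extension_subgroup[OF Q])
  have QB: "c \<in> B \<rightarrow> carrier R" if "c \<in> B \<rightarrow> Q" for c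
    using that Q.a_subset by (auto simp: Pi_def)
  have smult: "h q \<otimes>\<^bsub>S\<^esub> x \<in> extension Q" if q: "q \<in> Q" and x: "x \<in> carrier S" for q x
  proof -
    obtain c where c: "c \<in> B \<rightarrow> carrier R" "x = comb c" using generates[OF x] by blast
    have "h q \<otimes>\<^bsub>S\<^esub> x = comb (\<lambda>b. q \<otimes> c b)" unfolding c(2) using q c by (intro comb_smult) auto
    moreover have "(\<lambda>b. q \<otimes> c b) \<in> B \<rightarrow> Q" using c q by (auto intro!: Q.I_r_closed)
    ultimately show ?thesis unfolding extension_def by blast
  qed
  have l: "x \<otimes>\<^bsub>S\<^esub> y \<in> extension Q" if y: "y \<in> extension Q" and x: "x \<in> carrier S" for x y
  proof -
    obtain c where c: "c \<in> B \<rightarrow> Q" "y = comb c" using y by (auto simp: extension_def)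
    show ?thesis unfolding c(2) comb_mult[OF x QB[OF c(1)]]
      using c x B_closed finite_B by (intro E.finsum_mem S.is_abelian_group smult) auto
  qed
  show ?thesis
  proof (rule idealI[OF S.ring_axioms E.a_subgroup l])
    fix x y assume "y \<in> extension Q" "x \<in> carrier S"
    then show "y \<otimes>\<^bsub>S\<^esub> x \<in> extension Q" using l[of y x] E.a_subset S.m_comm[of x y] by auto
  qed
qed

lemma image_subset_extension:
  assumes Q: "ideal Q R" and q: "q \<in> Q" shows "h q \<in> extension Q"
proof -
  interpret Q: ideal Q R by fact
  obtain c where c: "c \<in> B \<rightarrow> carrier R" "\<one>\<^bsub>S\<^esub> = comb c" using generates[of "\<one>\<^bsub>S\<^esub>"] by auto
  have "h q = comb (\<lambda>b. q \<otimes> c b)" using comb_smult[of q c] c q by (metis Q.Icarr S.r_one hom_closed)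
  moreover have "(\<lambda>b. q \<otimes> c b) \<in> B \<rightarrow> Q" using c q by (auto intro!: Q.I_r_closed)
  ultimately show ?thesis unfolding extension_def by blast
qed

text \<open>A prime above T + QS that avoids the image of R - Q lies over Q. With T = 0 and
  injective \<open>h\<close> this is lying over; with T a prime it is one step of lifting a
  chain.\<close>

lemma going_up:
  assumes T: "ideal T S" and Q: "primeideal Q R"
    and TQ: "\<And>r. \<lbrakk>r \<in> carrier R; h r \<in> T\<rbrakk> \<Longrightarrow> r \<in> Q"
  obtains T' where "primeideal T' S" "T \<subseteq> T'" "\<And>r. r \<in> carrier R \<Longrightarrow> h r \<in> T' \<longleftrightarrow> r \<in> Q"
proof -
  interpret Q: primeideal Q R by fact
  interpret T: ideal T S by fact
  note EI = extension_ideal[OF Q.is_ideal]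
  interpret E: ideal "extension Q" S by fact
  let ?J = "set_add S T (extension Q)"
  interpret J: ideal ?J S by (rule S.add_ideals[OF T EI])
  have TJ: "T \<subseteq> ?J"
  proof
    fix t assume "t \<in> T"
    moreover from this have "t = t \<oplus>\<^bsub>S\<^esub> \<zero>\<^bsub>S\<^esub>" by simp
    ultimately show "t \<in> ?J" using E.zero_closed unfolding set_add_def' by blast
  qed
  have QJ: "h q \<in> ?J" if "q \<in> Q" for q
  proof -
    have "h q = \<zero>\<^bsub>S\<^esub> \<oplus>\<^bsub>S\<^esub> h q" using that by simp
    then show ?thesis using T.zero_closed image_subset_extension[OF Q.is_ideal that]
      unfolding set_add_def' by blast
  qed
  have disj: "r \<in> Q" if r: "r \<in> carrier R" "h r \<in> ?J" for r
  proof (rule ccontr)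
    assume rQ: "r \<notin> Q"
    \<comment> \<open>If r outside Q had image in T + QS, then r S would lie in T + QS. Nakayama
      gives s outside Q with s S inside T; writing 1 in the generators puts h s in T, against the
      assumption on the contraction of T.\<close>
    have "\<exists>s\<in>carrier R - Q. \<forall>b\<in>B. h s \<otimes>\<^bsub>S\<^esub> b \<in> T"
    proof (rule nakayama[OF Q T.additive_subgroup_axioms _ finite_B B_closed])
      fix b assume "b \<in> B"
      then have "h r \<otimes>\<^bsub>S\<^esub> b \<in> ?J" using B_closed r by (intro J.I_r_closed) auto
      then show "\<exists>t\<in>T. \<exists>a\<in>B \<rightarrow> Q. h r \<otimes>\<^bsub>S\<^esub> b = t \<oplus>\<^bsub>S\<^esub> (\<Oplus>\<^bsub>S\<^esub>c\<in>B. h (a c) \<otimes>\<^bsub>S\<^esub> c)"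
        unfolding set_add_def' extension_def comb_def by blast
    qed (use r rQ T.I_l_closed in auto)
    then obtain s where s: "s \<in> carrier R" "s \<notin> Q" "\<And>b. b \<in> B \<Longrightarrow> h s \<otimes>\<^bsub>S\<^esub> b \<in> T" by blast
    obtain c where c: "c \<in> B \<rightarrow> carrier R" "\<one>\<^bsub>S\<^esub> = comb c" using generates[of "\<one>\<^bsub>S\<^esub>"] by auto
    have "h s = (\<Oplus>\<^bsub>S\<^esub>b\<in>B. h (c b) \<otimes>\<^bsub>S\<^esub> (h s \<otimes>\<^bsub>S\<^esub> b))"
      using comb_mult[of "h s" c] s(1) c by (metis S.r_one hom_closed)
    also have "\<dots> \<in> T" using c(1) finite_B
      by (intro T.finsum_mem S.is_abelian_group T.I_l_closed[OF s(3)] hom_closed) auto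
    finally show False using TQ s by blast
  qed
  obtain T' where T': "primeideal T' S" "?J \<subseteq> T'" "T' \<inter> h ` (carrier R - Q) = {}"
  proof (rule S.exists_prime_avoiding[OF J.is_ideal, of "h ` (carrier R - Q)"])
    have "\<one> \<in> carrier R - Q" using Q.one_imp_carrier Q.I_notcarr by blast
    then show "\<one>\<^bsub>S\<^esub> \<in> h ` (carrier R - Q)" by (metis hom_one imageI)
    show "?J \<inter> h ` (carrier R - Q) = {}" using disj by auto
    fix x y assume "x \<in> h ` (carrier R - Q)" "y \<in> h ` (carrier R - Q)"
    then obtain a b where ab: "a \<in> carrier R - Q" "b \<in> carrier R - Q" "x = h a" "y = h b" by auto
    then have "x \<otimes>\<^bsub>S\<^esub> y = h (a \<otimes> b)" "a \<otimes> b \<in> carrier R - Q" using Q.I_prime[of a b] by auto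
    then show "x \<otimes>\<^bsub>S\<^esub> y \<in> h ` (carrier R - Q)" by blast
  qed blast
  show thesis
  proof (rule that[OF T'(1)])
    show "T \<subseteq> T'" using TJ T'(2) by blast
    fix r assume "r \<in> carrier R"
    then show "h r \<in> T' \<longleftrightarrow> r \<in> Q" using T'(2,3) QJ by blast
  qed
qed

text \<open>Chains of primes are lifted from the bottom up by \<open>going_up\<close>; injectivity
  starts the process, as the zero ideal then contracts into the first prime.\<close>

lemma krull_dim_le:
  assumes inj: "\<And>r. \<lbrakk>r \<in> carrier R; h r = \<zero>\<^bsub>S\<^esub>\<rbrakk> \<Longrightarrow> r = \<zero>"
  shows "krull_dim R \<le> krull_dim S"
  unfolding krull_dim_def
proof (rule Sup_subset_mono, safe)
  fix n and Q :: "nat \<Rightarrow> _ set"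
  assume Q: "\<forall>i\<le>n. primeideal (Q i) R" and chain: "\<forall>i<n. Q i \<subset> Q (Suc i)"
  have "\<exists>T. (\<forall>i\<le>m. primeideal (T i) S \<and> (\<forall>r\<in>carrier R. h r \<in> T i \<longleftrightarrow> r \<in> Q i)) \<and>
      (\<forall>i<m. T i \<subseteq> T (Suc i))" if "m \<le> n" for m
    using that
  proof (induction m)
    case 0
    interpret Q0: primeideal "Q 0" R using Q by blast
    obtain T' where "primeideal T' S" "\<And>r. r \<in> carrier R \<Longrightarrow> h r \<in> T' \<longleftrightarrow> r \<in> Q 0"
      by (rule going_up[OF S.zeroideal Q0.primeideal]) (use inj Q0.zero_closed in auto)
    then show ?case by (intro exI[of _ "\<lambda>_. T'"]) auto
  next
    case (Suc m)
    then obtain T where T: "\<forall>i\<le>m. primeideal (T i) S \<and> (\<forall>r\<in>carrier R. h r \<in> T i \<longleftrightarrow> r \<in> Q i)"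
      "\<forall>i<m. T i \<subseteq> T (Suc i)" by auto
    have p: "primeideal (T m) S" "primeideal (Q (Suc m)) R" using T Q Suc.prems by auto
    obtain T' where T': "primeideal T' S" "T m \<subseteq> T'" "\<And>r. r \<in> carrier R \<Longrightarrow> h r \<in> T' \<longleftrightarrow> r \<in> Q (Suc m)"
    proof (rule going_up[OF primeideal.axioms(1)[OF p(1)] p(2)])
      fix r assume "r \<in> carrier R" "h r \<in> T m"
      then have "r \<in> Q m" using T(1) by blast
      moreover have "Q m \<subset> Q (Suc m)" using chain Suc.prems by simp
      ultimately show "r \<in> Q (Suc m)" by blast
    qed blast
    define T'' where "T'' i = (if i \<le> m then T i else T')" for i
    have "primeideal (T'' i) S \<and> (\<forall>r\<in>carrier R. h r \<in> T'' i \<longleftrightarrow> r \<in> Q i)" if "i \<le> Suc m" for i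
      using that T(1) T' by (cases "i = Suc m") (auto simp: T''_def)
    moreover have "T'' i \<subseteq> T'' (Suc i)" if "i < Suc m" for i
      using that T(2) T'(2) by (cases "i = m") (auto simp: T''_def)
    ultimately show ?case by (intro exI[of _ T'']) blast
  qed
  from this[of n] obtain T where T: "\<forall>i\<le>n. primeideal (T i) S"
      "\<forall>i\<le>n. \<forall>r\<in>carrier R. h r \<in> T i \<longleftrightarrow> r \<in> Q i" "\<forall>i<n. T i \<subseteq> T (Suc i)" by auto
  \<comment> \<open>The lift only gave inclusions; strictness comes back because consecutive terms
    have different contractions.\<close>
  have "T i \<subset> T (Suc i)" if i: "i < n" for i
  proof -
    have Qc: "Q (Suc i) \<subseteq> carrier R"
      using Q i by (meson Suc_leI additive_subgroup.a_subset ideal.axioms(1) primeideal.axioms(1))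
    obtain r where "r \<in> Q (Suc i)" "r \<notin> Q i" using chain i by blast
    with T i Qc have "h r \<in> T (Suc i)" "h r \<notin> T i" by auto
    with T(3) i show ?thesis by blast
  qed
  with T(1) show "\<exists>na. enat n = enat na \<and> (\<exists>Q. (\<forall>i\<le>na. primeideal (Q i) S) \<and> (\<forall>i<na. Q i \<subset> Q (Suc i)))"
    by blast
qed

end

section \<open>Radicals and finite local homomorphisms\<close>

lemma (in ideal) power_mem_mono:
  assumes "a [^] (n::nat) \<in> I" "n \<le> m" "a \<in> carrier R" shows "a [^] m \<in> I"
proof -
  have "a [^] m = a [^] n \<otimes> a [^] (m - n)" using assms by (simp add: nat_pow_mult)
  also have "\<dots> \<in> I" using assms by (intro I_r_closed) auto
  finally show ?thesis .
qed

text \<open>Since n is at most p^n, radical membership can be tested on p-power exponents, where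
  taking powers is additive.\<close>

lemma (in cring) radical_iff_frobenius_power:
  assumes p: "Factorial_Ring.prime (p::nat)" and I: "ideal I R" and a: "a \<in> carrier R"
  shows "a \<in> radical R I \<longleftrightarrow> (\<exists>e. a [^] (p ^ e) \<in> I)"
proof
  interpret I: ideal I R by fact
  assume "a \<in> radical R I"
  then obtain n :: nat where n: "a [^] n \<in> I" by (auto simp: radical_def)
  have "n \<le> p ^ n" using power_gt_expt[of p n] prime_gt_1_nat[OF p] by simp
  then have "a [^] (p ^ n) \<in> I" by (rule I.power_mem_mono[OF n _ a])
  then show "\<exists>e. a [^] (p ^ e) \<in> I" by blast
qed (use a in \<open>auto simp: radical_def\<close>)

lemma (in cring) frobenius_preimage_ideal:
  assumes p: "Factorial_Ring.prime (p::nat)" "[p] \<cdot> \<one> = \<zero>" and I: "ideal I R"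
  shows "ideal {a \<in> carrier R. a [^] (p ^ e) \<in> I} R"
proof -
  interpret I: ideal I R by fact
  interpret F: abelian_group_hom R R "\<lambda>a. a [^] (p ^ e)" by (rule frobenius_hom[OF p])
  show ?thesis
  proof (rule idealI[OF ring_axioms])
    show "subgroup {a \<in> carrier R. a [^] (p ^ e) \<in> I} (add_monoid R)"
    proof (rule group.subgroupI[OF a_group])
      show "{a \<in> carrier R. a [^] (p ^ e) \<in> I} \<subseteq> carrier (add_monoid R)" by auto
      have "\<zero> [^] (p ^ e) \<in> I" unfolding F.hom_zero by (rule I.zero_closed)
      then show "{a \<in> carrier R. a [^] (p ^ e) \<in> I} \<noteq> {}" by blast
    next
      fix a assume a: "a \<in> {a \<in> carrier R. a [^] (p ^ e) \<in> I}"
      then have "(\<ominus> a) [^] (p ^ e) \<in> I" using F.hom_a_inv[of a] by simp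
      then show "inv\<^bsub>add_monoid R\<^esub> a \<in> {a \<in> carrier R. a [^] (p ^ e) \<in> I}"
        unfolding a_inv_def[symmetric] using a by simp
    next
      fix a b assume "a \<in> {a \<in> carrier R. a [^] (p ^ e) \<in> I}" "b \<in> {a \<in> carrier R. a [^] (p ^ e) \<in> I}"
      then show "a \<otimes>\<^bsub>add_monoid R\<^esub> b \<in> {a \<in> carrier R. a [^] (p ^ e) \<in> I}"
        using F.hom_add[of a b] by simp
    qed
    fix a x assume "a \<in> {a \<in> carrier R. a [^] (p ^ e) \<in> I}" and x: "x \<in> carrier R"
    then have a: "a \<in> carrier R" "a [^] (p ^ e) \<in> I" by auto
    have "(x \<otimes> a) [^] (p ^ e) \<in> I" using a x by (simp add: nat_pow_distrib I.I_l_closed)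
    then show "x \<otimes> a \<in> {a \<in> carrier R. a [^] (p ^ e) \<in> I}" using a x by simp
    then show "a \<otimes> x \<in> {a \<in> carrier R. a [^] (p ^ e) \<in> I}" using a x by (simp add: m_comm)
  qed
qed

text \<open>The radical is the increasing union of the preimages of I under the iterates of
  Frobenius, each of which is an ideal.\<close>

lemma (in cring) radical_ideal:
  assumes p: "Factorial_Ring.prime (p::nat)" "[p] \<cdot> \<one> = \<zero>" and I: "ideal I R"
  shows "ideal (radical R I) R"
proof -
  interpret I: ideal I R by fact
  let ?V = "\<lambda>e. {a \<in> carrier R. a [^] (p ^ e) \<in> I}"
  have V: "ideal (?V e) R" for e by (rule frobenius_preimage_ideal[OF p I])
  have rad: "a \<in> radical R I \<longleftrightarrow> (\<exists>e. a \<in> ?V e)" for a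
  proof -
    have "radical R I \<subseteq> carrier R" by (auto simp: radical_def)
    then show ?thesis using radical_iff_frobenius_power[OF p(1) I, of a] by blast
  qed
  have mono: "?V e \<subseteq> ?V f" if "e \<le> f" for e f
    using that I.power_mem_mono power_increasing[OF that, of p] prime_ge_1_nat[OF p(1)] by blast
  show ?thesis
  proof (rule idealI[OF ring_axioms])
    show "subgroup (radical R I) (add_monoid R)"
    proof (rule group.subgroupI[OF a_group])
      show "radical R I \<subseteq> carrier (add_monoid R)" by (auto simp: radical_def)
      show "radical R I \<noteq> {}" using additive_subgroup.zero_closed[OF ideal.axioms(1)[OF V]] rad by blast
    next
      fix a assume "a \<in> radical R I"
      then obtain e where "a \<in> ?V e" using rad by blast
      then have "\<ominus> a \<in> ?V e" by (rule additive_subgroup.a_inv_closed[OF ideal.axioms(1)[OF V]])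
      then show "inv\<^bsub>add_monoid R\<^esub> a \<in> radical R I" unfolding a_inv_def rad by blast
    next
      fix a b assume "a \<in> radical R I" "b \<in> radical R I"
      then obtain e f where "a \<in> ?V e" "b \<in> ?V f" using rad by blast
      then have "a \<in> ?V (e + f)" "b \<in> ?V (e + f)" using mono[of e "e + f"] mono[of f "e + f"] by auto
      then have "a \<oplus> b \<in> ?V (e + f)" by (rule additive_subgroup.a_closed[OF ideal.axioms(1)[OF V]])
      then show "a \<otimes>\<^bsub>add_monoid R\<^esub> b \<in> radical R I" unfolding rad by auto
    qed
    fix a x assume "a \<in> radical R I" and x: "x \<in> carrier R"
    then obtain e where e: "a \<in> ?V e" using rad by blast
    show "x \<otimes> a \<in> radical R I" "a \<otimes> x \<in> radical R I"
      using ideal.I_l_closed[OF V e x] ideal.I_r_closed[OF V e x] unfolding rad by blast+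
  qed
qed

section \<open>Prime and maximal ideals in local rings\<close>

lemma (in primeideal) power_mem_imp_mem:
  "\<lbrakk>a \<in> carrier R; a [^] (n::nat) \<in> I\<rbrakk> \<Longrightarrow> a \<in> I"
proof (induction n)
  case 0
  then show ?case using one_imp_carrier I_notcarr by simp
next
  case (Suc n)
  then show ?case using I_prime[of "a [^] n" a] by auto
qed

lemma max_ideal_maximalideal: "local_ring R \<Longrightarrow> maximalideal (max_ideal R) R"
  unfolding local_ring_def max_ideal_def by (elim conjE) (rule theI')

text \<open>An ideal maximal among those over I that miss 1 is a maximal ideal, hence the unique
  one.\<close>

lemma local_ring_proper_ideal:
  assumes R: "local_ring R" and I: "ideal I R" "I \<noteq> carrier R"
  shows "I \<subseteq> max_ideal R"
proof -
  interpret cring R using R by (simp add: local_ring_def)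
  obtain M where M: "primeideal M R" "I \<subseteq> M" "M \<inter> {\<one>\<^bsub>R\<^esub>} = {}"
    and max: "\<And>J. \<lbrakk>ideal J R; M \<subseteq> J; J \<inter> {\<one>\<^bsub>R\<^esub>} = {}\<rbrakk> \<Longrightarrow> J = M"
    by (rule exists_prime_avoiding[OF I(1), of "{\<one>\<^bsub>R\<^esub>}"]) (use I ideal.one_imp_carrier in auto)
  have "maximalideal M R"
  proof (rule maximalidealI[OF primeideal.axioms(1)[OF M(1)]])
    show "carrier R \<noteq> M" using M(3) by auto
    fix J assume J: "ideal J R" "M \<subseteq> J"
    then show "J = M \<or> J = carrier R" using max[of J] ideal.one_imp_carrier[OF J(1)] by blast
  qed
  then have "M = max_ideal R" using R max_ideal_maximalideal[OF R] by (auto simp: local_ring_def)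
  with M(2) show ?thesis by simp
qed

lemma local_ring_unit:
  assumes R: "local_ring R" and x: "x \<in> carrier R" "x \<notin> max_ideal R"
  shows "\<exists>y\<in>carrier R. y \<otimes>\<^bsub>R\<^esub> x = \<one>\<^bsub>R\<^esub>"
proof -
  interpret cring R using R by (simp add: local_ring_def)
  have "PIdl\<^bsub>R\<^esub> x = carrier R"
    using local_ring_proper_ideal[OF R cgenideal_ideal[OF x(1)]] cgenideal_self[OF x(1)] x(2) by blast
  then have "\<one>\<^bsub>R\<^esub> \<in> PIdl\<^bsub>R\<^esub> x" by simp
  then show ?thesis by (auto simp: cgenideal_def)
qed

locale finite_local_hom = finite_ring_hom +
  assumes local_R: "local_ring R" and local_S: "local_ring S"
    and injective: "\<lbrakk>r \<in> carrier R; h r = \<zero>\<^bsub>S\<^esub>\<rbrakk> \<Longrightarrow> r = \<zero>"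
begin

sublocale m: primeideal "max_ideal R" R
  by (rule R.maximalideal_prime[OF max_ideal_maximalideal[OF local_R]])

sublocale n: primeideal "max_ideal S" S
  by (rule S.maximalideal_prime[OF max_ideal_maximalideal[OF local_S]])

lemma one_notin_n: "\<one>\<^bsub>S\<^esub> \<notin> max_ideal S"
  using n.one_imp_carrier n.I_notcarr by blast

lemma unit_notin_n: "\<lbrakk>x \<in> carrier S; y \<in> carrier S; y \<otimes>\<^bsub>S\<^esub> x = \<one>\<^bsub>S\<^esub>\<rbrakk> \<Longrightarrow> x \<notin> max_ideal S"
  using n.I_l_closed one_notin_n by metis

text \<open>Locality of \<open>h\<close> is derived here: units go to units, and conversely a prime
  over the maximal ideal of R, supplied by lying over, is contained in the maximal ideal of
  S.\<close>

lemma contraction: 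
  assumes r: "r \<in> carrier R" shows "h r \<in> max_ideal S \<longleftrightarrow> r \<in> max_ideal R"
proof
  assume n: "h r \<in> max_ideal S"
  show "r \<in> max_ideal R"
  proof (rule ccontr)
    assume "r \<notin> max_ideal R"
    then obtain y where "y \<in> carrier R" "y \<otimes> r = \<one>" using local_ring_unit[OF local_R r] by blast
    then have "h y \<otimes>\<^bsub>S\<^esub> h r = \<one>\<^bsub>S\<^esub>" using r by (metis hom_mult hom_one)
    with n show False using unit_notin_n[of "h r" "h y"] r \<open>y \<in> carrier R\<close> by simp
  qed
next
  assume m: "r \<in> max_ideal R"
  obtain T' where T': "primeideal T' S" "\<And>r. r \<in> carrier R \<Longrightarrow> h r \<in> T' \<longleftrightarrow> r \<in> max_ideal R"
    by (rule going_up[OF S.zeroideal m.primeideal]) (use injective m.zero_closed in auto)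
  have "T' \<subseteq> max_ideal S"
    using local_ring_proper_ideal[OF local_S primeideal.axioms(1)[OF T'(1)]] primeideal.I_notcarr[OF T'(1)] by blast
  with T'(2)[OF r] m show "h r \<in> max_ideal S" by blast
qed

text \<open>Values at s of polynomials over R with n coefficients, that is of degree below n, in
  Horner form.\<close>

primrec polys :: "'c \<Rightarrow> nat \<Rightarrow> 'c set" where
  "polys s 0 = {\<zero>\<^bsub>S\<^esub>}"
| "polys s (Suc n) = {h a \<oplus>\<^bsub>S\<^esub> s \<otimes>\<^bsub>S\<^esub> g | a g. a \<in> carrier R \<and> g \<in> polys s n}"

context
  fixes s assumes s: "s \<in> carrier S"
begin

lemma polys_closed: "g \<in> polys s n \<Longrightarrow> g \<in> carrier S"
  using s by (induction n arbitrary: g) auto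

lemma polys_zero: "\<zero>\<^bsub>S\<^esub> \<in> polys s n"
proof (induction n)
  case (Suc n)
  have "\<zero>\<^bsub>S\<^esub> = h \<zero> \<oplus>\<^bsub>S\<^esub> s \<otimes>\<^bsub>S\<^esub> \<zero>\<^bsub>S\<^esub>" using s by simp
  with Suc show ?case unfolding polys.simps by blast
qed simp

lemma polys_const: "a \<in> carrier R \<Longrightarrow> h a \<in> polys s (Suc n)"
proof -
  assume a: "a \<in> carrier R"
  then have "h a = h a \<oplus>\<^bsub>S\<^esub> s \<otimes>\<^bsub>S\<^esub> \<zero>\<^bsub>S\<^esub>" using s by simp
  with a polys_zero[of n] show ?thesis unfolding polys.simps by blast
qed

lemma polys_shift: "g \<in> polys s n \<Longrightarrow> s \<otimes>\<^bsub>S\<^esub> g \<in> polys s (Suc n)"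
proof -
  assume g: "g \<in> polys s n"
  then have "s \<otimes>\<^bsub>S\<^esub> g = h \<zero> \<oplus>\<^bsub>S\<^esub> s \<otimes>\<^bsub>S\<^esub> g" using s polys_closed by simp
  with g show ?thesis unfolding polys.simps by blast
qed

lemma polys_Suc: "g \<in> polys s n \<Longrightarrow> g \<in> polys s (Suc n)"
proof (induction n arbitrary: g)
  case 0
  then show ?case using polys_zero[of "Suc 0"] by simp
next
  case (Suc n)
  then show ?case unfolding polys.simps(2)[of _ "Suc n"] polys.simps(2)[of _ n] by blast
qed

lemma polys_mono: "\<lbrakk>n \<le> m; g \<in> polys s n\<rbrakk> \<Longrightarrow> g \<in> polys s m"
  by (induction m rule: dec_induct) (auto intro: polys_Suc simp del: polys.simps)

lemma polys_add: "\<lbrakk>g \<in> polys s n; g' \<in> polys s n\<rbrakk> \<Longrightarrow> g \<oplus>\<^bsub>S\<^esub> g' \<in> polys s n"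
proof (induction n arbitrary: g g')
  case (Suc n)
  then obtain a b u v where c: "a \<in> carrier R" "b \<in> carrier R" "u \<in> polys s n" "v \<in> polys s n"
    and g: "g = h a \<oplus>\<^bsub>S\<^esub> s \<otimes>\<^bsub>S\<^esub> u" "g' = h b \<oplus>\<^bsub>S\<^esub> s \<otimes>\<^bsub>S\<^esub> v" by auto
  have "g \<oplus>\<^bsub>S\<^esub> g' = h (a \<oplus> b) \<oplus>\<^bsub>S\<^esub> s \<otimes>\<^bsub>S\<^esub> (u \<oplus>\<^bsub>S\<^esub> v)"
    unfolding g using c polys_closed s by (simp add: S.r_distr S.a_ac)
  with Suc.IH[OF c(3,4)] c show ?case unfolding polys.simps by blast
qed simp

lemma polys_smult: "\<lbrakk>a \<in> carrier R; g \<in> polys s n\<rbrakk> \<Longrightarrow> h a \<otimes>\<^bsub>S\<^esub> g \<in> polys s n"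
proof (induction n arbitrary: g)
  case (Suc n)
  then obtain b u where c: "b \<in> carrier R" "u \<in> polys s n" and g: "g = h b \<oplus>\<^bsub>S\<^esub> s \<otimes>\<^bsub>S\<^esub> u" by auto
  have "h a \<otimes>\<^bsub>S\<^esub> g = h (a \<otimes> b) \<oplus>\<^bsub>S\<^esub> s \<otimes>\<^bsub>S\<^esub> (h a \<otimes>\<^bsub>S\<^esub> u)"
    unfolding g using c polys_closed s Suc.prems(1) by (simp add: S.r_distr S.m_ac)
  with Suc.IH[OF Suc.prems(1) c(2)] c Suc.prems(1) show ?case unfolding polys.simps by blast
qed simp

lemma polys_mult: "\<lbrakk>g \<in> polys s n; g' \<in> polys s m\<rbrakk> \<Longrightarrow> g \<otimes>\<^bsub>S\<^esub> g' \<in> polys s (n + m)"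
proof (induction n arbitrary: g)
  case 0
  then show ?case using polys_zero polys_closed[OF 0(2)] by simp
next
  case (Suc n)
  then obtain a u where c: "a \<in> carrier R" "u \<in> polys s n" and g: "g = h a \<oplus>\<^bsub>S\<^esub> s \<otimes>\<^bsub>S\<^esub> u" by auto
  have "g \<otimes>\<^bsub>S\<^esub> g' = h a \<otimes>\<^bsub>S\<^esub> g' \<oplus>\<^bsub>S\<^esub> s \<otimes>\<^bsub>S\<^esub> (u \<otimes>\<^bsub>S\<^esub> g')"
    unfolding g using c polys_closed s Suc.prems(2) by (simp add: S.l_distr S.m_assoc)
  moreover have "h a \<otimes>\<^bsub>S\<^esub> g' \<in> polys s (Suc n + m)"
    using polys_smult[OF c(1) Suc.prems(2)] by (rule polys_mono[rotated]) simp
  moreover have "s \<otimes>\<^bsub>S\<^esub> (u \<otimes>\<^bsub>S\<^esub> g') \<in> polys s (Suc n + m)"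
    using polys_shift[OF Suc.IH[OF c(2) Suc.prems(2)]] by (simp del: polys.simps)
  ultimately show ?case by (simp only: polys_add)
qed

lemma polys_power: "g \<in> polys s m \<Longrightarrow> s [^]\<^bsub>S\<^esub> n \<otimes>\<^bsub>S\<^esub> g \<in> polys s (n + m)"
proof (induction n)
  case 0
  then show ?case using polys_closed by simp
next
  case (Suc n)
  have "s [^]\<^bsub>S\<^esub> Suc n \<otimes>\<^bsub>S\<^esub> g = s \<otimes>\<^bsub>S\<^esub> (s [^]\<^bsub>S\<^esub> n \<otimes>\<^bsub>S\<^esub> g)"
    using s polys_closed[OF Suc.prems] by (simp add: S.m_ac)
  then show ?case using polys_shift[OF Suc.IH[OF Suc.prems]] by (simp del: polys.simps)
qed

definition monic where "monic n = {s [^]\<^bsub>S\<^esub> n \<oplus>\<^bsub>S\<^esub> g | g. g \<in> polys s n}"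

lemma monic_closed: "w \<in> monic n \<Longrightarrow> w \<in> carrier S"
  unfolding monic_def using s polys_closed by auto

text \<open>Elimination with T = 0 starts from s itself, monic of degree 1, since each s b is a
  combination of the generators with constant coefficients. The resulting monic value kills every
  generator, hence 1, hence is 0.\<close>

lemma integral: "\<exists>n. \<zero>\<^bsub>S\<^esub> \<in> monic n"
proof -
  have "\<exists>N. \<exists>w\<in>monic N. \<forall>b\<in>B. w \<otimes>\<^bsub>S\<^esub> b \<in> {\<zero>\<^bsub>S\<^esub>}"
  proof (rule S.elimination[where D = "polys s"])
    show "additive_subgroup {\<zero>\<^bsub>S\<^esub>} S" using S.zeroideal by (rule ideal.axioms(1))
  next
    fix n m w a assume "w \<in> monic n" and a: "a \<in> polys s m"
    then obtain g where g: "g \<in> polys s n" "w = s [^]\<^bsub>S\<^esub> n \<oplus>\<^bsub>S\<^esub> g" by (auto simp: monic_def)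
    then have "w \<otimes>\<^bsub>S\<^esub> a = s [^]\<^bsub>S\<^esub> n \<otimes>\<^bsub>S\<^esub> a \<oplus>\<^bsub>S\<^esub> g \<otimes>\<^bsub>S\<^esub> a"
      using s polys_closed a by (simp add: S.l_distr)
    then show "w \<otimes>\<^bsub>S\<^esub> a \<in> polys s (n + m)" using polys_add polys_power[OF a] polys_mult[OF g(1) a] by simp
  next
    fix n m w v assume "w \<in> monic n" "v \<in> monic m"
    then obtain g g' where g: "g \<in> polys s n" "w = s [^]\<^bsub>S\<^esub> n \<oplus>\<^bsub>S\<^esub> g"
      "g' \<in> polys s m" "v = s [^]\<^bsub>S\<^esub> m \<oplus>\<^bsub>S\<^esub> g'" by (auto simp: monic_def)
    have "w \<otimes>\<^bsub>S\<^esub> v = s [^]\<^bsub>S\<^esub> (n + m) \<oplus>\<^bsub>S\<^esub> (s [^]\<^bsub>S\<^esub> n \<otimes>\<^bsub>S\<^esub> g' \<oplus>\<^bsub>S\<^esub> (s [^]\<^bsub>S\<^esub> m \<otimes>\<^bsub>S\<^esub> g \<oplus>\<^bsub>S\<^esub> g \<otimes>\<^bsub>S\<^esub> g'))"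
      using s polys_closed g by (simp add: S.l_distr S.r_distr S.a_ac S.m_ac S.nat_pow_mult[symmetric])
    moreover have "s [^]\<^bsub>S\<^esub> n \<otimes>\<^bsub>S\<^esub> g' \<oplus>\<^bsub>S\<^esub> (s [^]\<^bsub>S\<^esub> m \<otimes>\<^bsub>S\<^esub> g \<oplus>\<^bsub>S\<^esub> g \<otimes>\<^bsub>S\<^esub> g') \<in> polys s (n + m)"
      using polys_power[OF g(3), of n] polys_power[OF g(1), of m] polys_mult[OF g(1,3)]
      by (intro polys_add) (simp_all add: add.commute)
    ultimately show "w \<otimes>\<^bsub>S\<^esub> v \<in> monic (n + m)" unfolding monic_def by blast
  next
    fix n w a assume "w \<in> monic n" and a: "a \<in> polys s n"
    then obtain g where g: "g \<in> polys s n" "w = s [^]\<^bsub>S\<^esub> n \<oplus>\<^bsub>S\<^esub> g" by (auto simp: monic_def)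
    have "w \<ominus>\<^bsub>S\<^esub> a = s [^]\<^bsub>S\<^esub> n \<oplus>\<^bsub>S\<^esub> (g \<oplus>\<^bsub>S\<^esub> h (\<ominus> \<one>) \<otimes>\<^bsub>S\<^esub> a)"
      using s polys_closed a g by (simp add: S.minus_eq S.a_assoc S.l_minus)
    moreover have "g \<oplus>\<^bsub>S\<^esub> h (\<ominus> \<one>) \<otimes>\<^bsub>S\<^esub> a \<in> polys s n" using g a by (intro polys_add polys_smult) auto
    ultimately show "w \<ominus>\<^bsub>S\<^esub> a \<in> monic n" unfolding monic_def by blast
  next
    have "s [^]\<^bsub>S\<^esub> (1::nat) \<oplus>\<^bsub>S\<^esub> \<zero>\<^bsub>S\<^esub> = s" using s by simp
    then show "s \<in> monic 1" using polys_zero[of 1] unfolding monic_def by (metis (mono_tags, lifting) mem_Collect_eq)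
  next
    fix b assume "b \<in> B"
    then have "s \<otimes>\<^bsub>S\<^esub> b \<in> carrier S" using s B_closed by auto
    then obtain c where c: "c \<in> B \<rightarrow> carrier R" "s \<otimes>\<^bsub>S\<^esub> b = comb c" using generates by blast
    then have "s \<otimes>\<^bsub>S\<^esub> b = \<zero>\<^bsub>S\<^esub> \<oplus>\<^bsub>S\<^esub> (\<Oplus>\<^bsub>S\<^esub>e\<in>B. h (c e) \<otimes>\<^bsub>S\<^esub> e)"
      using comb_closed[OF c(1)] by (simp add: comb_def)
    moreover have "(\<lambda>e. h (c e)) \<in> B \<rightarrow> polys s 1" using c(1) polys_const[of _ 0] by auto
    ultimately show "\<exists>t\<in>{\<zero>\<^bsub>S\<^esub>}. \<exists>a\<in>B \<rightarrow> polys s 1. s \<otimes>\<^bsub>S\<^esub> b = t \<oplus>\<^bsub>S\<^esub> (\<Oplus>\<^bsub>S\<^esub>e\<in>B. a e \<otimes>\<^bsub>S\<^esub> e)"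
      by (intro bexI[of _ "\<zero>\<^bsub>S\<^esub>"] bexI[of _ "\<lambda>e. h (c e)"]) auto
  qed (use finite_B B_closed polys_closed monic_closed polys_add polys_mult in auto)
  then obtain N w where w: "w \<in> monic N" "\<And>b. b \<in> B \<Longrightarrow> w \<otimes>\<^bsub>S\<^esub> b = \<zero>\<^bsub>S\<^esub>" by blast
  have wc: "w \<in> carrier S" using w monic_closed by blast
  obtain c where c: "c \<in> B \<rightarrow> carrier R" "\<one>\<^bsub>S\<^esub> = comb c" using generates[of "\<one>\<^bsub>S\<^esub>"] by auto
  have "w = w \<otimes>\<^bsub>S\<^esub> comb c" unfolding c(2)[symmetric] using wc by simp
  also have "\<dots> = (\<Oplus>\<^bsub>S\<^esub>b\<in>B. \<zero>\<^bsub>S\<^esub>)"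
    unfolding comb_mult[OF wc c(1)] using w(2) c(1) by (intro S.finsum_cong') (auto simp: Pi_def)
  finally show ?thesis using w(1) by auto
qed

text \<open>
  Modulo the extended ideal, the lowest unit coefficient of a monic polynomial in \<open>s\<close> can be
  pulled out together with a power of \<open>s\<close>, since \<open>s\<close> lies in the maximal ideal.
\<close>

lemma monic_mod_extension:
  assumes sn: "s \<in> max_ideal S" and w: "w \<in> monic n"
  shows "\<exists>i::nat. \<exists>u\<in>carrier S. u \<notin> max_ideal S \<and> w \<ominus>\<^bsub>S\<^esub> s [^]\<^bsub>S\<^esub> i \<otimes>\<^bsub>S\<^esub> u \<in> extension (max_ideal R)"
  using w
proof (induction n arbitrary: w)
  case 0
  interpret E: ideal "extension (max_ideal R)" S by (rule extension_ideal[OF m.is_ideal])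
  have "w = \<one>\<^bsub>S\<^esub>" using 0 by (auto simp: monic_def)
  then show ?case using one_notin_n E.zero_closed
    by (intro exI[of _ 0] bexI[of _ "\<one>\<^bsub>S\<^esub>"]) (auto simp: S.minus_eq S.r_neg)
next
  case (Suc n)
  interpret E: ideal "extension (max_ideal R)" S by (rule extension_ideal[OF m.is_ideal])
  obtain a g where a: "a \<in> carrier R" and g: "g \<in> polys s n" and w: "w = s [^]\<^bsub>S\<^esub> Suc n \<oplus>\<^bsub>S\<^esub> (h a \<oplus>\<^bsub>S\<^esub> s \<otimes>\<^bsub>S\<^esub> g)"
    using Suc.prems by (auto simp: monic_def)
  define v where "v = s [^]\<^bsub>S\<^esub> n \<oplus>\<^bsub>S\<^esub> g"
  have v: "v \<in> monic n" "v \<in> carrier S" using g s polys_closed[OF g] by (auto simp: v_def monic_def)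
  have w: "w = h a \<oplus>\<^bsub>S\<^esub> s \<otimes>\<^bsub>S\<^esub> v"
    unfolding w v_def using s a polys_closed[OF g] by (simp add: S.r_distr S.a_ac S.m_comm)
  show ?case
  proof (cases "a \<in> max_ideal R")
    case False
    \<comment> \<open>The constant coefficient is a unit and s v lies in the maximal ideal, so w
      itself is the unit and i = 0.\<close>
    have "w \<notin> max_ideal S"
    proof
      assume "w \<in> max_ideal S"
      moreover have "s \<otimes>\<^bsub>S\<^esub> v \<in> max_ideal S" using sn v by (intro n.I_r_closed)
      ultimately have "w \<ominus>\<^bsub>S\<^esub> s \<otimes>\<^bsub>S\<^esub> v \<in> max_ideal S" unfolding S.minus_eq by blast
      moreover have "w \<ominus>\<^bsub>S\<^esub> s \<otimes>\<^bsub>S\<^esub> v = h a"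
        unfolding w using a v s by (simp add: S.minus_eq S.a_assoc S.r_neg)
      ultimately show False using contraction[OF a] False by simp
    qed
    moreover have "w \<in> carrier S" unfolding w using a s v by simp
    ultimately show ?thesis using E.zero_closed
      by (intro exI[of _ 0] bexI[of _ w]) (auto simp: S.minus_eq S.r_neg)
  next
    case True
    obtain i u where u: "u \<in> carrier S" "u \<notin> max_ideal S"
      and e: "v \<ominus>\<^bsub>S\<^esub> s [^]\<^bsub>S\<^esub> (i::nat) \<otimes>\<^bsub>S\<^esub> u \<in> extension (max_ideal R)" using Suc.IH[OF v(1)] by blast
    \<comment> \<open>The constant coefficient dies modulo the extended ideal; what is left is s
      times a monic value of degree one less.\<close>
    have "w \<ominus>\<^bsub>S\<^esub> s [^]\<^bsub>S\<^esub> Suc i \<otimes>\<^bsub>S\<^esub> u = h a \<oplus>\<^bsub>S\<^esub> s \<otimes>\<^bsub>S\<^esub> (v \<ominus>\<^bsub>S\<^esub> s [^]\<^bsub>S\<^esub> i \<otimes>\<^bsub>S\<^esub> u)"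
      unfolding w using a s v u by (simp add: S.minus_eq S.r_distr S.a_assoc S.r_minus S.m_ac)
    also have "\<dots> \<in> extension (max_ideal R)"
      using image_subset_extension[OF m.is_ideal True] E.I_l_closed[OF e s] by blast
    finally show ?thesis using u by blast
  qed
qed

text \<open>Applied to the monic value 0, the preceding lemma puts s^i u into the extended ideal
  with u a unit. This is the statement that S/mS, m the maximal ideal of R, has a nilpotent maximal
  element set, proved elementwise.\<close>

lemma power_mem_extension:
  assumes sn: "s \<in> max_ideal S" shows "\<exists>k::nat. s [^]\<^bsub>S\<^esub> k \<in> extension (max_ideal R)"
proof -
  interpret E: ideal "extension (max_ideal R)" S by (rule extension_ideal[OF m.is_ideal])
  obtain n where "\<zero>\<^bsub>S\<^esub> \<in> monic n" using integral by blast
  then obtain i u where u: "u \<in> carrier S" "u \<notin> max_ideal S"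
      and e: "\<zero>\<^bsub>S\<^esub> \<ominus>\<^bsub>S\<^esub> s [^]\<^bsub>S\<^esub> (i::nat) \<otimes>\<^bsub>S\<^esub> u \<in> extension (max_ideal R)"
    using monic_mod_extension[OF sn] by blast
  obtain y where y: "y \<in> carrier S" "y \<otimes>\<^bsub>S\<^esub> u = \<one>\<^bsub>S\<^esub>" using local_ring_unit[OF local_S u] by blast
  have "(\<ominus>\<^bsub>S\<^esub> y) \<otimes>\<^bsub>S\<^esub> (\<zero>\<^bsub>S\<^esub> \<ominus>\<^bsub>S\<^esub> s [^]\<^bsub>S\<^esub> i \<otimes>\<^bsub>S\<^esub> u) = s [^]\<^bsub>S\<^esub> i \<otimes>\<^bsub>S\<^esub> (y \<otimes>\<^bsub>S\<^esub> u)"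
    using y(1) s u by (simp add: S.minus_eq S.l_minus S.r_minus S.m_ac)
  also have "\<dots> = s [^]\<^bsub>S\<^esub> i" using y s by simp
  finally show ?thesis using E.I_l_closed[OF e, of "\<ominus>\<^bsub>S\<^esub> y"] y by auto
qed

end

text \<open>Some power of each element of the maximal ideal of S lies in the extension of the
  maximal ideal of R, and some power of each element of the latter lies in the ideal generated by Y.
  Characteristic p enters through \<open>radical_ideal\<close>, which makes the radical closed under
  sums.\<close>

lemma radical_genideal_image:
  assumes p: "Factorial_Ring.prime (p::nat)" "[p] \<cdot>\<^bsub>S\<^esub> \<one>\<^bsub>S\<^esub> = \<zero>\<^bsub>S\<^esub>"
    and Y: "Y \<subseteq> carrier R" "radical R (genideal R Y) = max_ideal R"
  shows "radical S (genideal S (h ` Y)) = max_ideal S"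
proof
  have hY: "h ` Y \<subseteq> carrier S" using Y by auto
  let ?J = "genideal S (h ` Y)"
  interpret J: ideal ?J S by (rule S.genideal_ideal[OF hY])
  have I: "ideal (genideal R Y) R" by (rule R.genideal_ideal[OF Y(1)])
  have Xm: "x \<in> max_ideal R" if "x \<in> Y" for x
  proof -
    have "x \<in> carrier R" using that Y(1) by blast
    then have "x [^] (1::nat) \<in> genideal R Y" using R.genideal_self[OF Y(1)] that by auto
    then show ?thesis using that Y unfolding Y(2)[symmetric] radical_def by blast
  qed
  have Jn: "?J \<subseteq> max_ideal S"
    using Xm contraction Y(1) by (intro S.genideal_minimal n.is_ideal) auto
  show "radical S ?J \<subseteq> max_ideal S"
  proof
    fix x assume "x \<in> radical S ?J"
    then obtain k :: nat where x: "x \<in> carrier S" "x [^]\<^bsub>S\<^esub> k \<in> max_ideal S"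
      using Jn unfolding radical_def by blast
    then show "x \<in> max_ideal S" by (rule n.power_mem_imp_mem)
  qed
  interpret rJ: ideal "radical S ?J" S by (rule S.radical_ideal[OF p J.is_ideal])
  have JR: "ideal {r \<in> carrier R. h r \<in> ?J} R"
    using ring.ideal_vimage[OF J.is_ideal] by (simp add: vimage_def Int_def conj_commute)
  have sub: "genideal R Y \<subseteq> {r \<in> carrier R. h r \<in> ?J}"
    using Y(1) S.genideal_self[OF hY] by (intro R.genideal_minimal JR) auto
  have mJ: "h r \<in> radical S ?J" if "r \<in> max_ideal R" for r
  proof -
    from that Y(2) obtain k :: nat where "r \<in> carrier R" "r [^] k \<in> genideal R Y"
      unfolding radical_def by blast
    with sub have "h (r [^] k) \<in> ?J" "r \<in> carrier R" by blast+
    then have "h r [^]\<^bsub>S\<^esub> k \<in> ?J" "h r \<in> carrier S" using ring.hom_nat_pow[of r k] by simp_all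
    then show ?thesis unfolding radical_def by blast
  qed
  have EJ: "extension (max_ideal R) \<subseteq> radical S ?J"
  proof
    fix x assume "x \<in> extension (max_ideal R)"
    then obtain c where c: "c \<in> B \<rightarrow> max_ideal R" "x = comb c" by (auto simp: extension_def)
    have "h (c b) \<otimes>\<^bsub>S\<^esub> b \<in> radical S ?J" if "b \<in> B" for b
      using that c(1) B_closed by (intro rJ.I_r_closed mJ) auto
    then show "x \<in> radical S ?J" unfolding c(2) comb_def
      by (rule rJ.finsum_mem[OF S.is_abelian_group finite_B])
  qed
  show "max_ideal S \<subseteq> radical S ?J"
  proof
    fix s assume sn: "s \<in> max_ideal S"
    then have s: "s \<in> carrier S" by auto
    obtain k :: nat where "s [^]\<^bsub>S\<^esub> k \<in> radical S ?J" using power_mem_extension[OF s sn] EJ by blast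
    then obtain l :: nat where "(s [^]\<^bsub>S\<^esub> k) [^]\<^bsub>S\<^esub> l \<in> ?J" unfolding radical_def by blast
    then have "s [^]\<^bsub>S\<^esub> (k * l) \<in> ?J" using s by (simp add: S.nat_pow_pow)
    with s show "s \<in> radical S ?J" unfolding radical_def by blast
  qed
qed

end

section \<open>Flatness and bilinear maps\<close>

lemma carrier_free_Abelian_group: "carrier (free_Abelian_group S) = {c. Poly_Mapping.keys c \<subseteq> S}"
  by (simp add: free_Abelian_group_def)

lemma free_Abelian_group_diff_closed:
  "\<lbrakk>s \<in> carrier (free_Abelian_group S); t \<in> carrier (free_Abelian_group S)\<rbrakk> \<Longrightarrow> s - t \<in> carrier (free_Abelian_group S)"
  using keys_diff[of s t] unfolding carrier_free_Abelian_group by blast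

context
  fixes R :: "('a, 'm) ring_scheme" and M :: "('a, 'b, 'n) module_scheme" and N :: "('a, 'c, 'k) module_scheme"
  assumes M: "module R M" and N: "module R N"
begin

interpretation M: module R M by (rule M)
interpretation N: module R N by (rule N)

lemma tensor_relations_subgroup: "subgroup (tensor_relations R M N) (free_Abelian_group (carrier M \<times> carrier N))"
  unfolding tensor_relations_def
  by (rule group.generate_is_subgroup[OF group_free_Abelian_group])
    (auto intro!: free_Abelian_group_diff_closed simp del: carrier_free_Abelian_group_iff)

lemma tensor_relations_carrier: "t \<in> tensor_relations R M N \<Longrightarrow> Poly_Mapping.keys t \<subseteq> carrier M \<times> carrier N"
  using subgroup.subset[OF tensor_relations_subgroup] by (auto simp: carrier_free_Abelian_group)

lemma tensor_relations_zero: "0 \<in> tensor_relations R M N"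
  using subgroup.one_closed[OF tensor_relations_subgroup] by simp

lemma tensor_relations_add:
  "\<lbrakk>s \<in> tensor_relations R M N; t \<in> tensor_relations R M N\<rbrakk> \<Longrightarrow> s + t \<in> tensor_relations R M N"
  using subgroup.m_closed[OF tensor_relations_subgroup] by simp

lemma tensor_relations_minus: "t \<in> tensor_relations R M N \<Longrightarrow> - t \<in> tensor_relations R M N"
  using subgroup.m_inv_closed[OF tensor_relations_subgroup] tensor_relations_carrier by fastforce

lemma tensor_relations_intros:
  "\<lbrakk>x \<in> carrier M; x' \<in> carrier M; y \<in> carrier N\<rbrakk> \<Longrightarrow>
    frag_of (x \<oplus>\<^bsub>M\<^esub> x', y) - frag_of (x, y) - frag_of (x', y) \<in> tensor_relations R M N"
  "\<lbrakk>x \<in> carrier M; y \<in> carrier N; y' \<in> carrier N\<rbrakk> \<Longrightarrow>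
    frag_of (x, y \<oplus>\<^bsub>N\<^esub> y') - frag_of (x, y) - frag_of (x, y') \<in> tensor_relations R M N"
  "\<lbrakk>r \<in> carrier R; x \<in> carrier M; y \<in> carrier N\<rbrakk> \<Longrightarrow>
    frag_of (r \<odot>\<^bsub>M\<^esub> x, y) - frag_of (x, r \<odot>\<^bsub>N\<^esub> y) \<in> tensor_relations R M N"
  unfolding tensor_relations_def by (rule generate.incl, blast)+

text \<open>Recasts generation of a subgroup as closure of the three families of generators under 0,
  negation and sums, in the additive notation of formal sums.\<close>

lemma tensor_relations_induct [consumes 1, case_names left right scalar zero minus add]:
  assumes "t \<in> tensor_relations R M N"
    and "\<And>x x' y. \<lbrakk>x \<in> carrier M; x' \<in> carrier M; y \<in> carrier N\<rbrakk> \<Longrightarrow>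
      P (frag_of (x \<oplus>\<^bsub>M\<^esub> x', y) - frag_of (x, y) - frag_of (x', y))"
    and "\<And>x y y'. \<lbrakk>x \<in> carrier M; y \<in> carrier N; y' \<in> carrier N\<rbrakk> \<Longrightarrow>
      P (frag_of (x, y \<oplus>\<^bsub>N\<^esub> y') - frag_of (x, y) - frag_of (x, y'))"
    and "\<And>r x y. \<lbrakk>r \<in> carrier R; x \<in> carrier M; y \<in> carrier N\<rbrakk> \<Longrightarrow>
      P (frag_of (r \<odot>\<^bsub>M\<^esub> x, y) - frag_of (x, r \<odot>\<^bsub>N\<^esub> y))"
    and "P 0" and minus: "\<And>t. \<lbrakk>t \<in> tensor_relations R M N; P t\<rbrakk> \<Longrightarrow> P (- t)"
    and add: "\<And>s t. \<lbrakk>s \<in> tensor_relations R M N; t \<in> tensor_relations R M N; P s; P t\<rbrakk> \<Longrightarrow> P (s + t)"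
  shows "P t"
  using assms(1) unfolding tensor_relations_def
proof (induction rule: generate.induct)
  case one
  then show ?case using assms(5) by simp
next
  case (incl t)
  then show ?case by (elim UnE CollectE exE conjE) (simp_all only: assms(2-4))
next
  case (inv t)
  then have t: "t \<in> tensor_relations R M N" unfolding tensor_relations_def by (rule generate.incl)
  have "P t" using inv by (elim UnE CollectE exE conjE) (simp_all only: assms(2-4))
  then show ?case using minus[OF t] tensor_relations_carrier[OF t] by simp
next
  case (eng s t)
  then show ?case using add[of s t] unfolding tensor_relations_def by simp
qed

lemma tensor_relations_sum:
  assumes x: "x \<in> carrier M" and G: "finite G" and y: "\<And>g. g \<in> G \<Longrightarrow> y g \<in> carrier N"
  shows "(\<Sum>g\<in>G. frag_of (x, y g)) - frag_of (x, \<Oplus>\<^bsub>N\<^esub>g\<in>G. y g) \<in> tensor_relations R M N"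
  using G y
proof (induction G rule: finite_induct)
  case empty
  \<comment> \<open>This is the additivity relation at 0 + 0 = 0: one copy of (x, 0) minus
    two.\<close>
  have "- frag_of (x, \<zero>\<^bsub>N\<^esub>) \<in> tensor_relations R M N"
    using tensor_relations_intros(2)[OF x N.zero_closed N.zero_closed] by simp
  then show ?case by simp
next
  case (insert g G)
  have c: "y g \<in> carrier N" "(\<Oplus>\<^bsub>N\<^esub>g\<in>G. y g) \<in> carrier N"
    using insert.prems by (auto intro!: N.finsum_closed)
  have "((\<Sum>g\<in>G. frag_of (x, y g)) - frag_of (x, \<Oplus>\<^bsub>N\<^esub>g\<in>G. y g)) +
      - (frag_of (x, y g \<oplus>\<^bsub>N\<^esub> (\<Oplus>\<^bsub>N\<^esub>g\<in>G. y g)) - frag_of (x, y g) - frag_of (x, \<Oplus>\<^bsub>N\<^esub>g\<in>G. y g))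
      \<in> tensor_relations R M N"
    using insert c tensor_relations_intros(2)[OF x c] by (intro tensor_relations_add tensor_relations_minus) auto
  then show ?case using insert by (simp add: Pi_def algebra_simps)
qed

end

text \<open>Copies of ideals on the type over which \<^const>\<open>flat_module\<close> quantifies.\<close>

definition singleton_fun :: "'a \<Rightarrow> (nat \<Rightarrow> 'a) set" where
  "singleton_fun x = {\<lambda>_. x}"

definition the_value :: "(nat \<Rightarrow> 'a) set \<Rightarrow> 'a" where
  "the_value U = the_elem U 0"

lemma the_value_singleton_fun [simp]: "the_value (singleton_fun x) = x"
  by (simp add: the_value_def singleton_fun_def)

definition ideal_module :: "('a, 'm) ring_scheme \<Rightarrow> 'a set \<Rightarrow> ('a, (nat \<Rightarrow> 'a) set) module" where
  "ideal_module R I =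
     \<lparr>carrier = singleton_fun ` I, monoid.mult = (\<lambda>U V. U), one = singleton_fun \<zero>\<^bsub>R\<^esub>,
      ring.zero = singleton_fun \<zero>\<^bsub>R\<^esub>, add = (\<lambda>U V. singleton_fun (the_value U \<oplus>\<^bsub>R\<^esub> the_value V)),
      smult = (\<lambda>r U. singleton_fun (r \<otimes>\<^bsub>R\<^esub> the_value U))\<rparr>"

lemma ideal_module:
  fixes R (structure)
  assumes "cring R" "ideal I R" shows "module R (ideal_module R I)"
proof -
  interpret cring R by fact
  interpret I: ideal I R by fact
  show ?thesis
  proof (rule moduleI)
    show "abelian_group (ideal_module R I)"
    proof (rule abelian_groupI)
      fix x assume "x \<in> carrier (ideal_module R I)"
      then obtain a where a: "a \<in> I" "x = singleton_fun a" by (auto simp: ideal_module_def)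
      then have "singleton_fun (\<ominus> a) \<in> carrier (ideal_module R I)"
        "singleton_fun (\<ominus> a) \<oplus>\<^bsub>ideal_module R I\<^esub> x = \<zero>\<^bsub>ideal_module R I\<^esub>"
        by (auto simp: ideal_module_def l_neg)
      then show "\<exists>y\<in>carrier (ideal_module R I). y \<oplus>\<^bsub>ideal_module R I\<^esub> x = \<zero>\<^bsub>ideal_module R I\<^esub>" by blast
    qed (auto simp: ideal_module_def a_ac)
  qed (auto simp: ideal_module_def l_distr r_distr m_assoc I.I_l_closed is_cring)
qed

text \<open>The element u = sum of e(g) \<otimes> g of I \<otimes> N becomes 1 \<otimes> (sum of
  e(g) g) = 0 in R \<otimes> N. Flatness for the inclusion I \<subseteq> R makes u vanish already in
  I \<otimes> N. A map \<open>\<beta>\<close> that is bilinear modulo K induces a homomorphism from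
  I \<otimes> N to R/K, which must kill u. Stating the laws modulo K avoids forming the quotient
  R/K.\<close>

lemma flat_module_bilinear:
  fixes R :: "('a, 'm) ring_scheme" (structure) and N :: "('a, 'b, 'n) module_scheme"
  assumes R: "cring R" and flat: "flat_module R N" and I: "ideal I R"
    and G: "finite G" "G \<subseteq> carrier N" and e: "e \<in> G \<rightarrow> I"
    and eq: "(\<Oplus>\<^bsub>N\<^esub>g\<in>G. e g \<odot>\<^bsub>N\<^esub> g) = \<zero>\<^bsub>N\<^esub>"
    and K: "additive_subgroup K R"
    and beta: "\<And>x y. \<lbrakk>x \<in> I; y \<in> carrier N\<rbrakk> \<Longrightarrow> \<beta> x y \<in> carrier R"
    and left: "\<And>x x' y. \<lbrakk>x \<in> I; x' \<in> I; y \<in> carrier N\<rbrakk> \<Longrightarrow> \<beta> (x \<oplus>\<^bsub>R\<^esub> x') y \<ominus>\<^bsub>R\<^esub> \<beta> x y \<ominus>\<^bsub>R\<^esub> \<beta> x' y \<in> K"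
    and right: "\<And>x y y'. \<lbrakk>x \<in> I; y \<in> carrier N; y' \<in> carrier N\<rbrakk> \<Longrightarrow> \<beta> x (y \<oplus>\<^bsub>N\<^esub> y') \<ominus>\<^bsub>R\<^esub> \<beta> x y \<ominus>\<^bsub>R\<^esub> \<beta> x y' \<in> K"
    and scalar: "\<And>r x y. \<lbrakk>r \<in> carrier R; x \<in> I; y \<in> carrier N\<rbrakk> \<Longrightarrow> \<beta> (r \<otimes>\<^bsub>R\<^esub> x) y \<ominus>\<^bsub>R\<^esub> \<beta> x (r \<odot>\<^bsub>N\<^esub> y) \<in> K"
  shows "(\<Oplus>\<^bsub>R\<^esub>g\<in>G. \<beta> (e g) g) \<in> K"
proof -
  interpret cring R by fact
  interpret K: additive_subgroup K R by fact
  interpret I: ideal I R by fact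
  have N: "module R N" using flat by (simp add: flat_module_def)
  interpret N: module R N by (rule N)
  let ?M = "ideal_module R I" and ?L = "ideal_module R (carrier R)"
  have M: "module R ?M" and L: "module R ?L" by (rule ideal_module[OF R I], rule ideal_module[OF R oneideal])
  have carr: "carrier ?M = singleton_fun ` I" "carrier ?L = singleton_fun ` carrier R"
    by (simp_all add: ideal_module_def)
  let ?rM = "tensor_relations R ?M N" and ?rL = "tensor_relations R ?L N"
  let ?FM = "free_Abelian_group (carrier ?M \<times> carrier N)" and ?FL = "free_Abelian_group (carrier ?L \<times> carrier N)"
  \<comment> \<open>The module on I has the operations of the one on R, restricted, so each relation
    for I is literally a relation for R.\<close>
  have rel_sub: "?rM \<subseteq> ?rL"
  proof
    fix t assume "t \<in> ?rM"
    then show "t \<in> ?rL"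
    proof (induction rule: tensor_relations_induct[OF M N, consumes 1, case_names left right scalar zero minus add])
      case (left x x' y)
      then show ?case using tensor_relations_intros(1)[OF L N, of x x' y]
        by (auto simp: carr) (simp add: ideal_module_def)
    next
      case (right x y y')
      then show ?case using tensor_relations_intros(2)[OF L N, of x y y'] by (auto simp: carr)
    next
      case (scalar r x y)
      then show ?case using tensor_relations_intros(3)[OF L N, of r x y]
        by (auto simp: carr) (simp add: ideal_module_def)
    qed (auto intro: tensor_relations_zero[OF L N] tensor_relations_minus[OF L N] tensor_relations_add[OF L N])
  qed
  define u where "u = (\<Sum>g\<in>G. frag_of (singleton_fun (e g), g))"
  have u_carrier: "u \<in> carrier ?FM"
    unfolding u_def using G e by (intro sum_closed_free_Abelian_group) (auto simp: carr)
  have one: "singleton_fun \<one> \<in> carrier ?L" by (simp add: carr)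
  have eN: "e g \<odot>\<^bsub>N\<^esub> g \<in> carrier N" if "g \<in> G" for g
  proof -
    have "e g \<in> I" "g \<in> carrier N" using that e G by auto
    then show ?thesis by simp
  qed
  \<comment> \<open>In R \<otimes> N each e(g) can be moved across the tensor sign, because e(g) =
    e(g) 1; the tensors 1 \<otimes> e(g) g then add up to 1 \<otimes> 0.\<close>
  have u_rel: "u \<in> ?rL"
  proof -
    have "(\<Sum>g\<in>H. frag_of (singleton_fun (e g), g)) - (\<Sum>g\<in>H. frag_of (singleton_fun \<one>, e g \<odot>\<^bsub>N\<^esub> g)) \<in> ?rL"
      if "H \<subseteq> G" "finite H" for H using that(2,1)
    proof (induction H rule: finite_induct)
      case empty
      then show ?case by (simp add: tensor_relations_zero[OF L N])
    next
      case (insert g H)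
      have "e g \<in> I" and g: "g \<in> carrier N" using insert.prems e G by auto
      then have eg: "e g \<in> carrier R" "g \<in> carrier N" by simp_all
      have "e g \<odot>\<^bsub>?L\<^esub> singleton_fun \<one> = singleton_fun (e g)" using eg by (simp add: ideal_module_def)
      then have "frag_of (singleton_fun (e g), g) - frag_of (singleton_fun \<one>, e g \<odot>\<^bsub>N\<^esub> g) \<in> ?rL"
        using tensor_relations_intros(3)[OF L N eg(1) one eg(2)] by simp
      from tensor_relations_add[OF L N this insert.IH] show ?case
        using insert by (simp add: algebra_simps)
    qed
    from this[OF subset_refl G(1)] tensor_relations_sum[OF L N one G(1), of "\<lambda>g. e g \<odot>\<^bsub>N\<^esub> g"] eN
    have "(u - (\<Sum>g\<in>G. frag_of (singleton_fun \<one>, e g \<odot>\<^bsub>N\<^esub> g))) +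
      ((\<Sum>g\<in>G. frag_of (singleton_fun \<one>, e g \<odot>\<^bsub>N\<^esub> g)) - frag_of (singleton_fun \<one>, \<zero>\<^bsub>N\<^esub>)) \<in> ?rL"
      unfolding u_def eq by (intro tensor_relations_add[OF L N]) auto
    moreover have "frag_of (singleton_fun \<one>, \<zero>\<^bsub>N\<^esub>) \<in> ?rL"
      using tensor_relations_minus[OF L N tensor_relations_intros(2)[OF L N one N.zero_closed N.zero_closed]] by simp
    ultimately have "(u - frag_of (singleton_fun \<one>, \<zero>\<^bsub>N\<^esub>)) + frag_of (singleton_fun \<one>, \<zero>\<^bsub>N\<^esub>) \<in> ?rL"
      by (intro tensor_relations_add[OF L N]) simp_all
    then show ?thesis by simp
  qed
  have coset: "?rL #>\<^bsub>?FL\<^esub> t = ?rL" if "t \<in> ?rL" for t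
    using group.coset_join2[OF group_free_Abelian_group _ tensor_relations_subgroup[OF L N] that]
      subgroup.mem_carrier[OF tensor_relations_subgroup[OF L N] that] by blast
  have map: "tensor_map R ?M N (\<lambda>x. x) ?L (?rM #>\<^bsub>?FM\<^esub> v) = ?rL" if v: "v \<in> ?rL" for v
  proof -
    have "t \<in> ?rL" if "t \<in> ?rM #>\<^bsub>?FM\<^esub> v" for t
      using that rel_sub v tensor_relations_add[OF L N] by (auto simp: r_coset_def)
    moreover have "frag_extend (\<lambda>(x, y). frag_of (x, y)) t = t" for t :: "((nat \<Rightarrow> 'a) set \<times> 'b) \<Rightarrow>\<^sub>0 int"
    proof -
      have "(\<lambda>(x, y). frag_of (x, y)) = (frag_of :: (nat \<Rightarrow> 'a) set \<times> 'b \<Rightarrow> _)" by (auto simp: fun_eq_iff)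
      then show ?thesis by (simp only: frag_expansion[symmetric])
    qed
    moreover have "0 + v \<in> ?rM #>\<^bsub>?FM\<^esub> v"
      using tensor_relations_zero[OF M N] by (auto simp: r_coset_def)
    ultimately show ?thesis using coset unfolding tensor_map_def by auto
  qed
  have mem: "?rM #>\<^bsub>?FM\<^esub> v \<in> carrier (tensor_product R ?M N)" if "v \<in> carrier ?FM" for v
    unfolding tensor_product_def FactGroup_def
    using group.rcosetsI[OF group_free_Abelian_group subgroup.subset[OF tensor_relations_subgroup[OF M N]] that] by simp
  have "(\<lambda>x. x) \<in> module_hom R ?M ?L"
    by (auto simp: module_hom_def ideal_module_def)
  then have inj: "inj_on (tensor_map R ?M N (\<lambda>x. x) ?L) (carrier (tensor_product R ?M N))"
    using flat[unfolded flat_module_def, THEN conjunct2, rule_format, of ?M ?L "\<lambda>x. x"] M L by simp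
  have zero: "(0 :: ((nat \<Rightarrow> 'a) set \<times> 'b) \<Rightarrow>\<^sub>0 int) \<in> carrier ?FM" by simp
  \<comment> \<open>The only use of flatness: the classes of u and of 0 both map to the zero coset
    over R.\<close>
  have "?rM #>\<^bsub>?FM\<^esub> u = ?rM #>\<^bsub>?FM\<^esub> 0"
    by (rule inj_onD[OF inj _ mem[OF u_carrier] mem[OF zero]])
      (simp only: map[OF u_rel] map[OF tensor_relations_zero[OF L N]])
  moreover have "0 + u \<in> ?rM #>\<^bsub>?FM\<^esub> u"
    using tensor_relations_zero[OF M N] unfolding r_coset_def by (simp only: mult_free_Abelian_group) blast
  ultimately have u_rel: "u \<in> ?rM" by (auto simp: r_coset_def)
  have "(\<lambda>z. \<beta> (the_value (fst z)) (snd z)) ` (carrier ?M \<times> carrier N) \<subseteq> carrier (add_monoid R)"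
    using beta by (auto simp: carr)
  then obtain H where H: "H \<in> hom ?FM (add_monoid R)"
    and Hf: "\<And>z. z \<in> carrier ?M \<times> carrier N \<Longrightarrow> H (frag_of z) = \<beta> (the_value (fst z)) (snd z)"
    by (rule comm_group.free_Abelian_group_universal[OF a_comm_group]) blast
  interpret H: group_hom ?FM "add_monoid R" H
    by (intro group_hom.intro group_hom_axioms.intro H group_free_Abelian_group a_group)
  have Hadd: "H (s + t) = H s \<oplus> H t" if "s \<in> carrier ?FM" "t \<in> carrier ?FM" for s t
    using H.hom_mult[OF that] by simp
  have Hminus: "H (- t) = \<ominus> H t" if "t \<in> carrier ?FM" for t
    using H.hom_inv[OF that] that by (simp add: a_inv_def carrier_free_Abelian_group)
  have Hdiff: "H (s - t) = H s \<ominus> H t" if "s \<in> carrier ?FM" "t \<in> carrier ?FM" for s t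
    using Hadd[of s "- t"] Hminus[of t] that by (simp add: minus_eq carrier_free_Abelian_group)
  have H2: "H (frag_of z - frag_of z') = \<beta> (the_value (fst z)) (snd z) \<ominus> \<beta> (the_value (fst z')) (snd z')"
    if "z \<in> carrier ?M \<times> carrier N" "z' \<in> carrier ?M \<times> carrier N" for z z'
    using Hdiff[of "frag_of z" "frag_of z'"] Hf that by simp
  have H3: "H (frag_of z - frag_of z' - frag_of z'') = \<beta> (the_value (fst z)) (snd z)
      \<ominus> \<beta> (the_value (fst z')) (snd z') \<ominus> \<beta> (the_value (fst z'')) (snd z'')"
    if "z \<in> carrier ?M \<times> carrier N" "z' \<in> carrier ?M \<times> carrier N" "z'' \<in> carrier ?M \<times> carrier N" for z z' z''
    using Hdiff[OF free_Abelian_group_diff_closed, of "frag_of z" "frag_of z'" "frag_of z''"] H2[OF that(1,2)] Hf[OF that(3)] that by simp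
  \<comment> \<open>The extension \<open>H\<close> of \<open>\<beta>\<close> to formal sums carries
    the defining relations into K, by bilinearity modulo K.\<close>
  have HK: "H t \<in> K" if "t \<in> ?rM" for t
    using that
  proof (induction rule: tensor_relations_induct[OF M N, consumes 1, case_names left right scalar zero minus add])
    case (left x x' y)
    then obtain a a' where a: "a \<in> I" "a' \<in> I" "x = singleton_fun a" "x' = singleton_fun a'" by (auto simp: carr)
    have s: "x \<oplus>\<^bsub>?M\<^esub> x' = singleton_fun (a \<oplus> a')" using a by (simp add: ideal_module_def)
    have "H (frag_of (x \<oplus>\<^bsub>?M\<^esub> x', y) - frag_of (x, y) - frag_of (x', y)) = \<beta> (a \<oplus> a') y \<ominus> \<beta> a y \<ominus> \<beta> a' y"
      unfolding s using a left by (subst H3) (auto simp: carr)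
    then show ?case using assms(10)[OF a(1,2) left(3)] by simp
  next
    case (right x y y')
    then obtain a where a: "a \<in> I" "x = singleton_fun a" by (auto simp: carr)
    have "H (frag_of (x, y \<oplus>\<^bsub>N\<^esub> y') - frag_of (x, y) - frag_of (x, y')) = \<beta> a (y \<oplus>\<^bsub>N\<^esub> y') \<ominus> \<beta> a y \<ominus> \<beta> a y'"
      using a right by (subst H3) (auto simp: carr)
    then show ?case using assms(11)[OF a(1) right(2,3)] by simp
  next
    case (scalar r x y)
    then obtain a where a: "a \<in> I" "x = singleton_fun a" by (auto simp: carr)
    have s: "r \<odot>\<^bsub>?M\<^esub> x = singleton_fun (r \<otimes> a)" using a by (simp add: ideal_module_def)
    have "H (frag_of (r \<odot>\<^bsub>?M\<^esub> x, y) - frag_of (x, r \<odot>\<^bsub>N\<^esub> y)) = \<beta> (r \<otimes> a) y \<ominus> \<beta> a (r \<odot>\<^bsub>N\<^esub> y)"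
      unfolding s using a scalar I.I_l_closed by (subst H2) (auto simp: carr)
    then show ?case using assms(12)[OF scalar(1) a(1) scalar(3)] by simp
  next
    case zero
    then show ?case using H.hom_one K.zero_closed by simp
  next
    case (minus t)
    then show ?case using Hminus subgroup.mem_carrier[OF tensor_relations_subgroup[OF M N]] by simp
  next
    case (add s t)
    then show ?case using Hadd subgroup.mem_carrier[OF tensor_relations_subgroup[OF M N]] by simp
  qed
  have "H (\<Sum>g\<in>D. frag_of (singleton_fun (e g), g)) = (\<Oplus>g\<in>D. \<beta> (e g) g)" if "finite D" "D \<subseteq> G" for D
    using that
  proof (induction D rule: finite_induct)
    case empty
    then show ?case using H.hom_one by simp
  next
    case (insert g D)
    have "(\<Sum>g\<in>D. frag_of (singleton_fun (e g), g)) \<in> carrier ?FM"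
      using insert.prems G e by (intro sum_closed_free_Abelian_group) (auto simp: carr)
    then show ?case using insert G e
      by (subst finsum_insert) (auto simp: Hadd Hf carr beta Pi_def subset_iff)
  qed
  from this[OF G(1) subset_refl] HK[OF u_rel] show ?thesis by (simp add: u_def)
qed

section \<open>Splitting of finite flat local homomorphisms\<close>

lemma finsum_scalar_restriction: "finsum (scalar_restriction S \<phi>) f B = finsum S f B"
  unfolding finsum_def finprod_def by (simp add: scalar_restriction_def)

context finite_family
begin

lemma comb_minus:
  assumes "c \<in> B \<rightarrow> carrier R" "d \<in> B \<rightarrow> carrier R"
  shows "comb (\<lambda>b. c b \<ominus> d b) = comb c \<ominus>\<^bsub>S\<^esub> comb d"
proof -
  have "\<ominus>\<^bsub>S\<^esub> comb d = h (\<ominus> \<one>) \<otimes>\<^bsub>S\<^esub> comb d" using assms by (simp add: S.l_minus)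
  also have "\<dots> = comb (\<lambda>b. \<ominus> \<one> \<otimes> d b)" using assms by (intro comb_smult) auto
  finally have "comb c \<ominus>\<^bsub>S\<^esub> comb d = comb (\<lambda>b. c b \<oplus> \<ominus> \<one> \<otimes> d b)"
    unfolding S.minus_eq using assms by (simp add: comb_add Pi_def)
  also have "\<dots> = comb (\<lambda>b. c b \<ominus> d b)"
    using assms by (intro comb_cong) (auto simp: R.minus_eq R.l_minus Pi_def)
  finally show ?thesis by simp
qed

lemma comb_delta:
  assumes "g \<in> B" shows "comb (\<lambda>b. if b = g then \<one> else \<zero>) = g"
proof -
  have "comb (\<lambda>b. if b = g then \<one> else \<zero>) = (\<Oplus>\<^bsub>S\<^esub>b\<in>B. if g = b then b else \<zero>\<^bsub>S\<^esub>)"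
    unfolding comb_def using B_closed by (intro S.finsum_cong') auto
  also have "\<dots> = g" using assms finite_B B_closed by (intro S.finsum_singleton) auto
  finally show ?thesis .
qed

end

context finite_ring_hom
begin

lemma insert_generator:
  assumes "x \<in> carrier S" shows "finite_ring_hom R S h (insert x B)"
proof (cases "x \<in> B")
  case True
  then show ?thesis using finite_ring_hom_axioms by (simp add: insert_absorb)
next
  case False
  interpret I: finite_family R S h "insert x B"
    using assms finite_B B_closed by unfold_locales auto
  show ?thesis
  proof
    fix y assume "y \<in> carrier S"
    then obtain c where c: "c \<in> B \<rightarrow> carrier R" "y = comb c" using generates by blast
    let ?c = "\<lambda>b. if b = x then \<zero> else c b"
    have "I.comb ?c = h (?c x) \<otimes>\<^bsub>S\<^esub> x \<oplus>\<^bsub>S\<^esub> (\<Oplus>\<^bsub>S\<^esub>b\<in>B. h (?c b) \<otimes>\<^bsub>S\<^esub> b)"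
      unfolding I.comb_def using False finite_B B_closed assms c(1) by (intro S.finsum_insert) (auto simp: Pi_def subset_iff)
    also have "(\<Oplus>\<^bsub>S\<^esub>b\<in>B. h (?c b) \<otimes>\<^bsub>S\<^esub> b) = comb c"
      unfolding comb_def using False B_closed c(1) by (intro S.finsum_cong') (auto simp: Pi_def subset_iff)
    finally have "y = I.comb ?c" using c assms by simp
    moreover have "?c \<in> insert x B \<rightarrow> carrier R" using c(1) by auto
    ultimately show "\<exists>c\<in>insert x B \<rightarrow> carrier R. y = I.comb c" by blast
  qed
qed

text \<open>A relation in which g has a unit coefficient expresses g through the other
  generators.\<close>

lemma remove_generator:
  assumes g: "g \<in> B" and c: "c \<in> B \<rightarrow> carrier R" "comb c = \<zero>\<^bsub>S\<^esub>"
    and y: "y \<in> carrier R" "y \<otimes> c g = \<one>"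
  shows "finite_ring_hom R S h (B - {g})"
proof -
  interpret I: finite_family R S h "B - {g}"
    using finite_B B_closed by unfold_locales auto
  have cg: "c g \<in> carrier R" and gS: "g \<in> carrier S" using g c B_closed by auto
  show ?thesis
  proof
    fix x assume "x \<in> carrier S"
    then obtain d where d: "d \<in> B \<rightarrow> carrier R" "x = comb d" using generates by blast
    have dg: "d g \<in> carrier R" using d g by auto
    \<comment> \<open>Adding this multiple of the relation c leaves the value unchanged and cancels
      the coefficient of g, as y is inverse to \<open>c g\<close>.\<close>
    let ?r = "\<ominus> (d g \<otimes> y)" and ?d = "\<lambda>b. d b \<oplus> \<ominus> (d g \<otimes> y) \<otimes> c b"
    have r: "?r \<in> carrier R" using dg y by simp
    have "comb ?d = comb d \<oplus>\<^bsub>S\<^esub> comb (\<lambda>b. ?r \<otimes> c b)"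
      using d(1) c(1) r by (subst comb_add) (auto simp: Pi_def)
    also have "comb (\<lambda>b. ?r \<otimes> c b) = h ?r \<otimes>\<^bsub>S\<^esub> comb c" using comb_smult[OF r c(1)] by simp
    finally have x: "x = comb ?d" using d c(2) r by simp
    have "?d g = d g \<oplus> \<ominus> (d g \<otimes> (y \<otimes> c g))" using dg cg y(1) by (simp add: R.l_minus R.m_assoc)
    then have "?d g = \<zero>" using y(2) dg by (simp add: R.r_neg)
    moreover have "comb ?d = h (?d g) \<otimes>\<^bsub>S\<^esub> g \<oplus>\<^bsub>S\<^esub> I.comb ?d"
    proof -
      have "(\<Oplus>\<^bsub>S\<^esub>b\<in>insert g (B - {g}). h (?d b) \<otimes>\<^bsub>S\<^esub> b) =
          h (?d g) \<otimes>\<^bsub>S\<^esub> g \<oplus>\<^bsub>S\<^esub> (\<Oplus>\<^bsub>S\<^esub>b\<in>B - {g}. h (?d b) \<otimes>\<^bsub>S\<^esub> b)"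
      proof (rule S.finsum_insert)
        have "?d b \<in> carrier R \<and> b \<in> carrier S" if "b \<in> B" for b
          using that d(1) c(1) r B_closed by (auto simp: Pi_def)
        then show "(\<lambda>b. h (?d b) \<otimes>\<^bsub>S\<^esub> b) \<in> B - {g} \<rightarrow> carrier S" "h (?d g) \<otimes>\<^bsub>S\<^esub> g \<in> carrier S"
          using g by (blast intro: S.m_closed hom_closed)+
      qed (use finite_B in auto)
      moreover have "insert g (B - {g}) = B" using g by blast
      ultimately show ?thesis unfolding comb_def I.comb_def by simp
    qed
    moreover have dI: "?d \<in> B - {g} \<rightarrow> carrier R" using d(1) c(1) r by (auto simp: Pi_def)
    ultimately have "x = I.comb ?d" using x gS I.comb_closed[OF dI] by simp
    with dI show "\<exists>c\<in>B - {g} \<rightarrow> carrier R. x = I.comb c" by blast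
  qed
qed

text \<open>An r with h r = 0 is a nonunit when 1 \<noteq> 0 in S, so S has a prime over the maximal
  ideal of R; that prime contains the extended ideal.\<close>

lemma one_notin_extension:
  assumes R: "local_ring R" and ne: "\<one>\<^bsub>S\<^esub> \<noteq> \<zero>\<^bsub>S\<^esub>"
  shows "\<one>\<^bsub>S\<^esub> \<notin> extension (max_ideal R)"
proof -
  have m: "primeideal (max_ideal R) R" by (rule R.maximalideal_prime[OF max_ideal_maximalideal[OF R]])
  have "r \<in> max_ideal R" if r: "r \<in> carrier R" "h r \<in> {\<zero>\<^bsub>S\<^esub>}" for r
  proof (rule ccontr)
    assume "r \<notin> max_ideal R"
    then obtain y where y: "y \<in> carrier R" "y \<otimes> r = \<one>" using local_ring_unit[OF R r(1)] by blast
    then have "h y \<otimes>\<^bsub>S\<^esub> h r = \<one>\<^bsub>S\<^esub>" using r by (metis hom_mult hom_one)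
    with r y ne show False by simp
  qed
  then obtain T' where T': "primeideal T' S" "\<And>r. r \<in> carrier R \<Longrightarrow> h r \<in> T' \<longleftrightarrow> r \<in> max_ideal R"
    by (rule going_up[OF S.zeroideal m]) blast+
  interpret T': primeideal T' S by fact
  interpret m: primeideal "max_ideal R" R by fact
  have "extension (max_ideal R) \<subseteq> T'"
  proof
    fix x assume "x \<in> extension (max_ideal R)"
    then obtain c where c: "c \<in> B \<rightarrow> max_ideal R" "x = comb c" by (auto simp: extension_def)
    have "h (c b) \<otimes>\<^bsub>S\<^esub> b \<in> T'" if "b \<in> B" for b
    proof -
      have "c b \<in> max_ideal R" "b \<in> carrier S" using that c(1) B_closed by auto
      then show ?thesis using T'(2)[of "c b"] m.Icarr[of "c b"] by (intro T'.I_r_closed) simp_all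
    qed
    then show "x \<in> T'" unfolding c(2) comb_def by (rule T'.finsum_mem[OF S.is_abelian_group finite_B])
  qed
  then show ?thesis using T'.one_imp_carrier T'.I_notcarr by blast
qed

end

lemma finite_ring_hom_of_fin_gen:
  assumes R: "cring R" and S: "cring S" and phi: "\<phi> \<in> ring_hom R S"
    and fg: "fin_gen_module R (scalar_restriction S \<phi>)"
  obtains B where "finite_ring_hom R S \<phi> B"
proof -
  obtain B where B: "B \<subseteq> carrier S" "finite B"
    and gen: "\<forall>x\<in>carrier S. \<exists>c\<in>B \<rightarrow> carrier R. x = (\<Oplus>\<^bsub>S\<^esub>b\<in>B. \<phi> (c b) \<otimes>\<^bsub>S\<^esub> b)"
    using fg unfolding fin_gen_module_def finsum_scalar_restriction
    by (auto simp: scalar_restriction_def)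
  interpret finite_family R S \<phi> B
    by (intro finite_family.intro finite_family_axioms.intro ring_hom_cringI R S phi B)
  have "finite_ring_hom R S \<phi> B" by unfold_locales (use gen in \<open>auto simp: comb_def\<close>)
  then show thesis by (rule that)
qed

text \<open>
  A minimal generating family containing \<open>1\<close> is independent modulo the maximal ideal.  If
  \<open>e\<close> is a relation and \<open>I\<close> the ideal of its coefficients, the coordinates modulo the maximal
  ideal \<open>m\<close> give bilinear maps from \<open>I\<close> and \<open>S\<close> to \<open>I/mI\<close>, so flatness puts the coefficients in
  \<open>mI\<close>; hence \<open>I = mI\<close> and \<open>I = 0\<close>.
\<close>

lemma flat_local_splitting:
  fixes R (structure) and S :: "('b, 'n) ring_scheme"
  assumes R: "local_ring R" and S: "cring S" and ne: "\<one>\<^bsub>S\<^esub> \<noteq> \<zero>\<^bsub>S\<^esub>" and phi: "\<phi> \<in> ring_hom R S"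
    and fg: "fin_gen_module R (scalar_restriction S \<phi>)"
    and flat: "flat_module R (scalar_restriction S \<phi>)"
  obtains \<rho> where "abelian_group_hom S R \<rho>" "\<rho> \<one>\<^bsub>S\<^esub> = \<one>"
    "\<And>r s. \<lbrakk>r \<in> carrier R; s \<in> carrier S\<rbrakk> \<Longrightarrow> \<rho> (\<phi> r \<otimes>\<^bsub>S\<^esub> s) = r \<otimes> \<rho> s"
proof -
  let ?m = "max_ideal R"
  interpret R: cring R using R by (simp add: local_ring_def)
  interpret S: cring S by fact
  interpret m: primeideal ?m R by (rule R.maximalideal_prime[OF max_ideal_maximalideal[OF R]])
  \<comment> \<open>Only families containing 1 compete for minimality, so that 1 survives as a basis
    element.\<close>
  define P where "P n \<longleftrightarrow> (\<exists>G. finite_ring_hom R S \<phi> G \<and> \<one>\<^bsub>S\<^esub> \<in> G \<and> card G = n)" for n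
  obtain B where "finite_ring_hom R S \<phi> B"
    by (rule finite_ring_hom_of_fin_gen[OF R.is_cring S phi fg])
  from finite_ring_hom.insert_generator[OF this S.one_closed]
  have "P (card (insert \<one>\<^bsub>S\<^esub> B))" unfolding P_def by blast
  then have "P (LEAST n. P n)" by (rule LeastI)
  then obtain G where G: "finite_ring_hom R S \<phi> G" and one: "\<one>\<^bsub>S\<^esub> \<in> G" and card: "card G = (LEAST n. P n)"
    unfolding P_def by blast
  have minimal: "\<not> finite_ring_hom R S \<phi> (G - {g})" if "g \<in> G" "g \<noteq> \<one>\<^bsub>S\<^esub>" for g
  proof
    assume "finite_ring_hom R S \<phi> (G - {g})"
    then have "P (card (G - {g}))" unfolding P_def using one that by blast
    then have "card G \<le> card (G - {g})" unfolding card by (rule Least_le)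
    moreover have "finite G"
      using G by (simp add: finite_ring_hom_def finite_family_def finite_family_axioms_def)
    ultimately show False using card_Diff1_less[OF _ that(1)] by simp
  qed
  interpret G: finite_ring_hom R S \<phi> G by (rule G)
  have coeff: "e g \<in> ?m" if e: "e \<in> G \<rightarrow> carrier R" "G.comb e = \<zero>\<^bsub>S\<^esub>" and g: "g \<in> G" for e g
  proof -
    \<comment> \<open>A unit coefficient at g \<noteq> 1 would let g be dropped while 1 is kept,
      against minimality.\<close>
    have other: "e g \<in> ?m" if g: "g \<in> G" "g \<noteq> \<one>\<^bsub>S\<^esub>" for g
    proof (rule ccontr)
      assume "e g \<notin> ?m"
      moreover have "e g \<in> carrier R" using e g by auto
      ultimately obtain y where "y \<in> carrier R" "y \<otimes> e g = \<one>" using local_ring_unit[OF R] by blast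
      from G.remove_generator[OF g(1) e this] show False using minimal[OF g] by simp
    qed
    show ?thesis
    proof (cases "g = \<one>\<^bsub>S\<^esub>")
      case True
      show ?thesis
      proof (rule ccontr)
        assume "e g \<notin> ?m"
        moreover have e1: "e \<one>\<^bsub>S\<^esub> \<in> carrier R" using e one by auto
        ultimately obtain y where y: "y \<in> carrier R" "y \<otimes> e \<one>\<^bsub>S\<^esub> = \<one>"
          using local_ring_unit[OF R] True by blast
        interpret E: ideal "G.extension ?m" S by (rule G.extension_ideal[OF m.is_ideal])
        let ?d = "\<lambda>b. if b = \<one>\<^bsub>S\<^esub> then e \<one>\<^bsub>S\<^esub> \<otimes> \<one> else \<zero>" and ?f = "\<lambda>b. if b = \<one>\<^bsub>S\<^esub> then \<zero> else e b"
        let ?\<delta> = "\<lambda>b. if b = \<one>\<^bsub>S\<^esub> then \<one> else \<zero>"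
        \<comment> \<open>Minimality does not cover the generator 1, which may not be dropped.
          Instead, the other coefficients being in the maximal ideal, the relation would put a unit
          multiple of 1 into the extended ideal.\<close>
        have "G.comb ?f \<in> G.extension ?m" unfolding G.extension_def
          using other m.zero_closed by (intro imageI) auto
        moreover have "G.comb ?f = G.comb (\<lambda>b. e b \<ominus> e \<one>\<^bsub>S\<^esub> \<otimes> ?\<delta> b)"
          using e e1 by (intro G.comb_cong) (auto simp: R.minus_eq R.r_neg Pi_def)
        moreover have "G.comb (\<lambda>b. e b \<ominus> e \<one>\<^bsub>S\<^esub> \<otimes> ?\<delta> b) = G.comb e \<ominus>\<^bsub>S\<^esub> G.comb (\<lambda>b. e \<one>\<^bsub>S\<^esub> \<otimes> ?\<delta> b)"
          using e e1 by (intro G.comb_minus) auto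
        moreover have "G.comb (\<lambda>b. e \<one>\<^bsub>S\<^esub> \<otimes> ?\<delta> b) = \<phi> (e \<one>\<^bsub>S\<^esub>) \<otimes>\<^bsub>S\<^esub> G.comb ?\<delta>"
          using e1 by (intro G.comb_smult[symmetric]) auto
        ultimately have "\<ominus>\<^bsub>S\<^esub> \<phi> (e \<one>\<^bsub>S\<^esub>) \<in> G.extension ?m"
          using G.comb_delta[OF one] e e1 by (simp add: S.minus_eq)
        then have "\<phi> (e \<one>\<^bsub>S\<^esub>) \<in> G.extension ?m" using E.a_inv_closed e1 by fastforce
        then have "\<phi> y \<otimes>\<^bsub>S\<^esub> \<phi> (e \<one>\<^bsub>S\<^esub>) \<in> G.extension ?m" using y by (intro E.I_l_closed) auto
        moreover have "\<phi> y \<otimes>\<^bsub>S\<^esub> \<phi> (e \<one>\<^bsub>S\<^esub>) = \<one>\<^bsub>S\<^esub>" using y e1 by (metis G.hom_mult G.hom_one)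
        ultimately show False using G.one_notin_extension[OF R ne] by simp
      qed
    qed (use other g in auto)
  qed
  have coeff_diff: "d g \<ominus> d' g \<in> ?m"
    if "d \<in> G \<rightarrow> carrier R" "d' \<in> G \<rightarrow> carrier R" "G.comb d = G.comb d'" "g \<in> G" for d d' g
    using coeff[of "\<lambda>b. d b \<ominus> d' b" g] G.comb_minus[OF that(1,2)] that
    by (simp add: S.minus_eq S.r_neg Pi_def)
  \<comment> \<open>An arbitrary choice of coordinates. At this stage they are additive, linear and
    dual to G only modulo the maximal ideal, which is all the bilinear argument asks for.\<close>
  obtain cf where cf: "\<And>s. s \<in> carrier S \<Longrightarrow> cf s \<in> G \<rightarrow> carrier R" "\<And>s. s \<in> carrier S \<Longrightarrow> s = G.comb (cf s)"
    using G.generates by metis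
  have cfc [simp]: "cf s g \<in> carrier R" if "s \<in> carrier S" "g \<in> G" for s g using cf(1)[OF that(1)] that(2) by auto
  have cf_add: "cf (s \<oplus>\<^bsub>S\<^esub> t) g \<ominus> (cf s g \<oplus> cf t g) \<in> ?m" if "s \<in> carrier S" "t \<in> carrier S" "g \<in> G" for s t g
  proof (rule coeff_diff[of "cf (s \<oplus>\<^bsub>S\<^esub> t)" "\<lambda>g. cf s g \<oplus> cf t g"])
    show "G.comb (cf (s \<oplus>\<^bsub>S\<^esub> t)) = G.comb (\<lambda>g. cf s g \<oplus> cf t g)"
      using that cf(2)[of "s \<oplus>\<^bsub>S\<^esub> t"] cf(2)[of s] cf(2)[of t] G.comb_add[OF cf(1) cf(1), of s t] by simp
  qed (use that in auto)
  have cf_smult: "cf (\<phi> r \<otimes>\<^bsub>S\<^esub> s) g \<ominus> r \<otimes> cf s g \<in> ?m" if "r \<in> carrier R" "s \<in> carrier S" "g \<in> G" for r s g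
  proof (rule coeff_diff[of "cf (\<phi> r \<otimes>\<^bsub>S\<^esub> s)" "\<lambda>g. r \<otimes> cf s g"])
    show "G.comb (cf (\<phi> r \<otimes>\<^bsub>S\<^esub> s)) = G.comb (\<lambda>g. r \<otimes> cf s g)"
      using that cf(2)[of "\<phi> r \<otimes>\<^bsub>S\<^esub> s"] cf(2)[of s] G.comb_smult[OF that(1) cf(1), of s] by simp
  qed (use that in auto)
  have cf_delta: "cf g g' \<ominus> (if g' = g then \<one> else \<zero>) \<in> ?m" if "g \<in> G" "g' \<in> G" for g g'
  proof (rule coeff_diff[of "cf g" "\<lambda>g'. if g' = g then \<one> else \<zero>"])
    have "g \<in> carrier S" using that G.B_closed by auto
    then show "cf g \<in> G \<rightarrow> carrier R" "G.comb (cf g) = G.comb (\<lambda>g'. if g' = g then \<one> else \<zero>)"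
      using cf(1)[of g] cf(2)[of g] G.comb_delta[OF that(1)] by simp_all
  qed (use that in auto)
  have free: "e g = \<zero>" if e: "e \<in> G \<rightarrow> carrier R" "G.comb e = \<zero>\<^bsub>S\<^esub>" and g: "g \<in> G" for e g
  proof -
    have ec: "e g \<in> carrier R" if "g \<in> G" for g using e that by auto
    interpret J: finite_family R R id "e ` G"
      using ec G.finite_B by unfold_locales (auto simp: ring_hom_def)
    define I where "I = J.extension (carrier R)"
    \<comment> \<open>This is mI, with m the maximal ideal and I the ideal spanned by the
      coefficients of the relation.\<close>
    define K where "K = J.extension ?m"
    have Ism: "r \<otimes> x \<in> I" if "r \<in> carrier R" "x \<in> I" for r x
    proof -
      obtain a where a: "a \<in> e ` G \<rightarrow> carrier R" "x = J.comb a"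
        using \<open>x \<in> I\<close> unfolding I_def J.extension_def by blast
      have "r \<otimes> x = J.comb (\<lambda>b. r \<otimes> a b)" using J.comb_smult[OF that(1) a(1)] a(2) by simp
      moreover have "(\<lambda>b. r \<otimes> a b) \<in> e ` G \<rightarrow> carrier R" using a that by auto
      ultimately show ?thesis unfolding I_def J.extension_def by blast
    qed
    interpret IS: additive_subgroup I R unfolding I_def by (rule J.extension_subgroup[OF R.oneideal])
    have I: "ideal I R"
    proof (rule idealI[OF R.ring_axioms IS.a_subgroup])
      fix a x assume ax: "a \<in> I" "x \<in> carrier R"
      show "x \<otimes> a \<in> I" using ax by (intro Ism)
      then show "a \<otimes> x \<in> I" using R.m_comm[of a x] ax by simp
    qed
    interpret K: additive_subgroup K R unfolding K_def by (rule J.extension_subgroup[OF m.is_ideal])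
    have IK: "x \<otimes> q \<in> K" if "q \<in> ?m" "x \<in> I" for q x
    proof -
      obtain a where a: "a \<in> e ` G \<rightarrow> carrier R" "x = J.comb a"
        using \<open>x \<in> I\<close> unfolding I_def J.extension_def by blast
      have q: "q \<in> carrier R" using that(1) by auto
      have "q \<otimes> x = J.comb (\<lambda>b. q \<otimes> a b)" using J.comb_smult[OF q a(1)] a(2) by simp
      moreover have "(\<lambda>b. q \<otimes> a b) \<in> e ` G \<rightarrow> ?m" using a that by (auto intro!: m.I_r_closed)
      ultimately have "q \<otimes> x \<in> K" unfolding K_def J.extension_def by blast
      then show ?thesis using q that(2) by (simp add: R.m_comm)
    qed
    have eI: "e g \<in> I" if "g \<in> G" for g
    proof -
      have "e g = J.comb (\<lambda>b. if b = e g then \<one> else \<zero>)" using that by (intro J.comb_delta[symmetric]) auto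
      then show ?thesis unfolding I_def J.extension_def by (rule ssubst) (intro imageI, auto)
    qed
    have eK: "e g0 \<in> K" if g0: "g0 \<in> G" for g0
    proof -
      have Ic: "x \<in> carrier R" if "x \<in> I" for x using that by simp
      \<comment> \<open>The pairing of x with s is x times the g0-coordinate of s. Its failure to be
        bilinear is an element of I times an element of the maximal ideal, hence lies in K.\<close>
      have "(\<Oplus>g\<in>G. e g \<otimes> cf g g0) \<in> K"
      proof (rule flat_module_bilinear[OF R.is_cring flat I G.finite_B _ _ _ K.additive_subgroup_axioms, of e "\<lambda>x s. x \<otimes> cf s g0"])
        show "G \<subseteq> carrier (scalar_restriction S \<phi>)" using G.B_closed by (simp add: scalar_restriction_def)
        show "e \<in> G \<rightarrow> I" using eI by blast
        show "(\<Oplus>\<^bsub>scalar_restriction S \<phi>\<^esub>g\<in>G. e g \<odot>\<^bsub>scalar_restriction S \<phi>\<^esub> g) = \<zero>\<^bsub>scalar_restriction S \<phi>\<^esub>"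
          using e(2) unfolding finsum_scalar_restriction G.comb_def by (simp add: scalar_restriction_def)
      next
        fix x y assume "x \<in> I" "y \<in> carrier (scalar_restriction S \<phi>)"
        then show "x \<otimes> cf y g0 \<in> carrier R" using g0 by (simp add: scalar_restriction_def)
      next
        fix x x' y assume xy: "x \<in> I" "x' \<in> I" "y \<in> carrier (scalar_restriction S \<phi>)"
        then have "(x \<oplus> x') \<otimes> cf y g0 \<ominus> x \<otimes> cf y g0 \<ominus> x' \<otimes> cf y g0 = \<zero>"
          using g0 by (simp add: scalar_restriction_def R.l_distr R.minus_eq R.a_ac R.r_neg R.r_neg1 R.r_neg2)
        then show "(x \<oplus> x') \<otimes> cf y g0 \<ominus> x \<otimes> cf y g0 \<ominus> x' \<otimes> cf y g0 \<in> K" by simp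
      next
        fix x y y' assume "x \<in> I" "y \<in> carrier (scalar_restriction S \<phi>)" "y' \<in> carrier (scalar_restriction S \<phi>)"
        then have xy: "x \<in> I" "y \<in> carrier S" "y' \<in> carrier S" by (simp_all add: scalar_restriction_def)
        have "x \<otimes> cf (y \<oplus>\<^bsub>S\<^esub> y') g0 \<ominus> x \<otimes> cf y g0 \<ominus> x \<otimes> cf y' g0
            = x \<otimes> (cf (y \<oplus>\<^bsub>S\<^esub> y') g0 \<ominus> (cf y g0 \<oplus> cf y' g0))"
          using xy g0 by (simp add: R.r_distr R.r_minus R.minus_eq R.minus_add R.a_assoc)
        then show "x \<otimes> cf (y \<oplus>\<^bsub>scalar_restriction S \<phi>\<^esub> y') g0 \<ominus> x \<otimes> cf y g0 \<ominus> x \<otimes> cf y' g0 \<in> K"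
          using IK[OF cf_add[OF xy(2,3) g0] xy(1)] by (simp add: scalar_restriction_def)
      next
        fix r x y assume "r \<in> carrier R" "x \<in> I" "y \<in> carrier (scalar_restriction S \<phi>)"
        then have rxy: "r \<in> carrier R" "x \<in> I" "y \<in> carrier S" by (simp_all add: scalar_restriction_def)
        have "(r \<otimes> x) \<otimes> cf y g0 \<ominus> x \<otimes> cf (\<phi> r \<otimes>\<^bsub>S\<^esub> y) g0
            = \<ominus> (x \<otimes> (cf (\<phi> r \<otimes>\<^bsub>S\<^esub> y) g0 \<ominus> r \<otimes> cf y g0))"
          using rxy g0 by (simp add: R.r_distr R.r_minus R.minus_eq R.minus_add R.a_ac R.m_ac)
        then show "(r \<otimes> x) \<otimes> cf y g0 \<ominus> x \<otimes> cf (r \<odot>\<^bsub>scalar_restriction S \<phi>\<^esub> y) g0 \<in> K"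
          using IK[OF cf_smult[OF rxy(1,3) g0] rxy(2)] by (simp add: scalar_restriction_def)
      qed
      \<comment> \<open>Coordinates of generators are Kronecker deltas modulo the maximal ideal, so
        modulo K the previous sum is \<open>e g0\<close>.\<close>
      moreover have "(\<Oplus>g\<in>G. e g \<otimes> (cf g g0 \<ominus> (if g0 = g then \<one> else \<zero>))) \<in> K"
        using IK[OF cf_delta[OF _ g0] eI] G.finite_B by (intro K.finsum_mem R.is_abelian_group) auto
      ultimately have "(\<Oplus>g\<in>G. e g \<otimes> cf g g0) \<ominus> (\<Oplus>g\<in>G. e g \<otimes> (cf g g0 \<ominus> (if g0 = g then \<one> else \<zero>))) \<in> K"
        unfolding R.minus_eq by blast
      moreover have "(\<Oplus>g\<in>G. e g \<otimes> cf g g0) = e g0 \<oplus> (\<Oplus>g\<in>G. e g \<otimes> (cf g g0 \<ominus> (if g0 = g then \<one> else \<zero>)))"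
      proof -
        have cg: "cf g g0 \<in> carrier R" if "g \<in> G" for g using that g0 G.B_closed by auto
        have "(\<Oplus>g\<in>G. e g \<otimes> cf g g0) =
          (\<Oplus>g\<in>G. (if g0 = g then e g else \<zero>) \<oplus> e g \<otimes> (cf g g0 \<ominus> (if g0 = g then \<one> else \<zero>)))"
          using ec cg by (intro R.finsum_cong') (auto simp: R.r_distr R.minus_eq R.r_minus R.a_ac R.r_neg R.r_neg1 R.r_neg2)
        also have "\<dots> = (\<Oplus>g\<in>G. (if g0 = g then e g else \<zero>)) \<oplus> (\<Oplus>g\<in>G. e g \<otimes> (cf g g0 \<ominus> (if g0 = g then \<one> else \<zero>)))"
          using ec cg by (intro R.finsum_addf) auto
        also have "(\<Oplus>g\<in>G. (if g0 = g then e g else \<zero>)) = e g0"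
          using ec g0 G.finite_B by (intro R.finsum_singleton) auto
        finally show ?thesis .
      qed
      moreover have "(\<Oplus>g\<in>G. e g \<otimes> (cf g g0 \<ominus> (if g0 = g then \<one> else \<zero>))) \<in> carrier R"
        using ec g0 G.B_closed by (intro R.finsum_closed) auto
      ultimately show ?thesis using ec[OF g0] by (simp add: R.minus_eq R.a_assoc R.r_neg)
    qed
    \<comment> \<open>All generators of I lie in mI, so Nakayama applies with r = 1 and T = 0; the
      resulting s is a unit and I vanishes.\<close>
    have "\<exists>s\<in>carrier R - ?m. \<forall>b\<in>e ` G. s \<otimes> b \<in> {\<zero>}"
    proof (rule J.nakayama[unfolded id_apply, OF m.primeideal ideal.axioms(1)[OF R.zeroideal] _ J.finite_B J.B_closed])
      show "\<one> \<in> carrier R - ?m" using m.one_imp_carrier m.I_notcarr by blast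
      fix b assume b: "b \<in> e ` G"
      then have "b \<in> K" using eK by auto
      then obtain a where a: "a \<in> e ` G \<rightarrow> ?m" "b = J.comb a" unfolding K_def J.extension_def by blast
      have "b \<in> carrier R" using b ec by auto
      then have "\<one> \<otimes> b = \<zero> \<oplus> (\<Oplus>c\<in>e ` G. a c \<otimes> c)" using a(2) unfolding J.comb_def id_apply by simp
      with a(1) show "\<exists>t\<in>{\<zero>}. \<exists>a\<in>e ` G \<rightarrow> ?m. \<one> \<otimes> b = t \<oplus> (\<Oplus>c\<in>e ` G. a c \<otimes> c)" by blast
    qed auto
    then obtain s where s: "s \<in> carrier R" "s \<notin> ?m" "s \<otimes> e g = \<zero>" using g by auto
    obtain y where y: "y \<in> carrier R" "y \<otimes> s = \<one>" using local_ring_unit[OF R s(1,2)] by blast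
    have "e g = (y \<otimes> s) \<otimes> e g" using y ec[OF g] by simp
    also have "\<dots> = y \<otimes> (s \<otimes> e g)" by (rule R.m_assoc[OF y(1) s(1) ec[OF g]])
    also have "\<dots> = \<zero>" unfolding s(3) using y(1) by simp
    finally show ?thesis .
  qed
  have unique: "d g = d' g"
    if "d \<in> G \<rightarrow> carrier R" "d' \<in> G \<rightarrow> carrier R" "G.comb d = G.comb d'" "g \<in> G" for d d' g
  proof -
    have "d g \<ominus> d' g = \<zero>"
      using free[of "\<lambda>b. d b \<ominus> d' b" g] G.comb_minus[OF that(1,2)] that by (simp add: S.minus_eq S.r_neg Pi_def)
    then show ?thesis using that by (auto simp: Pi_def)
  qed
  show thesis
  \<comment> \<open>G is now a basis, so coordinates are unique and the coordinate at the basis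
    element 1 is linear with value 1 at 1.\<close>
  proof (rule that[of "\<lambda>s. cf s \<one>\<^bsub>S\<^esub>"])
    have "cf (s \<oplus>\<^bsub>S\<^esub> t) \<one>\<^bsub>S\<^esub> = cf s \<one>\<^bsub>S\<^esub> \<oplus> cf t \<one>\<^bsub>S\<^esub>" if "s \<in> carrier S" "t \<in> carrier S" for s t
    proof (rule unique[of "cf (s \<oplus>\<^bsub>S\<^esub> t)" "\<lambda>g. cf s g \<oplus> cf t g"])
      show "G.comb (cf (s \<oplus>\<^bsub>S\<^esub> t)) = G.comb (\<lambda>g. cf s g \<oplus> cf t g)"
        using that cf(2)[of "s \<oplus>\<^bsub>S\<^esub> t"] cf(2)[of s] cf(2)[of t] G.comb_add[OF cf(1) cf(1), of s t] by simp
    qed (use that one in auto)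
    then show "abelian_group_hom S R (\<lambda>s. cf s \<one>\<^bsub>S\<^esub>)"
      using one by (intro abelian_group_homI S.is_abelian_group R.is_abelian_group group_hom.intro
          group_hom_axioms.intro S.a_group R.a_group homI) simp_all
    show "cf \<one>\<^bsub>S\<^esub> \<one>\<^bsub>S\<^esub> = \<one>"
      using unique[of "cf \<one>\<^bsub>S\<^esub>" "\<lambda>g. if g = \<one>\<^bsub>S\<^esub> then \<one> else \<zero>" "\<one>\<^bsub>S\<^esub>"]
        cf(1)[of "\<one>\<^bsub>S\<^esub>"] cf(2)[of "\<one>\<^bsub>S\<^esub>"] G.comb_delta[OF one] one by simp
    fix r s assume rs: "r \<in> carrier R" "s \<in> carrier S"
    show "cf (\<phi> r \<otimes>\<^bsub>S\<^esub> s) \<one>\<^bsub>S\<^esub> = r \<otimes> cf s \<one>\<^bsub>S\<^esub>"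
    proof (rule unique[of "cf (\<phi> r \<otimes>\<^bsub>S\<^esub> s)" "\<lambda>g. r \<otimes> cf s g"])
      show "G.comb (cf (\<phi> r \<otimes>\<^bsub>S\<^esub> s)) = G.comb (\<lambda>g. r \<otimes> cf s g)"
        using rs cf(2)[of "\<phi> r \<otimes>\<^bsub>S\<^esub> s"] cf(2)[of s] G.comb_smult[OF rs(1) cf(1), of s] by simp
    qed (use rs one in auto)
  qed
qed

section \<open>Quotients and the main theorem\<close>

lemma (in ideal) coset_eq_iff:
  assumes "x \<in> carrier R" "y \<in> carrier R" shows "I +> x = I +> y \<longleftrightarrow> x \<ominus> y \<in> I"
  using quotient_eq_iff_same_a_r_cos[OF is_ideal assms] by blast

text \<open>Maps out of a quotient are written below as unions over cosets; this evaluates them once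
  independence of the representative is known.\<close>

lemma (in ideal) UN_coset:
  assumes x: "x \<in> carrier R" and f: "\<And>y. \<lbrakk>y \<in> carrier R; y \<ominus> x \<in> I\<rbrakk> \<Longrightarrow> f y = f x"
  shows "(\<Union>y\<in>I +> x. f y) = f x"
proof -
  have "f y = f x" if "y \<in> I +> x" for y
  proof -
    have y: "y \<in> carrier R" using that x by (meson a_elemrcos_carrier)
    then show ?thesis using f a_repr_independence'[OF that x] coset_eq_iff[OF y x] by simp
  qed
  moreover have "x \<in> I +> x" by (rule a_rcos_self[OF x])
  ultimately show ?thesis by blast
qed

lemma Quot_cases:
  assumes "U \<in> carrier (R Quot I)" obtains r where "r \<in> carrier R" "U = I +>\<^bsub>R\<^esub> r"
  using assms by (auto simp: FactRing_def A_RCOSETS_def RCOSETS_def a_r_coset_def)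

text \<open>Generators of the preimage of an ideal map to generators of that ideal.\<close>

lemma (in noetherian_ring) noetherian_quotient:
  assumes R: "cring R" and I: "ideal I R" shows "noetherian_ring (R Quot I)"
proof -
  interpret I: ideal I R by fact
  interpret pi: ring_hom_ring R "R Quot I" "(+>) I" by (rule I.rcos_ring_hom_ring)
  show ?thesis
  proof (rule ring.noetherian_ringI[OF I.quotient_is_ring])
    fix K assume K: "ideal K (R Quot I)"
    interpret K: ideal K "R Quot I" by fact
    have "ideal {r \<in> carrier R. I +> r \<in> K} R" using pi.ideal_vimage[OF K] .
    from finetely_gen[OF this] obtain F where F: "F \<subseteq> carrier R" "finite F"
      and KF: "{r \<in> carrier R. I +> r \<in> K} = Idl F" by auto
    let ?F = "(\<lambda>r. I +> r) ` F"
    have Fc: "?F \<subseteq> carrier (R Quot I)" using F by auto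
    interpret G: ideal "genideal (R Quot I) ?F" "R Quot I" by (rule pi.S.genideal_ideal[OF Fc])
    have "K = genideal (R Quot I) ?F"
    proof
      show "genideal (R Quot I) ?F \<subseteq> K"
        using genideal_self[OF F(1)] KF by (intro pi.S.genideal_minimal K) auto
      have "ideal {r \<in> carrier R. I +> r \<in> genideal (R Quot I) ?F} R"
        by (rule pi.ideal_vimage[OF G.is_ideal])
      then have IF: "Idl F \<subseteq> {r \<in> carrier R. I +> r \<in> genideal (R Quot I) ?F}"
        using F(1) pi.S.genideal_self[OF Fc] by (intro genideal_minimal) auto
      show "K \<subseteq> genideal (R Quot I) ?F"
      proof
        fix x assume x: "x \<in> K"
        then have "x \<in> carrier (R Quot I)" using K.a_subset by blast
        then obtain r where "r \<in> carrier R" "x = I +> r" by (rule Quot_cases)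
        with x KF IF show "x \<in> genideal (R Quot I) ?F" by blast
      qed
    qed
    then show "\<exists>F\<subseteq>carrier (R Quot I). finite F \<and> K = genideal (R Quot I) F" using F(2) Fc by blast
  qed
qed

lemma local_ringI:
  assumes A: "cring A" and N: "ideal N A" "N \<noteq> carrier A"
    and max: "\<And>M. \<lbrakk>ideal M A; M \<noteq> carrier A\<rbrakk> \<Longrightarrow> M \<subseteq> N"
  shows "local_ring A"
  unfolding local_ring_def
proof (intro conjI ex1I[of _ N])
  show "maximalideal N A"
  proof (rule maximalidealI[OF N(1)])
    show "carrier A \<noteq> N" using N(2) by simp
    fix J assume "ideal J A" "N \<subseteq> J"
    then show "J = N \<or> J = carrier A" using max[of J] by blast
  qed
  fix M assume M: "maximalideal M A"
  interpret M: maximalideal M A by fact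
  have "M \<subseteq> N" using max[OF M.is_ideal] M.I_notcarr by simp
  moreover have "N \<subseteq> carrier A" by (rule additive_subgroup.a_subset[OF ideal.axioms(1)[OF N(1)]])
  ultimately show "M = N" using M.I_maximal[OF N(1)] N(2) by blast
qed (rule A)

lemma local_ring_quotient:
  assumes R: "local_ring R" and I: "ideal I R" "I \<noteq> carrier R"
  shows "local_ring (R Quot I)"
proof -
  interpret R: cring R using R by (simp add: local_ring_def)
  interpret I: ideal I R by fact
  interpret pi: ring_hom_ring R "R Quot I" "(+>\<^bsub>R\<^esub>) I" by (rule I.rcos_ring_hom_ring)
  interpret m: maximalideal "max_ideal R" R by (rule max_ideal_maximalideal[OF R])
  have Im: "I \<subseteq> max_ideal R" by (rule local_ring_proper_ideal[OF R I])
  let ?N = "(+>\<^bsub>R\<^esub>) I ` max_ideal R"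
  have N: "ideal ?N (R Quot I)" by (rule R.ring_ideal_imp_quot_ideal[OF I(1) m.is_ideal])
  show ?thesis
  proof (rule local_ringI[OF I.quotient_is_cring[OF R.is_cring] N])
    show "?N \<noteq> carrier (R Quot I)"
    proof
      assume "?N = carrier (R Quot I)"
      then have "I +>\<^bsub>R\<^esub> \<one>\<^bsub>R\<^esub> \<in> ?N" by simp
      then obtain r where r: "r \<in> max_ideal R" "I +>\<^bsub>R\<^esub> \<one>\<^bsub>R\<^esub> = I +>\<^bsub>R\<^esub> r" by blast
      \<comment> \<open>The difference lies in I, which is contained in the maximal ideal; with r
        there too, 1 would follow.\<close>
      then have "\<one>\<^bsub>R\<^esub> \<ominus>\<^bsub>R\<^esub> r \<in> max_ideal R" using I.coset_eq_iff[of "\<one>\<^bsub>R\<^esub>" r] Im by auto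
      then have "\<one>\<^bsub>R\<^esub> \<ominus>\<^bsub>R\<^esub> r \<oplus>\<^bsub>R\<^esub> r \<in> max_ideal R" using r(1) by (rule m.a_closed)
      then have "\<one>\<^bsub>R\<^esub> \<in> max_ideal R" using r(1) by (simp add: R.minus_eq R.a_assoc R.l_neg)
      then show False using m.one_imp_carrier m.I_notcarr by blast
    qed
    fix M assume M: "ideal M (R Quot I)" "M \<noteq> carrier (R Quot I)"
    interpret M: ideal M "R Quot I" by fact
    have V: "ideal {r \<in> carrier R. I +>\<^bsub>R\<^esub> r \<in> M} R" by (rule pi.ideal_vimage[OF M(1)])
    have "{r \<in> carrier R. I +>\<^bsub>R\<^esub> r \<in> M} \<noteq> carrier R"
    proof
      assume "{r \<in> carrier R. I +>\<^bsub>R\<^esub> r \<in> M} = carrier R"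
      then have "\<one>\<^bsub>R Quot I\<^esub> \<in> M" using pi.hom_one R.one_closed by (metis (mono_tags, lifting) mem_Collect_eq)
      then show False using M.one_imp_carrier M(2) by simp
    qed
    from local_ring_proper_ideal[OF R V this]
    have VN: "{r \<in> carrier R. I +>\<^bsub>R\<^esub> r \<in> M} \<subseteq> max_ideal R" .
    show "M \<subseteq> ?N"
    proof
      fix x assume x: "x \<in> M"
      then have "x \<in> carrier (R Quot I)" using M.a_subset by blast
      then obtain r where "r \<in> carrier R" "x = I +>\<^bsub>R\<^esub> r" by (rule Quot_cases)
      with x VN show "x \<in> ?N" by blast
    qed
  qed
qed

lemma has_char_quotient:
  assumes p: "Factorial_Ring.prime p" and R: "cring R" and char: "has_char R p"
    and I: "ideal I R" "I \<noteq> carrier R"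
  shows "has_char (R Quot I) p"
  unfolding has_char_def
proof (intro allI iffI)
  interpret R: cring R by fact
  interpret I: ideal I R by fact
  interpret pi: ring_hom_ring R "R Quot I" "(+>\<^bsub>R\<^esub>) I" by (rule I.rcos_ring_hom_ring)
  have p0: "[p] \<cdot>\<^bsub>R\<^esub> \<one>\<^bsub>R\<^esub> = \<zero>\<^bsub>R\<^esub>" using char by (simp add: has_char_def)
  have mult: "[n] \<cdot>\<^bsub>R Quot I\<^esub> \<one>\<^bsub>R Quot I\<^esub> = I +>\<^bsub>R\<^esub> ([n] \<cdot>\<^bsub>R\<^esub> \<one>\<^bsub>R\<^esub>)" for n :: nat
    by (induction n) simp_all
  fix n :: nat
  { assume "p dvd n"
    then have "[n] \<cdot>\<^bsub>R\<^esub> \<one>\<^bsub>R\<^esub> = \<zero>\<^bsub>R\<^esub>" by (intro R.nat_multiple_eq_zero[OF p0]) auto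
    then show "[n] \<cdot>\<^bsub>R Quot I\<^esub> \<one>\<^bsub>R Quot I\<^esub> = \<zero>\<^bsub>R Quot I\<^esub>" unfolding mult by simp }
  assume "[n] \<cdot>\<^bsub>R Quot I\<^esub> \<one>\<^bsub>R Quot I\<^esub> = \<zero>\<^bsub>R Quot I\<^esub>"
  then have nI: "I +>\<^bsub>R\<^esub> ([n] \<cdot>\<^bsub>R\<^esub> \<one>\<^bsub>R\<^esub>) = I" unfolding mult unfolding FactRing_def ring.simps .
  have "[n] \<cdot>\<^bsub>R\<^esub> \<one>\<^bsub>R\<^esub> \<in> carrier R" by simp
  then have nI: "[n] \<cdot>\<^bsub>R\<^esub> \<one>\<^bsub>R\<^esub> \<in> I" using nI by (rule I.rcos_const_imp_mem)
  show "p dvd n"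
  proof (rule ccontr)
    assume "\<not> p dvd n"
    then have "coprime p n" by (rule prime_imp_coprime[OF p])
    then have "gcd n p = 1" unfolding coprime_iff_gcd_eq_1 gcd.commute[of n p] .
    moreover have "n \<noteq> 0" using \<open>\<not> p dvd n\<close> by (metis dvd_0_right)
    \<comment> \<open>Bezout: n 1 lies in I and p 1 = 0, so this identity would put 1 into the
      proper ideal I.\<close>
    ultimately obtain x y where xy: "n * x = p * y + 1" using bezout_nat[of n p] by auto
    have "[(n * x)] \<cdot>\<^bsub>R\<^esub> \<one>\<^bsub>R\<^esub> = [x] \<cdot>\<^bsub>R\<^esub> ([n] \<cdot>\<^bsub>R\<^esub> \<one>\<^bsub>R\<^esub>)" by (simp add: R.add.nat_pow_pow)
    also have "\<dots> = [x] \<cdot>\<^bsub>R\<^esub> \<one>\<^bsub>R\<^esub> \<otimes>\<^bsub>R\<^esub> ([n] \<cdot>\<^bsub>R\<^esub> \<one>\<^bsub>R\<^esub>)" by (rule R.add_pow_as_mult) simp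
    also have "\<dots> \<in> I" using nI by (intro I.I_l_closed) auto
    finally have "[(p * y)] \<cdot>\<^bsub>R\<^esub> \<one>\<^bsub>R\<^esub> \<oplus>\<^bsub>R\<^esub> \<one>\<^bsub>R\<^esub> \<in> I" unfolding xy by (simp add: R.add.nat_pow_mult[symmetric])
    moreover have "[(p * y)] \<cdot>\<^bsub>R\<^esub> \<one>\<^bsub>R\<^esub> = \<zero>\<^bsub>R\<^esub>" by (intro R.nat_multiple_eq_zero[OF p0]) auto
    ultimately show False using I.one_imp_carrier I(2) by simp
  qed
qed

lemma has_char_zero: "has_char A p \<Longrightarrow> [p] \<cdot>\<^bsub>A\<^esub> \<one>\<^bsub>A\<^esub> = \<zero>\<^bsub>A\<^esub>"
  by (simp add: has_char_def)

text \<open>Collects the transfer from C to A: the dimension inequality moves the bound on i, the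
  image of a sequence still generates the maximal ideal up to radical, and the Cech comparison moves
  nilpotency back.\<close>

lemma weakly_F_nilpotent_descent:
  fixes A (structure) and C :: "('b, 'n) ring_scheme"
  assumes nil: "weakly_F_nilpotent p C" and A: "noetherian_local_ring A" "has_char A p" "domain A"
    and fin: "finite_ring_hom A C \<psi> B"
    and theta: "abelian_group_hom C A \<theta>" "\<theta> \<one>\<^bsub>C\<^esub> = \<one>"
    and semilinear: "\<And>a c. \<lbrakk>a \<in> carrier A; c \<in> carrier C\<rbrakk> \<Longrightarrow> \<theta> (\<psi> a \<otimes>\<^bsub>C\<^esub> c) = a [^] (p ^ e) \<otimes> \<theta> c"
  shows "weakly_F_nilpotent p A"
proof -
  have p: "Factorial_Ring.prime p" and C: "noetherian_local_ring C" "has_char C p"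
    using nil by (auto simp: weakly_F_nilpotent_def)
  interpret finite_ring_hom A C \<psi> B by fact
  interpret A: domain A by fact
  interpret theta: abelian_group_hom C A \<theta> by fact
  \<comment> \<open>Semilinearity at c = 1 gives a^q = \<theta>(\<psi>(a)) = 0, and A is a
    domain.\<close>
  have inj: "a = \<zero>" if a: "a \<in> carrier A" "\<psi> a = \<zero>\<^bsub>C\<^esub>" for a
  proof -
    have "a [^] (p ^ e) = \<theta> (\<psi> a \<otimes>\<^bsub>C\<^esub> \<one>\<^bsub>C\<^esub>)" using semilinear[OF a(1), of "\<one>\<^bsub>C\<^esub>"] a theta(2) by simp
    also have "\<dots> = \<zero>" using a(2) theta.hom_zero by simp
    finally show ?thesis using primeideal.power_mem_imp_mem[OF A.zeroprimeideal a(1)] by simp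
  qed
  interpret finite_local_hom A C \<psi> B
    by unfold_locales (use A C inj in \<open>auto simp: noetherian_local_ring_def\<close>)
  have dim: "krull_dim A \<le> krull_dim C" by (rule krull_dim_le[OF inj])
  show ?thesis
    unfolding weakly_F_nilpotent_def
  proof (intro conjI p A(1,2) allI impI)
    fix xs i assume xs: "set xs \<subseteq> carrier A \<and> radical A (genideal A (set xs)) = max_ideal A"
      and i: "enat i < krull_dim A"
    have xsC: "set (map \<psi> xs) \<subseteq> carrier C" using xs by auto
    have "radical C (genideal C (set (map \<psi> xs))) = max_ideal C"
      using radical_genideal_image[OF p has_char_zero[OF C(2)], of "set xs"] xs by simp
    moreover have "enat i < krull_dim C" using i dim by (rule less_le_trans)
    ultimately have "\<forall>\<xi> \<in> carrier (local_cohomology C (map \<psi> xs) i).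
        \<exists>n. (frobenius_action p C (map \<psi> xs) i ^^ n) \<xi> = \<one>\<^bsub>local_cohomology C (map \<psi> xs) i\<^esub>"
      using nil xsC unfolding weakly_F_nilpotent_def by blast
    then show "\<forall>\<xi> \<in> carrier (local_cohomology A xs i).
        \<exists>n. (frobenius_action p A xs i ^^ n) \<xi> = \<one>\<^bsub>local_cohomology A xs i\<^esub>"
      using xs xsC p has_char_zero[OF A(2)] has_char_zero[OF C(2)]
      by (intro frobenius_nilpotent_descent[where \<psi> = \<psi> and C = C, OF _ _ _ theta semilinear])
        (auto intro!: cech_complex.intro cech_complex_axioms.intro R.is_cring S.is_cring ring.ring_hom_ring_axioms)
  qed
qed

theorem proposition2p12:
  fixes p :: nat
    and R :: "('a, 'm) ring_scheme"
    and S :: "('b, 'n) ring_scheme"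
    and \<phi> :: "'a \<Rightarrow> 'b"
    and P :: "'a set"
  assumes "Factorial_Ring.prime p"
    and "noetherian_local_ring R" and "has_char R p"
    and "noetherian_local_ring S" and "has_char S p"
    and "\<phi> \<in> ring_hom R S"
    and "fin_gen_module R (scalar_restriction S \<phi>)"
    and "flat_module R (scalar_restriction S \<phi>)"
    and "primeideal P R"
    and "weakly_F_nilpotent p (S Quot (radical S (genideal S (\<phi> ` P))))"
  shows "weakly_F_nilpotent p (R Quot P)"
proof -
  note p = assms(1)
  interpret R: noetherian_ring R using assms(2) by (simp add: noetherian_local_ring_def)
  interpret S: noetherian_ring S using assms(4) by (simp add: noetherian_local_ring_def)
  have R: "local_ring R" and S: "local_ring S" using assms(2,4) by (simp_all add: noetherian_local_ring_def)
  interpret R: cring R using R by (simp add: local_ring_def)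
  interpret S: cring S using S by (simp add: local_ring_def)
  interpret P: primeideal P R by fact
  interpret phi: ring_hom_cring R S \<phi> by (rule ring_hom_cringI[OF R.is_cring S.is_cring assms(6)])
  note pR = has_char_zero[OF assms(3)] and pS = has_char_zero[OF assms(5)]
  have "\<not> p dvd 1" using prime_gt_1_nat[OF p] by simp
  then have "[(1::nat)] \<cdot>\<^bsub>S\<^esub> \<one>\<^bsub>S\<^esub> \<noteq> \<zero>\<^bsub>S\<^esub>" using assms(5) unfolding has_char_def by blast
  then have ne: "\<one>\<^bsub>S\<^esub> \<noteq> \<zero>\<^bsub>S\<^esub>" by simp
  obtain \<rho> where rho: "abelian_group_hom S R \<rho>" "\<rho> \<one>\<^bsub>S\<^esub> = \<one>\<^bsub>R\<^esub>"
    and lin: "\<And>r s. \<lbrakk>r \<in> carrier R; s \<in> carrier S\<rbrakk> \<Longrightarrow> \<rho> (\<phi> r \<otimes>\<^bsub>S\<^esub> s) = r \<otimes>\<^bsub>R\<^esub> \<rho> s"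
    by (rule flat_local_splitting[OF R S.is_cring ne assms(6-8)]) blast
  interpret rho: abelian_group_hom S R \<rho> by fact
  let ?PS = "genideal S (\<phi> ` P)"
  let ?J = "radical S ?PS"
  have phiP: "\<phi> ` P \<subseteq> carrier S" by auto
  interpret PS: ideal ?PS S by (rule S.genideal_ideal[OF phiP])
  interpret J: ideal ?J S by (rule S.radical_ideal[OF p pS PS.is_ideal])
  have PSJ: "?PS \<subseteq> ?J"
  proof
    fix x assume x: "x \<in> ?PS"
    then have "x [^]\<^bsub>S\<^esub> (1::nat) \<in> ?PS" by simp
    moreover have "x \<in> carrier S" using x by simp
    ultimately show "x \<in> ?J" unfolding radical_def by blast
  qed
  have rhoP: "\<rho> x \<in> P" if x: "x \<in> ?PS" for x
  proof -
    \<comment> \<open>Since \<open>\<rho>\<close> is only R-linear, the preimage of P need not be an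
      ideal of S. This is the largest ideal inside it, and it contains \<phi>(P) because \<rho>(t
      \<phi>(r)) = r \<rho>(t).\<close>
    let ?V = "{x \<in> carrier S. \<forall>t\<in>carrier S. \<rho> (t \<otimes>\<^bsub>S\<^esub> x) \<in> P}"
    have "ideal ?V S"
    proof (rule idealI[OF S.ring_axioms])
      show "subgroup ?V (add_monoid S)"
      proof (rule group.subgroupI[OF S.a_group])
        show "?V \<subseteq> carrier (add_monoid S)" by auto
        have "\<zero>\<^bsub>S\<^esub> \<in> ?V" using P.zero_closed by (simp add: rho.hom_zero)
        then show "?V \<noteq> {}" by blast
      next
        fix x assume "x \<in> ?V"
        then have "\<ominus>\<^bsub>S\<^esub> x \<in> ?V" by (simp add: S.r_minus rho.hom_a_inv)
        then show "inv\<^bsub>add_monoid S\<^esub> x \<in> ?V" unfolding a_inv_def .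
      next
        fix x y assume "x \<in> ?V" "y \<in> ?V"
        then show "x \<otimes>\<^bsub>add_monoid S\<^esub> y \<in> ?V" by (simp add: S.r_distr)
      qed
      fix x s assume x: "x \<in> ?V" and s: "s \<in> carrier S"
      then show "s \<otimes>\<^bsub>S\<^esub> x \<in> ?V" by (simp add: S.m_assoc[symmetric])
      then show "x \<otimes>\<^bsub>S\<^esub> s \<in> ?V" using x s by (simp add: S.m_comm)
    qed
    moreover have "\<phi> ` P \<subseteq> ?V"
      using lin by (auto simp: S.m_comm[of _ "\<phi> _"] intro!: P.I_r_closed)
    ultimately have "?PS \<subseteq> ?V" by (rule S.genideal_minimal)
    with x have "\<rho> (\<one>\<^bsub>S\<^esub> \<otimes>\<^bsub>S\<^esub> x) \<in> P" by blast
    then show ?thesis using x by simp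
  qed
  \<comment> \<open>Each of the finitely many generators of the radical has its own exponent; their
    sum works for all. It then works for the whole radical, because the elements whose p^e-th power
    lies in PS form an ideal.\<close>
  obtain e where e: "\<And>z. z \<in> ?J \<Longrightarrow> z [^]\<^bsub>S\<^esub> (p ^ e) \<in> ?PS"
  proof -
    obtain F where F: "F \<subseteq> carrier S" "finite F" "?J = genideal S F" using S.finetely_gen[OF J.is_ideal] by blast
    have "\<forall>g\<in>F. \<exists>f. g [^]\<^bsub>S\<^esub> (p ^ f) \<in> ?PS"
      using S.genideal_self[OF F(1)] F(1,3) S.radical_iff_frobenius_power[OF p PS.is_ideal] by blast
    then obtain f where f: "\<And>g. g \<in> F \<Longrightarrow> g [^]\<^bsub>S\<^esub> (p ^ f g) \<in> ?PS" by metis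
    let ?e = "sum f F"
    have "g [^]\<^bsub>S\<^esub> (p ^ ?e) \<in> ?PS" if g: "g \<in> F" for g
    proof (rule PS.power_mem_mono[OF f[OF g]])
      show "p ^ f g \<le> p ^ ?e"
        using member_le_sum[OF g, of f] F(2) prime_ge_1_nat[OF p] by (intro power_increasing) auto
    qed (use g F in auto)
    then have "F \<subseteq> {z \<in> carrier S. z [^]\<^bsub>S\<^esub> (p ^ ?e) \<in> ?PS}" using F(1) by blast
    then have "?J \<subseteq> {z \<in> carrier S. z [^]\<^bsub>S\<^esub> (p ^ ?e) \<in> ?PS}"
      unfolding F(3) by (rule S.genideal_minimal[OF S.frobenius_preimage_ideal[OF p pS PS.is_ideal]])
    then show thesis by (intro that[of ?e]) blast
  qed
  let ?A = "R Quot P" and ?C = "S Quot ?J"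
  let ?q = "p ^ e"
  interpret A: domain ?A by (rule P.quotient_is_domain)
  interpret C: cring ?C by (rule J.quotient_is_cring[OF S.is_cring])
  interpret piA: ring_hom_ring R ?A "(+>\<^bsub>R\<^esub>) P" by (rule P.rcos_ring_hom_ring)
  interpret piC: ring_hom_ring S ?C "(+>\<^bsub>S\<^esub>) ?J" by (rule J.rcos_ring_hom_ring)
  define \<psi> where "\<psi> U = (\<Union>r\<in>U. ?J +>\<^bsub>S\<^esub> \<phi> r)" for U
  define \<theta> where "\<theta> V = (\<Union>s\<in>V. P +>\<^bsub>R\<^esub> \<rho> (s [^]\<^bsub>S\<^esub> ?q))" for V
  have psi: "\<psi> (P +>\<^bsub>R\<^esub> r) = ?J +>\<^bsub>S\<^esub> \<phi> r" if r: "r \<in> carrier R" for r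
    unfolding \<psi>_def
  proof (rule P.UN_coset[OF r])
    fix y assume y: "y \<in> carrier R" "y \<ominus>\<^bsub>R\<^esub> r \<in> P"
    then have "\<phi> (y \<ominus>\<^bsub>R\<^esub> r) \<in> ?J" using S.genideal_self[OF phiP] PSJ by blast
    then show "?J +>\<^bsub>S\<^esub> \<phi> y = ?J +>\<^bsub>S\<^esub> \<phi> r"
      using y r by (simp add: J.coset_eq_iff R.minus_eq S.minus_eq)
  qed
  have frob: "abelian_group_hom S S (\<lambda>s. s [^]\<^bsub>S\<^esub> ?q)" by (rule S.frobenius_hom[OF p pS])
  interpret frob: abelian_group_hom S S "\<lambda>s. s [^]\<^bsub>S\<^esub> ?q" by (rule frob)
  \<comment> \<open>Independence of the representative: if y - s is in the radical, then y^q - s^q =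
    (y - s)^q lies in PS, and \<open>\<rho>\<close> sends it into P.\<close>
  have theta: "\<theta> (?J +>\<^bsub>S\<^esub> s) = P +>\<^bsub>R\<^esub> \<rho> (s [^]\<^bsub>S\<^esub> ?q)" if s: "s \<in> carrier S" for s
    unfolding \<theta>_def
  proof (rule J.UN_coset[OF s])
    fix y assume y: "y \<in> carrier S" "y \<ominus>\<^bsub>S\<^esub> s \<in> ?J"
    then have "\<rho> ((y \<ominus>\<^bsub>S\<^esub> s) [^]\<^bsub>S\<^esub> ?q) \<in> P" by (intro rhoP e)
    moreover have "(y \<ominus>\<^bsub>S\<^esub> s) [^]\<^bsub>S\<^esub> ?q = y [^]\<^bsub>S\<^esub> ?q \<oplus>\<^bsub>S\<^esub> \<ominus>\<^bsub>S\<^esub> (s [^]\<^bsub>S\<^esub> ?q)"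
      using y(1) s frob.hom_add[of y "\<ominus>\<^bsub>S\<^esub> s"] frob.hom_a_inv[of s] by (simp add: S.minus_eq)
    ultimately have "\<rho> (y [^]\<^bsub>S\<^esub> ?q) \<ominus>\<^bsub>R\<^esub> \<rho> (s [^]\<^bsub>S\<^esub> ?q) \<in> P"
      using y(1) s by (simp add: rho.hom_a_inv R.minus_eq)
    then show "P +>\<^bsub>R\<^esub> \<rho> (y [^]\<^bsub>S\<^esub> ?q) = P +>\<^bsub>R\<^esub> \<rho> (s [^]\<^bsub>S\<^esub> ?q)"
      using y(1) s by (simp add: P.coset_eq_iff)
  qed
  have psi_hom: "\<psi> \<in> ring_hom ?A ?C"
  proof (rule ring_hom_memI)
    fix U assume "U \<in> carrier ?A"
    then obtain r where "r \<in> carrier R" "U = P +>\<^bsub>R\<^esub> r" by (rule Quot_cases)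
    then show "\<psi> U \<in> carrier ?C" by (simp add: psi)
  next
    fix U V assume "U \<in> carrier ?A" "V \<in> carrier ?A"
    then obtain r s where rs: "r \<in> carrier R" "U = P +>\<^bsub>R\<^esub> r" "s \<in> carrier R" "V = P +>\<^bsub>R\<^esub> s"
      by (metis Quot_cases)
    have "U \<otimes>\<^bsub>?A\<^esub> V = P +>\<^bsub>R\<^esub> (r \<otimes>\<^bsub>R\<^esub> s)" "U \<oplus>\<^bsub>?A\<^esub> V = P +>\<^bsub>R\<^esub> (r \<oplus>\<^bsub>R\<^esub> s)" using rs by simp_all
    then show "\<psi> (U \<otimes>\<^bsub>?A\<^esub> V) = \<psi> U \<otimes>\<^bsub>?C\<^esub> \<psi> V" "\<psi> (U \<oplus>\<^bsub>?A\<^esub> V) = \<psi> U \<oplus>\<^bsub>?C\<^esub> \<psi> V"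
      using rs by (simp_all add: psi del: piA.hom_mult piA.hom_add)
  next
    have "\<one>\<^bsub>?A\<^esub> = P +>\<^bsub>R\<^esub> \<one>\<^bsub>R\<^esub>" by simp
    then show "\<psi> \<one>\<^bsub>?A\<^esub> = \<one>\<^bsub>?C\<^esub>" by (simp add: psi del: piA.hom_one)
  qed
  obtain B where "finite_ring_hom R S \<phi> B"
    by (rule finite_ring_hom_of_fin_gen[OF R.is_cring S.is_cring assms(6,7)])
  then interpret B: finite_ring_hom R S \<phi> B .
  let ?B = "(\<lambda>b. ?J +>\<^bsub>S\<^esub> b) ` B"
  have fam: "finite_family ?A ?C \<psi> ?B"
    using B.finite_B B.B_closed
    by (intro finite_family.intro finite_family_axioms.intro ring_hom_cringI A.is_cring C.is_cring psi_hom) auto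
  interpret D: finite_family ?A ?C \<psi> ?B by (rule fam)
  \<comment> \<open>Different elements of B may have equal classes, so a sum over B is not literally
    a combination over \<open>?B\<close>. Putting each summand into the additive span of
    \<open>?B\<close> avoids regrouping.\<close>
  interpret E: additive_subgroup "D.extension (carrier ?A)" ?C by (rule D.extension_subgroup[OF A.oneideal])
  have fin: "finite_ring_hom ?A ?C \<psi> ?B"
  proof (intro finite_ring_hom.intro fam finite_ring_hom_axioms.intro)
    fix V assume "V \<in> carrier ?C"
    then obtain s where s: "s \<in> carrier S" "V = ?J +>\<^bsub>S\<^esub> s" by (rule Quot_cases)
    obtain c where c: "c \<in> B \<rightarrow> carrier R" "s = B.comb c" using B.generates[OF s(1)] by blast
    have cb: "c b \<in> carrier R" "b \<in> carrier S" if "b \<in> B" for b using that c(1) B.B_closed by auto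
    have "V = (\<Oplus>\<^bsub>?C\<^esub>b\<in>B. ?J +>\<^bsub>S\<^esub> (\<phi> (c b) \<otimes>\<^bsub>S\<^esub> b))"
      unfolding s(2) c(2) B.comb_def
    proof (rule piC.add_hom_finsum[OF B.finite_B])
      fix b assume "b \<in> B"
      then show "\<phi> (c b) \<otimes>\<^bsub>S\<^esub> b \<in> carrier S" using cb by simp
    qed
    also have "\<dots> \<in> D.extension (carrier ?A)"
    proof (rule E.finsum_mem[OF C.is_abelian_group B.finite_B])
      fix b assume b: "b \<in> B"
      let ?d = "\<lambda>v. if v = ?J +>\<^bsub>S\<^esub> b then \<one>\<^bsub>?A\<^esub> else \<zero>\<^bsub>?A\<^esub>"
      have "?J +>\<^bsub>S\<^esub> (\<phi> (c b) \<otimes>\<^bsub>S\<^esub> b) = \<psi> (P +>\<^bsub>R\<^esub> c b) \<otimes>\<^bsub>?C\<^esub> D.comb ?d"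
        using cb[OF b] D.comb_delta[of "?J +>\<^bsub>S\<^esub> b"] b by (simp add: psi)
      also have "\<dots> = D.comb (\<lambda>v. (P +>\<^bsub>R\<^esub> c b) \<otimes>\<^bsub>?A\<^esub> ?d v)"
        using cb[OF b] by (intro D.comb_smult) auto
      also have "\<dots> \<in> D.extension (carrier ?A)"
        unfolding D.extension_def using cb[OF b] by (intro imageI) auto
      finally show "?J +>\<^bsub>S\<^esub> (\<phi> (c b) \<otimes>\<^bsub>S\<^esub> b) \<in> D.extension (carrier ?A)" .
    qed
    finally show "\<exists>c\<in>?B \<rightarrow> carrier ?A. V = D.comb c" unfolding D.extension_def by blast
  qed
  have theta_hom: "abelian_group_hom ?C ?A \<theta>"
  proof (intro abelian_group_homI C.is_abelian_group A.is_abelian_group group_hom.intro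
        group_hom_axioms.intro C.a_group A.a_group homI)
    fix U assume "U \<in> carrier (add_monoid ?C)"
    then obtain s where "s \<in> carrier S" "U = ?J +>\<^bsub>S\<^esub> s" by (auto elim: Quot_cases)
    then show "\<theta> U \<in> carrier (add_monoid ?A)" by (simp add: theta)
  next
    fix U V assume "U \<in> carrier (add_monoid ?C)" "V \<in> carrier (add_monoid ?C)"
    then obtain s t where st: "s \<in> carrier S" "U = ?J +>\<^bsub>S\<^esub> s" "t \<in> carrier S" "V = ?J +>\<^bsub>S\<^esub> t"
      by (metis Quot_cases partial_object.select_convs(1))
    have "U \<oplus>\<^bsub>?C\<^esub> V = ?J +>\<^bsub>S\<^esub> (s \<oplus>\<^bsub>S\<^esub> t)" using st by simp
    then have "\<theta> (U \<oplus>\<^bsub>?C\<^esub> V) = \<theta> U \<oplus>\<^bsub>?A\<^esub> \<theta> V"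
      using st frob.hom_add[of s t] by (simp add: theta del: piC.hom_add)
    then show "\<theta> (U \<otimes>\<^bsub>add_monoid ?C\<^esub> V) = \<theta> U \<otimes>\<^bsub>add_monoid ?A\<^esub> \<theta> V" by simp
  qed
  have theta_one: "\<theta> \<one>\<^bsub>?C\<^esub> = \<one>\<^bsub>?A\<^esub>"
    using theta[OF S.one_closed] rho(2) by simp
  have semilinear: "\<theta> (\<psi> a \<otimes>\<^bsub>?C\<^esub> c) = a [^]\<^bsub>?A\<^esub> ?q \<otimes>\<^bsub>?A\<^esub> \<theta> c"
    if a: "a \<in> carrier ?A" and c: "c \<in> carrier ?C" for a c
  proof -
    obtain r where r: "r \<in> carrier R" "a = P +>\<^bsub>R\<^esub> r" using a by (rule Quot_cases)
    obtain s where s: "s \<in> carrier S" "c = ?J +>\<^bsub>S\<^esub> s" using c by (rule Quot_cases)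
    have "\<psi> a \<otimes>\<^bsub>?C\<^esub> c = ?J +>\<^bsub>S\<^esub> (\<phi> r \<otimes>\<^bsub>S\<^esub> s)" using r s by (simp add: psi)
    then have "\<theta> (\<psi> a \<otimes>\<^bsub>?C\<^esub> c) = \<theta> (?J +>\<^bsub>S\<^esub> (\<phi> r \<otimes>\<^bsub>S\<^esub> s))" by (rule arg_cong)
    also have "\<dots> = P +>\<^bsub>R\<^esub> \<rho> ((\<phi> r \<otimes>\<^bsub>S\<^esub> s) [^]\<^bsub>S\<^esub> ?q)" using r s by (intro theta) simp
    also have "(\<phi> r \<otimes>\<^bsub>S\<^esub> s) [^]\<^bsub>S\<^esub> ?q = \<phi> (r [^]\<^bsub>R\<^esub> ?q) \<otimes>\<^bsub>S\<^esub> s [^]\<^bsub>S\<^esub> ?q"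
      using r s by (simp add: S.nat_pow_distrib phi.ring.hom_nat_pow)
    also have "\<rho> \<dots> = r [^]\<^bsub>R\<^esub> ?q \<otimes>\<^bsub>R\<^esub> \<rho> (s [^]\<^bsub>S\<^esub> ?q)" using r s by (intro lin) auto
    also have "P +>\<^bsub>R\<^esub> \<dots> = (P +>\<^bsub>R\<^esub> r) [^]\<^bsub>?A\<^esub> ?q \<otimes>\<^bsub>?A\<^esub> (P +>\<^bsub>R\<^esub> \<rho> (s [^]\<^bsub>S\<^esub> ?q))"
      using r s by (simp add: piA.hom_nat_pow)
    finally show ?thesis using r s by (simp add: theta)
  qed
  have Pne: "P \<noteq> carrier R" using P.I_notcarr by simp
  show ?thesis
  proof (rule weakly_F_nilpotent_descent[OF assms(10) _ _ A.domain_axioms fin theta_hom theta_one semilinear])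
    show "noetherian_local_ring ?A" unfolding noetherian_local_ring_def
      using R.noetherian_quotient[OF R.is_cring P.is_ideal] local_ring_quotient[OF R P.is_ideal Pne] by blast
    show "has_char ?A p" by (rule has_char_quotient[OF p R.is_cring assms(3) P.is_ideal Pne])
  qed
qed

end
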